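(* Let $c\in[1,16/15)$, $\gamma=1/c$, $h\in\mathcal{F}_c$ and let $\varphi$ be the inverse function of $h$. Let $r>\frac{26-24\gamma}{16\gamma-15}$ be a real number. Then there is a finite constant $C_{r,\gamma}>0$ such that for all integers $m,N\in\mathbb{N}$ and $b\ge 0$ with $1\le m\le\log N$, $0\le b\le m-1$, $(b,m)=1$, and for all functions $f\in L^2(\Lambda^h_{b,m,N},\lambda^h_{b,m,N})$, $$\|T_hf\|_{L^r(\mathbb{T})}\le C_{r,\gamma}N^{-1/r}\|f\|_{L^2(\Lambda^h_{b,m,N},\lambda^h_{b,m,N})},$$ where $T_h:\mathcal{C}(\Lambda^h_{b,m,N})\to\mathcal{C}(\mathbb{T})$ is the linear operator $T_h(f)(\xi)=\sum_{n\in\mathbb{Z}}f(n)\lambda^h_{b,m,N}(n)e^{2\pi i\xi n}$.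
   Context: $\mathbf{P}$ is the set of primes, $\mathbb{T}=\mathbb{R}/\mathbb{Z}$, $\phi$ is Euler's totient function. For $c\in[1,2)$, $\mathcal{F}_c$ is the family of all functions $h:[x_0,\infty)\to[1,\infty)$ (for some $x_0\ge1$) satisfying: (i) $h\in\mathcal{C}^3([x_0,\infty))$ and $h'(x)>0$, $h''(x)>0$ for every $x\ge x_0$; (ii) there exist a real-valued function $\vartheta\in\mathcal{C}^2([x_0,\infty))$ and a constant $C_h>0$ such that $h(x)=C_hx^c\ell_h(x)$ with $\ell_h(x)=\exp\big(\int_{x_0}^x\frac{\vartheta(t)}{t}dt\big)$ for every $x\ge x_0$, and if $c>1$, then $\lim_{x\to\infty}\vartheta(x)=\lim_{x\to\infty}x\vartheta'(x)=\lim_{x\to\infty}x^2\vartheta''(x)=0$; (iii) if $c=1$, then $\vartheta$ is positive, decreasing, for every $\varepsilon>0$ one has $\frac1{\vartheta(x)}\lesssim_\varepsilon x^\varepsilon$, $\lim_{x\to\infty}\frac{x}{h(x)}=0$, and $\lim_{x\to\infty}\vartheta(x)=\lim_{x\to\infty}\frac{x\vartheta'(x)}{\vartheta(x)}=\lim_{x\to\infty}\frac{x^2\vartheta''(x)}{\vartheta(x)}=0$. $\mathbf{P}_h=\{p\in\mathbf{P}:\ \exists_{n\in\mathbb{N}}\ p=\lfloor h(n)\rfloor\}$ ($n$ ranging over positive integers in the domain of $h$). Define $\Lambda^h_{b,m,N}=\{0\le n\le N:\ mn+b\in\mathbf{P}_h\}$ and $$\lambda^h_{b,m,N}(n)=\frac{\phi(m)\log(mn+b)}{mN\varphi'(mn+b)}\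 \text{ if } n\in\Lambda^h_{b,m,N},\qquad \lambda^h_{b,m,N}(n)=0\ \text{ otherwise.}$$ The finitely many $n$ with $mn+b<h(x_0)$, where $\varphi$ is undefined, are disregarded. The norm is $\|f\|^2_{L^2(\Lambda^h_{b,m,N},\lambda^h_{b,m,N})}=\sum_{n\in\Lambda^h_{b,m,N}}|f(n)|^2\lambda^h_{b,m,N}(n)$. $\mathcal{C}(X)$ is the space of continuous functions on $X$. The function $h$ is fixed, so $C_{r,\gamma}$ may depend on it, but not on $b,m,N,f$. *)

theory Defs
  imports "HOL-Analysis.Analysis" "HOL-Number_Theory.Totient"
begin

(* Derivative relative to S, hence one-sided at the endpoint of a half-line. *)
definition deriv_on :: "real set \<Rightarrow> (real \<Rightarrow> real) \<Rightarrow> real \<Rightarrow> real" where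
  "deriv_on S f x = vector_derivative f (at x within S)"

fun C_k_on :: "nat \<Rightarrow> (real \<Rightarrow> real) \<Rightarrow> real set \<Rightarrow> bool" where
  "C_k_on 0 f S \<longleftrightarrow> continuous_on S f"
| "C_k_on (Suc k) f S \<longleftrightarrow> f differentiable_on S \<and> C_k_on k (deriv_on S f) S"

(* h \<in> F_class c x0 means that h belongs to the family F_c with domain [x0, \<infinity>); the values of
   h and \<theta> to the left of x0 play no role.  "Decreasing" is read as non-increasing. *)
definition F_class :: "real \<Rightarrow> real \<Rightarrow> (real \<Rightarrow> real) set" where
  "F_class c x0 = {h.
     1 \<le> x0 \<and> (\<forall>x\<ge>x0. 1 \<le> h x) \<and>
     C_k_on 3 h {x0..} \<and>
     (\<forall>x\<ge>x0. 0 < deriv_on {x0..} h x \<and> 0 < (deriv_on {x0..} ^^ 2) h x) \<and>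
     (\<exists>\<theta> C\<^sub>h. C_k_on 2 \<theta> {x0..} \<and> 0 < C\<^sub>h \<and>
        (\<forall>x\<ge>x0. h x = C\<^sub>h * x powr c * exp (integral {x0..x} (\<lambda>t. \<theta> t / t))) \<and>
        (c > 1 \<longrightarrow>
           (\<theta> \<longlongrightarrow> 0) at_top \<and>
           ((\<lambda>x. x * deriv_on {x0..} \<theta> x) \<longlongrightarrow> 0) at_top \<and>
           ((\<lambda>x. x\<^sup>2 * (deriv_on {x0..} ^^ 2) \<theta> x) \<longlongrightarrow> 0) at_top) \<and>
        (c = 1 \<longrightarrow>
           (\<forall>x\<ge>x0. 0 < \<theta> x) \<and>
           antimono_on {x0..} \<theta> \<and>
           (\<forall>\<epsilon>>0. \<exists>K>0. \<forall>x\<ge>x0. 1 / \<theta> x \<le> K * x powr \<epsilon>) \<and>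
           ((\<lambda>x. x / h x) \<longlongrightarrow> 0) at_top \<and>
           (\<theta> \<longlongrightarrow> 0) at_top \<and>
           ((\<lambda>x. x * deriv_on {x0..} \<theta> x / \<theta> x) \<longlongrightarrow> 0) at_top \<and>
           ((\<lambda>x. x\<^sup>2 * (deriv_on {x0..} ^^ 2) \<theta> x / \<theta> x) \<longlongrightarrow> 0) at_top))}"

definition P_set :: "(real \<Rightarrow> real) \<Rightarrow> real \<Rightarrow> nat set" where
  "P_set h x0 = {p. prime p \<and> (\<exists>n::nat. 1 \<le> n \<and> x0 \<le> real n \<and> int p = \<lfloor>h (real n)\<rfloor>)}"

(* The inverse of h is only defined on [h x0, \<infinity>).  The finitely many n with m * n + b < h x0,
   where the weight makes no sense, are left out of the set. *)
definition Lambda_set :: "(real \<Rightarrow> real) \<Rightarrow> real \<Rightarrow> nat \<Rightarrow> nat \<Rightarrow> nat \<Rightarrow> nat set" where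
  "Lambda_set h x0 b m N =
     {n. n \<le> N \<and> m * n + b \<in> P_set h x0 \<and> h x0 \<le> real (m * n + b)}"

(* \<phi> is the inverse function of h, with domain [h x0, \<infinity>). *)
definition lambda_weight ::
  "(real \<Rightarrow> real) \<Rightarrow> real \<Rightarrow> (real \<Rightarrow> real) \<Rightarrow> nat \<Rightarrow> nat \<Rightarrow> nat \<Rightarrow> nat \<Rightarrow> real" where
  "lambda_weight h x0 \<phi> b m N n =
     (if n \<in> Lambda_set h x0 b m N
      then real (totient m) * ln (real (m * n + b)) /
             (real m * real N * deriv_on {h x0..} \<phi> (real (m * n + b)))
      else 0)"

definition L2_norm_Lambda ::
  "(real \<Rightarrow> real) \<Rightarrow> real \<Rightarrow> (real \<Rightarrow> real) \<Rightarrow> nat \<Rightarrow> nat \<Rightarrow> nat \<Rightarrow> (nat \<Rightarrow> complex) \<Rightarrow> real" where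
  "L2_norm_Lambda h x0 \<phi> b m N f =
     sqrt (\<Sum>n\<in>Lambda_set h x0 b m N. (norm (f n))\<^sup>2 * lambda_weight h x0 \<phi> b m N n)"

(* Functions on the torus R/Z are represented by 1-periodic functions on R.  The sum over all
   integers reduces to the finite set outside of which the weight vanishes. *)
definition T_op ::
  "(real \<Rightarrow> real) \<Rightarrow> real \<Rightarrow> (real \<Rightarrow> real) \<Rightarrow> nat \<Rightarrow> nat \<Rightarrow> nat \<Rightarrow> (nat \<Rightarrow> complex) \<Rightarrow> real \<Rightarrow> complex" where
  "T_op h x0 \<phi> b m N f \<xi> =
     (\<Sum>n\<in>Lambda_set h x0 b m N. f n * of_real (lambda_weight h x0 \<phi> b m N n) *
        exp (2 * of_real pi * \<i> * of_real \<xi> * of_nat n))"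

definition Lr_norm_torus :: "real \<Rightarrow> (real \<Rightarrow> complex) \<Rightarrow> real" where
  "Lr_norm_torus r F = (LINT \<xi>:{0..<1}|lborel. norm (F \<xi>) powr r) powr (1 / r)"

end

theory Submission
  imports Defs "HOL-Number_Theory.Number_Theory" "HOL-Computational_Algebra.Squarefree"
    "HOL-Real_Asymp.Real_Asymp"
begin

text \<open>
  By Cauchy-Schwarz and duality, the estimate for \<open>T f\<close> on a set of \<open>J\<close> points \<open>\<theta> + j / (N + 1)\<close> at which
  \<open>\<bar>T f\<bar>\<close> is large reduces to an upper bound for the weighted mean square of an exponential polynomial
  with \<open>J\<close> frequencies. The weight enters only through majorants, so no asymptotic information about
  primes is needed. The condition \<open>t = \<lfloor>h k\<rfloor>\<close> is majorised by a Fejer kernel at the inverse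
  function, whose nonconstant Fourier coefficients are controlled by a second derivative test for
  exponential sums. The primality of \<open>t\<close> is used through a large sieve restricted to moduli without
  prime factors up to \<open>J\<^sup>2\<close>; it saves a factor of order \<open>ln N\<close> at a cost of \<open>J powr \<epsilon>\<close> only. The resulting
  bounds \<open>\<alpha>\<^sup>2 \<le> C J powr (-\<tau>)\<close> for level sets are summed over the ranks of the values, and integrated
  over \<open>\<theta>\<close>.
\<close>

section \<open>Exponential sums\<close>

text \<open>What has to be beaten is the factor \<open>ln N\<close> in the weight. A set of
  \<open>J\<close> points may lose any power \<open>J powr \<epsilon>\<close>, so once
  \<open>J\<close> exceeds a fixed power of \<open>N\<close> the majorant of the condition
  \<open>t = \<lfloor>h k\<rfloor>\<close> suffices and \<open>ln N\<close> is absorbed; only for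
  \<open>J \<le> N powr (1/1000)\<close> must primality be exploited. There the diagonal of the
  large sieve has size \<open>J * N * G\<close>, with \<open>G\<close> of order \<open>ln N\<close>
  when \<open>m = 1\<close> and up to a small power of \<open>J\<close>, while colliding pairs of
  fractions, counted for each of the \<open>J\<^sup>2\<close> pairs of points, cost
  \<open>J\<^sup>2 * N * G / sqrt z\<close>; this dictates \<open>z = J\<^sup>2\<close>. The
  exponential sums give a Fourier error with exponent \<open>91/100 + (1 - \<gamma>)\<close>, which
  leads to every \<open>\<tau> < (\<gamma> - 91/100) * (100/9)\<close> and then to
  \<open>r > 2 / \<tau>\<close>. The resulting threshold for \<open>r\<close> agrees with that of
  the theorem at \<open>\<gamma> = 1\<close>, where both are 2, and is at most as large for
  \<open>15/16 < \<gamma> \<le> 1\<close>.\<close>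

definition ee :: "real \<Rightarrow> complex" where
  "ee x = cis (2 * pi * x)"

lemma norm_ee [simp]: "norm (ee x) = 1"
  by (simp add: ee_def)

lemma ee_add: "ee (x + y) = ee x * ee y"
  by (simp add: ee_def cis_mult ring_distribs)

lemma cnj_ee: "cnj (ee x) = ee (- x)"
  by (simp add: ee_def cis_cnj)

lemma ee_diff: "ee (x - y) = ee x * cnj (ee y)"
  using ee_add[of x "- y"] by (simp add: cnj_ee)

lemma ee_nat_mult: "ee (real n * x) = ee x ^ n"
  by (simp add: ee_def Complex.DeMoivre mult_ac)

lemma ee_of_int [simp]: "ee (of_int k) = 1"
  unfolding ee_def by (intro cis_multiple_2pi) simp

lemma ee_of_nat [simp]: "ee (of_nat k) = 1"
  using ee_of_int[of "int k"] by simp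

lemma ee_1 [simp]: "ee 1 = 1"
  using ee_of_nat[of 1] by simp

lemma ee_0 [simp]: "ee 0 = 1"
  by (simp add: ee_def)

lemma norm_ee_minus_1: "norm (ee d - 1) = 2 * \<bar>sin (pi * d)\<bar>"
  using dist_exp_i_1[of "2 * pi * d"] by (simp add: ee_def cis_conv_exp)

lemma norm_ee_diff_le: "norm (ee x - ee y) \<le> 2 * pi * \<bar>x - y\<bar>"
proof -
  have "norm (ee x - ee y) = norm (ee y * (ee (x - y) - 1))"
    by (simp add: algebra_simps flip: ee_add)
  also have "\<dots> = 2 * \<bar>sin (pi * (x - y))\<bar>"
    by (simp add: norm_mult norm_ee_minus_1)
  also have "\<dots> \<le> 2 * \<bar>pi * (x - y)\<bar>"
    using abs_sin_x_le_abs_x[of "pi * (x - y)"] by simp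
  finally show ?thesis by (simp add: abs_mult)
qed

text \<open>Up to \<open>pi / 3\<close> the derivative \<open>cos y - 1/2\<close> is nonnegative;
  beyond it the sine is at least \<open>sqrt 3 / 2 \<ge> 0.85\<close>, while
  \<open>x / 2 \<le> pi / 4 < 0.8\<close>. The constant is weaker than in Jordan's inequality but
  sufficient for geometric sums.\<close>

lemma sin_ge_half:
  assumes "0 \<le> x" "x \<le> pi / 2"
  shows "x / 2 \<le> sin (x::real)"
proof (cases "x \<le> pi / 3")
  case True
  have "sin 0 - 0 / 2 \<le> sin x - x / 2"
  proof (rule DERIV_nonneg_imp_nondecreasing[OF assms(1)])
    fix y assume y: "0 \<le> y" "y \<le> x"
    have "cos (pi / 3) \<le> cos y"
      using y True by (intro cos_monotone_0_pi_le) auto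
    hence "0 \<le> cos y - 1 / 2" by (simp add: cos_60)
    moreover have "((\<lambda>x. sin x - x / 2) has_real_derivative (cos y - 1 / 2)) (at y)"
      by (auto intro!: derivative_eq_intros)
    ultimately show "\<exists>z. ((\<lambda>x. sin x - x / 2) has_real_derivative z) (at y) \<and> 0 \<le> z"
      by blast
  qed
  thus ?thesis by simp
next
  case False
  have "sin (pi / 3) \<le> sin x"
    using False assms by (intro sin_monotone_2pi_le) auto
  moreover have "sqrt 3 \<ge> sqrt (1.7\<^sup>2)"
    by (intro real_sqrt_le_mono) (simp add: power2_eq_square)
  moreover have "pi < 3.2" using pi_less_4 pi_approx by simp
  ultimately show ?thesis using assms by (simp add: sin_60)
qed

text \<open>The distance of \<open>d\<close> to the nearest integer is at most 1/2, so the argument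
  of the sine falls into \<open>[0, pi / 2]\<close>, where \<open>sin_ge_half\<close> turns the
  chord length into a multiple of this distance.\<close>

lemma norm_ee_minus_1_ge:
  assumes "\<And>k::int. \<rho> \<le> \<bar>d - of_int k\<bar>"
  shows "2 * \<rho> \<le> norm (ee d - 1)"
proof -
  define k where "k = round d"
  define t where "t = \<bar>d - of_int k\<bar>"
  have t: "0 \<le> t" "t \<le> 1 / 2" "\<rho> \<le> t"
    using assms[of k] of_int_round_abs_le[of d] by (auto simp: t_def k_def abs_minus_commute)
  have "pi * t \<le> pi * (1 / 2)" using t by (intro mult_left_mono) auto
  hence "pi * t / 2 \<le> sin (pi * t)"
    using t by (intro sin_ge_half) auto
  moreover have "ee d = ee (d - of_int k)" by (simp add: ee_diff)
  hence "norm (ee d - 1) = 2 * \<bar>sin (pi * t)\<bar>"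
    using sin_minus[of "pi * (d - of_int k)"] by (simp add: norm_ee_minus_1 t_def abs_if algebra_simps)
  moreover have "2 * t \<le> pi * t" using t pi_ge_two by (intro mult_right_mono) auto
  ultimately show ?thesis using t by linarith
qed

lemma norm_sum_ee_le:
  assumes "\<And>k::int. \<rho> \<le> \<bar>d - of_int k\<bar>" "0 < \<rho>"
  shows "norm (\<Sum>l<L. ee (real l * d)) \<le> 1 / \<rho>"
proof -
  have *: "2 * \<rho> \<le> norm (ee d - 1)" using norm_ee_minus_1_ge assms(1) by blast
  hence "ee d \<noteq> 1" using assms(2) by auto
  hence "(\<Sum>l<L. ee (real l * d)) = (ee d ^ L - 1) / (ee d - 1)"
    by (simp add: ee_nat_mult geometric_sum)
  hence "norm (\<Sum>l<L. ee (real l * d)) = norm (ee d ^ L - 1) / norm (ee d - 1)"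
    by (simp add: norm_divide)
  also have "\<dots> \<le> 2 / (2 * \<rho>)"
  proof (rule frac_le)
    show "norm (ee d ^ L - 1) \<le> 2"
      using norm_triangle_ineq4[of "ee d ^ L" 1] by (simp add: norm_power)
  qed (use * assms(2) in auto)
  finally show ?thesis by simp
qed

section \<open>The second derivative test in discrete form\<close>

lemma decreasing_gap:
  fixes d :: "nat \<Rightarrow> real"
  assumes "\<And>n. A \<le> n \<Longrightarrow> n < B \<Longrightarrow> \<kappa> \<le> d n - d (Suc n)"
    and "A \<le> p" "p \<le> q" "q \<le> B"
  shows "\<kappa> * real (q - p) \<le> d p - d q"
  using assms(3,4)
proof (induction q rule: dec_induct)
  case base
  then show ?case by simp
next
  case (step n)
  have "\<kappa> \<le> d n - d (Suc n)" using step assms(1,2) by auto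
  with step show ?case by (simp add: Suc_diff_le algebra_simps)
qed

text \<open>As \<open>d\<close> drops by at least \<kappa> per step, the first and the last index
  whose values fall into a window of length \<open>2 * \<rho>\<close> are at most
  \<open>2 * \<rho> / \<kappa>\<close> apart.\<close>

lemma card_close_le:
  fixes d :: "nat \<Rightarrow> real"
  assumes gap: "\<And>n. A \<le> n \<Longrightarrow> n < B \<Longrightarrow> \<kappa> \<le> d n - d (Suc n)"
    and "0 < \<kappa>" "0 < \<rho>"
  shows "real (card {n\<in>{A..<B}. \<bar>d n - k\<bar> < \<rho>}) \<le> 2 * \<rho> / \<kappa> + 1"
proof (cases "{n\<in>{A..<B}. \<bar>d n - k\<bar> < \<rho>} = {}")
  case True
  show ?thesis unfolding True using assms(2,3) by simp
next
  case False
  let ?S = "{n\<in>{A..<B}. \<bar>d n - k\<bar> < \<rho>}"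
  define p where "p = Min ?S"
  define q where "q = Max ?S"
  have fin: "finite ?S" by simp
  have p: "p \<in> ?S" unfolding p_def by (rule Min_in[OF fin False])
  have q: "q \<in> ?S" unfolding q_def by (rule Max_in[OF fin False])
  have sub: "?S \<subseteq> {p..q}" using Min_le[OF fin] Max_ge[OF fin] by (auto simp: p_def q_def)
  have pq: "p \<le> q" using Min_le[OF fin q] by (simp add: p_def)
  have "\<kappa> * real (q - p) \<le> d p - d q"
    by (rule decreasing_gap[where A = A and B = B]) (use gap p q pq in auto)
  also have "\<dots> \<le> 2 * \<rho>" using p q by (auto simp: abs_if split: if_splits)
  finally have "real (q - p) \<le> 2 * \<rho> / \<kappa>" using assms by (simp add: field_simps)
  moreover have "card ?S \<le> card {p..q}" by (intro card_mono sub) simp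
  ultimately show ?thesis using pq by (simp add: of_nat_diff)
qed

text \<open>Averaging over \<open>L\<close> shifts replaces the sum by sums of length
  \<open>L\<close>, on which \<open>f\<close> is linear up to \<open>L\<^sup>2 * \<Lambda>\<close>;
  these are geometric with ratio \<open>ee (d n)\<close>. The four terms come from the ends of the
  shifted ranges, from the linearisation, from the \<open>n\<close> with \<open>d n\<close> at
  distance at least \<rho> from the integers, and from the remaining \<open>n\<close>. The latter
  are counted integer by integer, using that \<open>d\<close> decreases in steps between \<kappa>
  and \<Lambda>. The step bounds reach up to \<open>B + L\<close> because the shifts leave
  \<open>{A..<B}\<close>.\<close>

lemma vdc_sum:
  fixes f :: "nat \<Rightarrow> real" and A B L :: nat
  defines "d \<equiv> \<lambda>n. f (Suc n) - f n"
  assumes gap: "\<And>n. A \<le> n \<Longrightarrow> n < B + L \<Longrightarrow> \<kappa> \<le> d n - d (Suc n)"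
    and gap': "\<And>n. A \<le> n \<Longrightarrow> n < B + L \<Longrightarrow> d n - d (Suc n) \<le> \<Lambda>"
    and "0 < \<kappa>" "0 < \<rho>" "\<rho> \<le> 1 / 2" "L \<ge> 1" "A \<le> B"
  shows "norm (\<Sum>n=A..<B. ee (f n)) \<le> 2 * real L + 2 * pi * \<Lambda> * (real L)\<^sup>2 * real (B - A)
           + real (B - A) / (\<rho> * real L) + (real (B - A) * \<Lambda> + 2) * (2 * \<rho> / \<kappa> + 1)"
proof (cases "A = B")
  case True
  then show ?thesis using assms by simp
next
  case False
  with \<open>A \<le> B\<close> have AB: "A < B" by simp
  have Lam: "\<kappa> \<le> \<Lambda>" using gap[of A] gap'[of A] AB by simp
  hence Lam0: "0 < \<Lambda>" using \<open>0 < \<kappa>\<close> by simp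
  have gap0: "0 \<le> d n - d (Suc n)" if "A \<le> n" "n < B + L" for n
    using gap[OF that] \<open>0 < \<kappa>\<close> by simp
  define S where "S = (\<Sum>n=A..<B. ee (f n))"
  define W where "W = (\<lambda>n. \<Sum>l<L. ee (f (n + l)))"
  define M where "M = real (B - A)"
  have shift: "norm (S - (\<Sum>n=A..<B. ee (f (n + l)))) \<le> 2 * real l" for l
  proof (induction l)
    case 0
    then show ?case by (simp add: S_def)
  next
    case (Suc l)
    have "(\<Sum>n=A..<B. ee (f (n + l))) - (\<Sum>n=A..<B. ee (f (n + Suc l)))
            = - (\<Sum>n=A..<B. ee (f (Suc n + l)) - ee (f (n + l)))"
      by (simp add: sum_subtractf)
    also have "\<dots> = ee (f (A + l)) - ee (f (B + l))"
      using sum_Suc_diff'[of A B "\<lambda>n. ee (f (n + l))"] AB by simp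
    finally have "norm ((\<Sum>n=A..<B. ee (f (n + l))) - (\<Sum>n=A..<B. ee (f (n + Suc l)))) \<le> 2"
      using norm_triangle_ineq4[of "ee (f (A + l))" "ee (f (B + l))"] by simp
    with Suc show ?case
      using norm_triangle_le[of "S - (\<Sum>n=A..<B. ee (f (n + l)))"
          "(\<Sum>n=A..<B. ee (f (n + l))) - (\<Sum>n=A..<B. ee (f (n + Suc l)))" "2 * real (Suc l)"]
      by (simp add: algebra_simps)
  qed
  have "(\<Sum>n=A..<B. W n) = (\<Sum>l<L. \<Sum>n=A..<B. ee (f (n + l)))"
    unfolding W_def by (rule sum.swap)
  hence "of_nat L * S - (\<Sum>n=A..<B. W n) = (\<Sum>l<L. S - (\<Sum>n=A..<B. ee (f (n + l))))"
    by (simp add: sum_subtractf)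
  also have "norm \<dots> \<le> (\<Sum>l<L. 2 * real L)"
  proof (rule sum_norm_le)
    fix l assume "l \<in> {..<L}"
    thus "norm (S - (\<Sum>n=A..<B. ee (f (n + l)))) \<le> 2 * real L"
      using shift[of l] by simp
  qed
  also have "\<dots> = 2 * (real L)\<^sup>2" by (simp add: power2_eq_square)
  finally have LS: "real L * norm S \<le> norm (\<Sum>n=A..<B. W n) + 2 * (real L)\<^sup>2"
    using norm_triangle_ineq2[of "of_nat L * S" "\<Sum>n=A..<B. W n"] by (simp add: norm_mult)
  have W1: "norm (W n) \<le> 2 * pi * \<Lambda> * (real L) ^ 3 + norm (\<Sum>l<L. ee (real l * d n))"
    if n: "A \<le> n" "n < B" for n
  proof -
    have lin: "\<bar>f (n + l) - (f n + real l * d n)\<bar> \<le> (real L)\<^sup>2 * \<Lambda>" if l: "l < L" for l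
    proof -
      have dd: "\<bar>d (n + i) - d n\<bar> \<le> real L * \<Lambda>" if i: "i < L" for i
      proof -
        have "0 * real (n + i - n) \<le> d n - d (n + i)"
          by (rule decreasing_gap[where A = A and B = "B + L"])
            (use gap0 n i in auto)
        moreover have "(- \<Lambda>) * real (n + i - n) \<le> (- d n) - (- d (n + i))"
          by (rule decreasing_gap[where A = A and B = "B + L"])
            (use gap' n i in \<open>force+\<close>)
        moreover have "\<Lambda> * real i \<le> \<Lambda> * real L" using i Lam0 by (intro mult_left_mono) auto
        ultimately show ?thesis by (simp add: mult.commute)
      qed
      have "f (n + l) - f n = (\<Sum>i<l. d (n + i))"
        unfolding d_def by (induction l) auto
      hence "f (n + l) - (f n + real l * d n) = (\<Sum>i<l. d (n + i) - d n)"
        by (simp add: sum_subtractf)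
      also have "\<bar>\<dots>\<bar> \<le> (\<Sum>i<l. \<bar>d (n + i) - d n\<bar>)" by (rule sum_abs)
      also have "\<dots> \<le> (\<Sum>i<l. real L * \<Lambda>)" using l by (intro sum_mono dd) auto
      also have "\<dots> = real l * (real L * \<Lambda>)" by simp
      also have "\<dots> \<le> real L * (real L * \<Lambda>)" using l Lam0 by (intro mult_right_mono) auto
      finally show ?thesis by (simp add: power2_eq_square mult_ac)
    qed
    have "norm (W n - (\<Sum>l<L. ee (f n + real l * d n)))
            \<le> (\<Sum>l<L. 2 * pi * ((real L)\<^sup>2 * \<Lambda>))"
      unfolding W_def sum_subtractf[symmetric]
    proof (rule sum_norm_le)
      fix l assume "l \<in> {..<L}"
      hence "2 * pi * \<bar>f (n + l) - (f n + real l * d n)\<bar> \<le> 2 * pi * ((real L)\<^sup>2 * \<Lambda>)"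
        by (intro mult_left_mono lin) auto
      thus "norm (ee (f (n + l)) - ee (f n + real l * d n)) \<le> 2 * pi * ((real L)\<^sup>2 * \<Lambda>)"
        using norm_ee_diff_le order_trans by blast
    qed
    moreover have "(\<Sum>l<L. ee (f n + real l * d n)) = ee (f n) * (\<Sum>l<L. ee (real l * d n))"
      by (simp add: ee_add sum_distrib_left)
    ultimately show ?thesis
      using norm_triangle_ineq2[of "W n" "\<Sum>l<L. ee (f n + real l * d n)"]
      by (simp add: norm_mult power3_eq_cube power2_eq_square mult_ac)
  qed
  define bad where "bad = {n\<in>{A..<B}. \<exists>k::int. \<bar>d n - of_int k\<bar> < \<rho>}"
  have W2: "norm (\<Sum>l<L. ee (real l * d n)) \<le> 1 / \<rho> + (if n \<in> bad then real L else 0)"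
    if n: "A \<le> n" "n < B" for n
  proof (cases "n \<in> bad")
    case True
    have "norm (\<Sum>l<L. ee (real l * d n)) \<le> (\<Sum>l<L. 1)"
      by (rule sum_norm_le) simp
    with True show ?thesis using \<open>0 < \<rho>\<close> by (simp add: add_increasing)
  next
    case False
    hence "\<And>k::int. \<rho> \<le> \<bar>d n - of_int k\<bar>" using n by (fastforce simp: bad_def not_less)
    from norm_sum_ee_le[OF this \<open>0 < \<rho>\<close>] False show ?thesis by simp
  qed
  have mono: "d B \<le> d n" "d n \<le> d A" if n: "A \<le> n" "n \<le> B" for n
  proof -
    have "0 * real (B - n) \<le> d n - d B"
      by (rule decreasing_gap[where A = A and B = "B + L"])
        (use gap0 n in auto)
    moreover have "0 * real (n - A) \<le> d A - d n"
      by (rule decreasing_gap[where A = A and B = "B + L"])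
        (use gap0 n in auto)
    ultimately show "d B \<le> d n" "d n \<le> d A" by auto
  qed
  have dAB: "d A - d B \<le> M * \<Lambda>"
  proof -
    have "(- \<Lambda>) * real (B - A) \<le> (- d A) - (- d B)"
      by (rule decreasing_gap[where A = A and B = "B + L"]) (use gap' AB in \<open>force+\<close>)
    thus ?thesis by (simp add: M_def mult.commute)
  qed
  \<comment> \<open>Contains every integer within \<rho> of some value \<open>d n\<close>. As
    \<open>\<rho> \<le> 1/2\<close>, the interval exceeds the range of \<open>d\<close> by at most 1
    in total, whence the count \<open>M * \<Lambda> + 2\<close>.\<close>
  define Ks where "Ks = {\<lceil>d B - \<rho>\<rceil>..\<lfloor>d A + \<rho>\<rfloor>}"
  have "bad \<subseteq> (\<Union>k\<in>Ks. {n\<in>{A..<B}. \<bar>d n - of_int k\<bar> < \<rho>})"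
  proof
    fix n assume "n \<in> bad"
    then obtain k :: int where k: "n \<in> {A..<B}" "\<bar>d n - of_int k\<bar> < \<rho>" by (auto simp: bad_def)
    hence "d B - \<rho> \<le> of_int k" "of_int k \<le> d A + \<rho>" using mono[of n] by auto
    hence "k \<in> Ks" by (auto simp: Ks_def ceiling_le_iff le_floor_iff)
    with k show "n \<in> (\<Union>k\<in>Ks. {n\<in>{A..<B}. \<bar>d n - of_int k\<bar> < \<rho>})" by auto
  qed
  hence "card bad \<le> card (\<Union>k\<in>Ks. {n\<in>{A..<B}. \<bar>d n - of_int k\<bar> < \<rho>})"
    by (intro card_mono) (auto simp: Ks_def)
  also have "\<dots> \<le> (\<Sum>k\<in>Ks. card {n\<in>{A..<B}. \<bar>d n - of_int k\<bar> < \<rho>})"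
    by (intro card_UN_le) (auto simp: Ks_def)
  finally have "real (card bad) \<le> (\<Sum>k\<in>Ks. real (card {n\<in>{A..<B}. \<bar>d n - of_int k\<bar> < \<rho>}))"
    unfolding of_nat_sum[symmetric] of_nat_le_iff .
  also have "\<dots> \<le> (\<Sum>k\<in>Ks. 2 * \<rho> / \<kappa> + 1)"
    by (intro sum_mono card_close_le) (use gap \<open>0 < \<kappa>\<close> \<open>0 < \<rho>\<close> in auto)
  also have "\<dots> = real (card Ks) * (2 * \<rho> / \<kappa> + 1)" by simp
  also have "\<dots> \<le> (M * \<Lambda> + 2) * (2 * \<rho> / \<kappa> + 1)"
  proof (rule mult_right_mono)
    have "real (card Ks) \<le> M * \<Lambda> + 2"
    proof (cases "\<lceil>d B - \<rho>\<rceil> \<le> \<lfloor>d A + \<rho>\<rfloor>")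
      case True
      hence "real (card Ks) = of_int \<lfloor>d A + \<rho>\<rfloor> - of_int \<lceil>d B - \<rho>\<rceil> + 1"
        by (simp add: Ks_def)
      also have "\<dots> \<le> (d A + \<rho>) - (d B - \<rho>) + 1" by linarith
      finally show ?thesis using dAB \<open>\<rho> \<le> 1 / 2\<close> by simp
    next
      case False
      thus ?thesis using Lam0 by (simp add: Ks_def M_def)
    qed
    thus "real (card Ks) \<le> M * \<Lambda> + 2" .
  qed (use \<open>0 < \<kappa>\<close> \<open>0 < \<rho>\<close> in auto)
  finally have cb: "real (card bad) \<le> (M * \<Lambda> + 2) * (2 * \<rho> / \<kappa> + 1)" .
  have "norm (\<Sum>n=A..<B. W n)
      \<le> (\<Sum>n=A..<B. 2 * pi * \<Lambda> * (real L) ^ 3 + (1 / \<rho> + (if n \<in> bad then real L else 0)))"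
  proof (rule sum_norm_le)
    fix n assume "n \<in> {A..<B}"
    thus "norm (W n) \<le> 2 * pi * \<Lambda> * (real L) ^ 3 + (1 / \<rho> + (if n \<in> bad then real L else 0))"
      using W1[of n] W2[of n] by simp
  qed
  also have "\<dots> = M * (2 * pi * \<Lambda> * (real L) ^ 3) + M / \<rho> + real L * real (card bad)"
  proof -
    have "{A..<B} \<inter> bad = bad" by (auto simp: bad_def)
    thus ?thesis by (simp add: sum.distrib sum.If_cases M_def mult.commute)
  qed
  also have "\<dots> \<le> M * (2 * pi * \<Lambda> * (real L) ^ 3) + M / \<rho>
                   + real L * ((M * \<Lambda> + 2) * (2 * \<rho> / \<kappa> + 1))"
    using cb by (intro add_left_mono mult_left_mono) auto
  finally have "real L * norm S \<le> M * (2 * pi * \<Lambda> * (real L) ^ 3) + M / \<rho>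
                   + real L * ((M * \<Lambda> + 2) * (2 * \<rho> / \<kappa> + 1)) + 2 * (real L)\<^sup>2"
    using LS by linarith
  also have "\<dots> = real L * (2 * real L + 2 * pi * \<Lambda> * (real L)\<^sup>2 * M
           + M / (\<rho> * real L) + (M * \<Lambda> + 2) * (2 * \<rho> / \<kappa> + 1))"
    using \<open>L \<ge> 1\<close> \<open>0 < \<rho>\<close> by (simp add: algebra_simps power2_eq_square power3_eq_cube)
  finally show ?thesis
    using \<open>L \<ge> 1\<close> by (simp add: S_def M_def)
qed

section \<open>Ramanujan sums\<close>

lemma ee_cong:
  assumes "[x = y] (mod q)" "q > 0"
  shows "ee (real x / real q) = ee (real y / real q)"
proof -
  have "[int x = int y] (mod int q)" using assms by (simp add: cong_int_iff)
  then obtain k where "int y = int x + int q * k" by (auto simp: cong_iff_lin)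
  hence "real_of_int (int y) = real_of_int (int x + int q * k)" by (rule arg_cong)
  hence "real y / real q = real x / real q + of_int k" using assms(2) by (simp add: field_simps)
  thus ?thesis by (simp add: ee_add)
qed

lemma squarefree_mult_imp_coprime:
  assumes "squarefree (a * b :: nat)"
  shows "coprime a b"
proof -
  have "(gcd a b)\<^sup>2 dvd a * b" by (simp add: power2_eq_square mult_dvd_mono)
  hence "gcd a b dvd 1" using assms by (rule squarefreeD[rotated])
  thus ?thesis by (metis coprime_iff_gcd_eq_1 nat_dvd_1_iff_1)
qed

text \<open>The Ramanujan sum c_q(1), which equals the Moebius function of \<open>q\<close>; below
  only its absolute value for squarefree \<open>q\<close> is evaluated.\<close>

definition ramanujan_one :: "nat \<Rightarrow> complex" where
  "ramanujan_one q = (\<Sum>a\<in>totatives q. ee (real a / real q))"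

text \<open>Multiplication by \<open>t\<close> modulo \<open>q\<close> permutes the reduced
  residues. So the sum has the same value at all arguments coprime to \<open>q\<close>, which is how
  primes are detected later. For \<open>q = 1\<close> the only totative is 1 and not 0, so this case
  is evaluated separately.\<close>

lemma ramanujan_sum_coprime:
  assumes "coprime t q" "q > 0"
  shows "(\<Sum>a\<in>totatives q. ee (real (a * t) / real q)) = ramanujan_one q"
proof (cases "q = 1")
  case True
  then show ?thesis by (simp add: ramanujan_one_def)
next
  case False
  with assms have q: "q > 1" by simp
  define g where "g = (\<lambda>a. (a * t) mod q)"
  have inj: "inj_on g (totatives q)"
  proof
    fix x y assume xy: "x \<in> totatives q" "y \<in> totatives q" "g x = g y"
    hence "[x * t = y * t] (mod q)" by (simp add: g_def cong_def)
    hence "[x = y] (mod q)" using assms(1) cong_mult_rcancel_nat[of t q x y] by simp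
    thus "x = y" using xy q totatives_less[of _ q] by (simp add: cong_def)
  qed
  have sub: "g ` totatives q \<subseteq> totatives q"
  proof
    fix y assume "y \<in> g ` totatives q"
    then obtain x where x: "x \<in> totatives q" "y = (x * t) mod q" by (auto simp: g_def)
    have "coprime (x * t) q" using x assms by (simp add: in_totatives_iff)
    hence "coprime y q" using x(2) q by (simp add: coprime_mod_left_iff)
    moreover have "y \<noteq> 0" using \<open>coprime y q\<close> q by (intro notI) simp
    ultimately show "y \<in> totatives q" using q x(2) by (simp add: in_totatives_iff less_imp_le)
  qed
  have surj: "g ` totatives q = totatives q"
    by (rule endo_inj_surj[OF _ sub inj]) simp
  have "ramanujan_one q = (\<Sum>a\<in>g ` totatives q. ee (real a / real q))"
    by (simp add: ramanujan_one_def surj)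
  also have "\<dots> = (\<Sum>a\<in>totatives q. ee (real (g a) / real q))"
    by (simp add: sum.reindex[OF inj])
  also have "\<dots> = (\<Sum>a\<in>totatives q. ee (real (a * t) / real q))"
    by (intro sum.cong refl ee_cong) (use q in \<open>simp_all add: g_def\<close>)
  finally show ?thesis by simp
qed

text \<open>With \<alpha> the inverse of \<open>n\<close> modulo \<open>m\<close> and \<beta> that
  of \<open>m\<close> modulo \<open>n\<close>, the number \<open>x / (m * n)\<close> is congruent to
  \<open>x * \<alpha> / m + x * \<beta> / n\<close> modulo 1. The Chinese remainder bijection on
  totatives factors the sum, and the twists by \<alpha> and \<beta> disappear because they are
  coprime to the moduli.\<close>

lemma ramanujan_one_mult:
  assumes "coprime m n" "m > 1" "n > 1"
  shows "ramanujan_one (m * n) = ramanujan_one m * ramanujan_one n"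
proof -
  obtain \<alpha> where \<alpha>: "[n * \<alpha> = 1] (mod m)"
    using cong_solve_coprime_nat[of n m] assms by (auto simp: coprime_commute)
  obtain \<beta> where \<beta>: "[m * \<beta> = 1] (mod n)"
    using cong_solve_coprime_nat[of m n] assms by auto
  have cop: "coprime \<alpha> m" "coprime \<beta> n"
    using cong_imp_coprime[OF cong_sym[OF \<alpha>]] cong_imp_coprime[OF cong_sym[OF \<beta>]] by auto
  have "[n * \<alpha> + m * \<beta> = 1] (mod m)"
    using \<alpha> by (simp add: cong_def)
  moreover have "[n * \<alpha> + m * \<beta> = 1] (mod n)"
    using \<beta> by (simp add: cong_def)
  ultimately have one: "[n * \<alpha> + m * \<beta> = 1] (mod (m * n))"
    using assms(1) coprime_cong_mult_nat by blast
  have split: "ee (real x / real (m * n))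
      = ee (real ((x mod m) * \<alpha>) / real m) * ee (real ((x mod n) * \<beta>) / real n)" for x
  proof -
    have "[x = x * (n * \<alpha> + m * \<beta>)] (mod (m * n))"
      using cong_sym[OF cong_scalar_left[OF one, of x]] by simp
    hence "ee (real x / real (m * n)) = ee (real (x * (n * \<alpha> + m * \<beta>)) / real (m * n))"
      using assms by (intro ee_cong) auto
    also have "real (x * (n * \<alpha> + m * \<beta>)) / real (m * n) = real (x * \<alpha>) / real m + real (x * \<beta>) / real n"
      using assms by (simp add: field_simps)
    also have "ee \<dots> = ee (real (x * \<alpha>) / real m) * ee (real (x * \<beta>) / real n)"
      by (rule ee_add)
    also have "ee (real (x * \<alpha>) / real m) = ee (real ((x mod m) * \<alpha>) / real m)"
      using assms by (intro ee_cong) (auto simp: cong_def mod_mult_left_eq)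
    also have "ee (real (x * \<beta>) / real n) = ee (real ((x mod n) * \<beta>) / real n)"
      using assms by (intro ee_cong) (auto simp: cong_def mod_mult_left_eq)
    finally show ?thesis .
  qed
  have "ramanujan_one (m * n)
      = (\<Sum>x\<in>totatives (m * n). (\<lambda>(a, b). ee (real (a * \<alpha>) / real m) * ee (real (b * \<beta>) / real n)) (x mod m, x mod n))"
    unfolding ramanujan_one_def by (intro sum.cong) (use split in auto)
  also have "\<dots> = (\<Sum>(a, b)\<in>totatives m \<times> totatives n. ee (real (a * \<alpha>) / real m) * ee (real (b * \<beta>) / real n))"
    by (rule sum.reindex_bij_betw[OF bij_betw_totatives]) (use assms in auto)
  also have "\<dots> = (\<Sum>a\<in>totatives m. ee (real (a * \<alpha>) / real m)) * (\<Sum>b\<in>totatives n. ee (real (b * \<beta>) / real n))"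
    by (simp add: sum_product sum.cartesian_product)
  finally show ?thesis
    using ramanujan_sum_coprime cop assms by simp
qed

lemma sum_ee_roots:
  assumes "q > 1"
  shows "(\<Sum>a<q. ee (real a / real q)) = 0"
proof -
  have "ee (1 / real q) \<noteq> 1"
  proof
    assume "ee (1 / real q) = 1"
    hence "sin (pi / real q) = 0" using norm_ee_minus_1[of "1 / real q"] by simp
    moreover have "sin (pi / real q) > 0"
      using assms by (intro sin_gt_zero) (auto simp: field_simps)
    ultimately show False by simp
  qed
  moreover have "ee (1 / real q) ^ q = 1"
    using assms ee_nat_mult[of q "1 / real q"] ee_of_nat[of 1] by simp
  ultimately have "(\<Sum>a<q. ee (1 / real q) ^ a) = 0" by (simp add: geometric_sum)
  thus ?thesis by (simp flip: ee_nat_mult)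
qed

text \<open>All \<open>p\<close>-th roots of unity sum to zero, and the totatives of
  \<open>p\<close> omit exactly the root 1.\<close>

lemma ramanujan_one_prime:
  assumes "prime p"
  shows "ramanujan_one p = - 1"
proof -
  have "p > 1" using assms prime_gt_1_nat by blast
  hence "{..<p} = insert 0 {0<..<p}" by auto
  hence "(\<Sum>a<p. ee (real a / real p)) = 1 + ramanujan_one p"
    using assms by (simp add: ramanujan_one_def totatives_prime)
  hence "1 + ramanujan_one p = 0" using sum_ee_roots[OF \<open>p > 1\<close>] by simp
  thus ?thesis by (metis add.commute eq_neg_iff_add_eq_0)
qed

lemma norm_ramanujan_one:
  assumes "squarefree q"
  shows "norm (ramanujan_one q) = 1"
  using assms
proof (induction q rule: less_induct)
  case (less q)
  show ?case
  proof (cases "q \<le> 1")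
    case True
    moreover have "q \<noteq> 0" using less.prems by (cases "q = 0") auto
    ultimately have "q = 1" by simp
    then show ?thesis by (simp add: ramanujan_one_def)
  next
    case False
    then obtain p where p: "prime p" "p dvd q" using prime_factor_nat[of q] by auto
    then obtain k where k: "q = p * k" by auto
    have "k > 0" using k False by (intro Nat.gr0I) auto
    have "squarefree k" using less.prems k squarefree_mono[of k q] by simp
    have "coprime p k" using less.prems k squarefree_mult_imp_coprime[of p k] by simp
    show ?thesis
    proof (cases "k = 1")
      case True
      then show ?thesis using k p by (simp add: ramanujan_one_prime)
    next
      case False
      with \<open>k > 0\<close> have "k > 1" by simp
      have "p > 1" using p prime_gt_1_nat by blast
      hence "k < q" using k \<open>k > 0\<close> by simp
      hence "norm (ramanujan_one k) = 1" using less.IH[of k] \<open>squarefree k\<close> by simp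
      thus ?thesis using ramanujan_one_mult[OF \<open>coprime p k\<close> \<open>p > 1\<close> \<open>k > 1\<close>] k p
        by (simp add: norm_mult ramanujan_one_prime)
    qed
  qed
qed

section \<open>Sieve weights\<close>

text \<open>Up to the restriction imposed by \<open>S\<close>, this is the sum of \<mu>(q)^2 /
  \<phi>(q) known from the Selberg and large sieves, with \<phi> the totient; its size is the saving
  of the sieve.\<close>

definition sieve_sum :: "nat set \<Rightarrow> nat \<Rightarrow> real" where
  "sieve_sum S Q = (\<Sum>q | q \<in> {1..Q} \<and> squarefree q \<and> (\<forall>p\<in>S. \<not> p dvd q). 1 / real (totient q))"

text \<open>Telescoping against \<open>1 / (n * (n + 1))\<close>; the induction carries the sharper
  bound \<open>2 - 1 / n\<close>.\<close>

lemma sum_inverse_squares_le: "(\<Sum>d=1..n. 1 / (real d)\<^sup>2) \<le> 2"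
proof -
  have "(\<Sum>d=1..Suc n. 1 / (real d)\<^sup>2) \<le> 2 - 1 / real (Suc n)" for n
  proof (induction n)
    case 0
    then show ?case by simp
  next
    case (Suc n)
    have "1 / (real (Suc (Suc n)))\<^sup>2 \<le> 1 / (real (Suc n) * real (Suc (Suc n)))"
      unfolding power2_eq_square by (intro divide_left_mono mult_right_mono) auto
    also have "\<dots> = 1 / real (Suc n) - 1 / real (Suc (Suc n))"
      by (simp add: field_simps)
    finally have "1 / (real (Suc (Suc n)))\<^sup>2 \<le> 1 / real (Suc n) - 1 / real (Suc (Suc n))" .
    with Suc show ?case by simp
  qed
  from this[of "n - 1"] show ?thesis
    by (cases n) (auto intro: order_trans)
qed

text \<open>Every \<open>n \<le> Q\<close> is uniquely \<open>q * d\<^sup>2\<close> with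
  \<open>q\<close> squarefree, so the harmonic sum is at most the sum of \<open>1 / q\<close> over
  squarefree \<open>q\<close> times that of \<open>1 / d\<^sup>2\<close>. The latter is at most 2,
  and \<open>1 / q \<le> 1 / totient q\<close>.\<close>

lemma sieve_sum_empty_ge: "ln (real Q + 1) / 2 \<le> sieve_sum {} Q"
proof -
  define SF where "SF = {q. q \<in> {1..Q} \<and> squarefree q}"
  have fin: "finite SF" by (simp add: SF_def)
  define g where "g = (\<lambda>n::nat. (squarefree_part n, square_part n))"
  have dec: "n = fst (g n) * snd (g n) ^ 2" for n
    using squarefree_decompose[of n] by (simp add: g_def)
  have inj: "inj_on g {1..Q}"
  proof (rule inj_onI)
    fix x y assume "g x = g y"
    thus "x = y" using dec[of x] dec[of y] by simp
  qed
  have img: "g ` {1..Q} \<subseteq> SF \<times> {1..Q}"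
  proof
    fix y assume "y \<in> g ` {1..Q}"
    then obtain n where n: "y = g n" "1 \<le> n" "n \<le> Q" by auto
    define q d where "q = squarefree_part n" and "d = square_part n"
    have nqd: "n = q * d\<^sup>2" using squarefree_decompose[of n] by (simp add: q_def d_def)
    have "q > 0" "d > 0" using nqd n by (auto intro!: Nat.gr0I)
    have "q \<le> n" using nqd \<open>d > 0\<close> by simp
    have "d \<le> d\<^sup>2" using \<open>d > 0\<close> by (simp add: power2_eq_square)
    also have "d\<^sup>2 \<le> n" using nqd \<open>q > 0\<close> by simp
    finally have "d \<le> n" .
    with \<open>q \<le> n\<close> \<open>q > 0\<close> \<open>d > 0\<close> n show "y \<in> SF \<times> {1..Q}"
      by (auto simp: SF_def g_def q_def d_def)
  qed
  have "ln (real Q + 1) \<le> harm Q" by (rule ln_le_harm)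
  also have "\<dots> = (\<Sum>n\<in>{1..Q}. (\<lambda>(q, d). 1 / (real q * (real d)\<^sup>2)) (g n))"
    unfolding harm_def
  proof (intro sum.cong refl)
    fix n
    have "real n = real (fst (g n)) * (real (snd (g n)))\<^sup>2"
      by (subst dec[of n]) (simp del: of_nat_power add: of_nat_power[symmetric])
    thus "inverse (real n) = (\<lambda>(q, d). 1 / (real q * (real d)\<^sup>2)) (g n)"
      by (simp add: case_prod_beta inverse_eq_divide)
  qed
  also have "\<dots> = (\<Sum>y\<in>g ` {1..Q}. (\<lambda>(q, d). 1 / (real q * (real d)\<^sup>2)) y)"
    using sum.reindex[OF inj, of "\<lambda>(q, d). 1 / (real q * (real d)\<^sup>2)"] by (simp only: o_def)
  also have "\<dots> \<le> (\<Sum>y\<in>SF \<times> {1..Q}. (\<lambda>(q, d). 1 / (real q * (real d)\<^sup>2)) y)"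
    by (intro sum_mono2 img) (auto simp: fin)
  also have "\<dots> = (\<Sum>q\<in>SF. 1 / real q) * (\<Sum>d=1..Q. 1 / (real d)\<^sup>2)"
    by (simp add: sum_product sum.cartesian_product case_prod_beta)
  also have "\<dots> \<le> (\<Sum>q\<in>SF. 1 / real (totient q)) * 2"
  proof (rule mult_mono)
    show "(\<Sum>q\<in>SF. 1 / real q) \<le> (\<Sum>q\<in>SF. 1 / real (totient q))"
      by (intro sum_mono divide_left_mono) (auto simp: SF_def totient_le)
  qed (use sum_inverse_squares_le[of Q] in \<open>auto intro!: sum_nonneg\<close>)
  finally show ?thesis by (simp add: sieve_sum_def SF_def)
qed

text \<open>The moduli divisible by \<open>p\<close> are of the form \<open>p * k\<close> with
  \<open>k\<close> among the moduli left after removing \<open>p\<close>; hence they contribute at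
  most \<open>1 / (p - 1)\<close> times the new sum, and \<open>1 + 1 / (p - 1)\<close> is the
  inverse of \<open>1 - 1 / p\<close>.\<close>

lemma sieve_sum_insert:
  assumes "prime p" "p \<notin> S" "\<And>q. q \<in> S \<Longrightarrow> prime q"
  shows "(1 - 1 / real p) * sieve_sum S Q \<le> sieve_sum (insert p S) Q"
proof -
  have p: "p \<ge> 2" using assms(1) prime_ge_2_nat by blast
  define B :: "nat set \<Rightarrow> nat \<Rightarrow> nat set"
    where "B = (\<lambda>S Q. {q. q \<in> {1..Q} \<and> squarefree q \<and> (\<forall>p\<in>S. \<not> p dvd q)})"
  have fin: "finite (B S Q)" for S Q by (simp add: B_def)
  have split: "B S Q = B (insert p S) Q \<union> {q\<in>B S Q. p dvd q}" by (auto simp: B_def)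
  have sub: "{q\<in>B S Q. p dvd q} \<subseteq> (\<lambda>k. p * k) ` B (insert p S) Q"
  proof
    fix q assume q: "q \<in> {q\<in>B S Q. p dvd q}"
    then obtain k where k: "q = p * k" by auto
    have sq: "squarefree q" using q by (simp add: B_def)
    have "squarefree k" using sq k squarefree_mono[of k q] by simp
    moreover have "coprime p k" using sq k squarefree_mult_imp_coprime[of p k] by simp
    hence "\<not> p dvd k" using assms(1) using coprime_common_divisor_nat[of p k p] prime_gt_1_nat[of p] by auto
    moreover have "k \<ge> 1" "k \<le> q" using q k p by (auto simp: B_def intro!: Suc_leI Nat.gr0I)
    moreover have "q \<le> Q" using q by (simp add: B_def)
    moreover have "\<forall>p\<in>S. \<not> p dvd k" using q k by (auto simp: B_def)
    ultimately have "k \<in> B (insert p S) Q" by (auto simp: B_def)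
    thus "q \<in> (\<lambda>k. p * k) ` B (insert p S) Q" using k by blast
  qed
  have "sieve_sum S Q = (\<Sum>q\<in>B (insert p S) Q \<union> {q\<in>B S Q. p dvd q}. 1 / real (totient q))"
    unfolding split[symmetric] by (simp add: sieve_sum_def B_def)
  also have "\<dots> = sieve_sum (insert p S) Q + (\<Sum>q\<in>{q\<in>B S Q. p dvd q}. 1 / real (totient q))"
    by (subst sum.union_disjoint) (auto simp: B_def sieve_sum_def)
  also have "(\<Sum>q\<in>{q\<in>B S Q. p dvd q}. 1 / real (totient q))
      \<le> (\<Sum>q\<in>(\<lambda>k. p * k) ` B (insert p S) Q. 1 / real (totient q))"
    by (intro sum_mono2 sub) (auto simp: fin)
  also have "\<dots> = (\<Sum>k\<in>B (insert p S) Q. 1 / real (totient (p * k)))"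
    using p by (subst sum.reindex) (auto simp: inj_on_def)
  also have "\<dots> = (\<Sum>k\<in>B (insert p S) Q. 1 / (real p - 1) * (1 / real (totient k)))"
  proof (intro sum.cong refl)
    fix k assume "k \<in> B (insert p S) Q"
    hence "coprime p k" using assms(1) by (auto simp: B_def prime_imp_coprime)
    hence "totient (p * k) = (p - 1) * totient k"
      using assms(1) by (simp add: totient_mult_coprime totient_prime)
    thus "1 / real (totient (p * k)) = 1 / (real p - 1) * (1 / real (totient k))"
      using p by (simp add: of_nat_diff)
  qed
  also have "\<dots> = 1 / (real p - 1) * sieve_sum (insert p S) Q"
    by (simp add: sum_distrib_left sieve_sum_def B_def)
  finally have "sieve_sum S Q \<le> (1 + 1 / (real p - 1)) * sieve_sum (insert p S) Q"
    by (simp add: algebra_simps)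
  also have "1 + 1 / (real p - 1) = 1 / (1 - 1 / real p)"
    using p by (simp add: field_simps)
  finally show ?thesis using p by (simp add: field_simps)
qed

lemma sieve_sum_ge:
  assumes "finite S" "\<And>q. q \<in> S \<Longrightarrow> prime q"
  shows "(\<Prod>p\<in>S. 1 - 1 / real p) * sieve_sum {} Q \<le> sieve_sum S Q"
  using assms
proof (induction S rule: finite_induct)
  case empty
  then show ?case by simp
next
  case (insert p S)
  have "0 \<le> 1 - 1 / real p" using prime_ge_1_nat[of p] insert.prems by (simp add: field_simps)
  hence "(1 - 1 / real p) * ((\<Prod>p\<in>S. 1 - 1 / real p) * sieve_sum {} Q)
      \<le> (1 - 1 / real p) * sieve_sum S Q"
    using insert by (intro mult_left_mono) auto
  also have "\<dots> \<le> sieve_sum (insert p S) Q"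
    using insert by (intro sieve_sum_insert) auto
  finally show ?case using insert by (simp add: mult.assoc)
qed

section \<open>Chebyshev and Mertens type bounds for primes\<close>

lemma prod_primes_dvd:
  fixes n :: nat
  assumes "finite A" "\<And>p. p \<in> A \<Longrightarrow> prime p" "\<And>p. p \<in> A \<Longrightarrow> p dvd n"
  shows "\<Prod>A dvd n"
  using assms
proof (induction A rule: finite_induct)
  case empty
  then show ?case by simp
next
  case (insert p A)
  have "coprime p (\<Prod>A)"
    using insert by (intro prod_coprime_right) (metis insertCI primes_coprime)
  with insert show ?case by (simp add: divides_mult)
qed

text \<open>Chebyshev's argument: the primes in \<open>(n, 2n]\<close> divide the central binomial coefficient.\<close>

lemma card_primes_dyadic:
  "j * card {p::nat. prime p \<and> 2 ^ j < p \<and> p \<le> 2 ^ Suc j} \<le> 2 ^ Suc j"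
proof -
  define n :: nat where "n = 2 ^ j"
  define A where "A = {p. prime p \<and> n < p \<and> p \<le> 2 * n}"
  have fin: "finite A" by (rule finite_subset[of _ "{..2 * n}"]) (auto simp: A_def)
  have "\<Prod>A dvd ((2 * n) choose n)"
  proof (rule prod_primes_dvd[OF fin])
    fix p assume p: "p \<in> A"
    thus "prime p" by (simp add: A_def)
    have "fact n * fact n * ((2 * n) choose n) = (fact (2 * n) :: nat)"
      using binomial_fact_lemma[of n "2 * n"] by simp
    moreover have "p dvd fact (2 * n)" "\<not> p dvd fact n"
      using p by (auto simp: A_def prime_dvd_fact_iff)
    ultimately show "p dvd ((2 * n) choose n)"
      using \<open>prime p\<close> by (metis prime_dvd_mult_iff)
  qed
  hence "\<Prod>A \<le> ((2 * n) choose n)"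
    by (rule dvd_imp_le) (simp add: zero_less_binomial_iff)
  also have "\<dots> \<le> 2 ^ (2 * n)"
    using binomial_le_pow2 by blast
  finally have "\<Prod>A \<le> 2 ^ (2 * n)" .
  moreover have "(\<Prod>p\<in>A. n) \<le> \<Prod>A"
    by (intro prod_mono) (auto simp: A_def)
  ultimately have "n ^ card A \<le> 2 ^ (2 * n)" by simp
  hence "(2::nat) ^ (j * card A) \<le> 2 ^ (2 * n)" by (simp add: n_def power_mult)
  hence "j * card A \<le> 2 * n" by (rule power_le_imp_le_exp[rotated]) simp
  thus ?thesis by (simp add: A_def n_def)
qed

definition mertens_prod :: "nat \<Rightarrow> real" where
  "mertens_prod z = (\<Prod>p | prime p \<and> p \<le> z. 1 - 1 / real p)"

lemma finite_primes_le: "finite {p::nat. prime p \<and> p \<le> z}"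
  by (rule finite_subset[of _ "{..z}"]) auto

lemma prime_factor_bounds:
  assumes "prime (p::nat)"
  shows "0 < 1 - 1 / real p" "1 - 1 / real p \<le> 1"
  using prime_gt_1_nat[OF assms] by (auto simp: field_simps)

lemma mertens_prod_pos: "0 < mertens_prod z"
  unfolding mertens_prod_def by (rule prod_pos) (use prime_factor_bounds(1) in blast)

lemma mertens_prod_antimono:
  assumes "y \<le> z"
  shows "mertens_prod z \<le> mertens_prod y"
proof -
  have "{p. prime p \<and> p \<le> z} = {p. prime p \<and> p \<le> y} \<union> {p. prime p \<and> y < p \<and> p \<le> z}"
    using assms by auto
  hence "mertens_prod z = mertens_prod y * (\<Prod>p | prime p \<and> y < p \<and> p \<le> z. 1 - 1 / real p)"
    unfolding mertens_prod_def
    by (simp only:) (rule prod.union_disjoint, auto intro: finite_primes_le finite_subset[OF _ finite_primes_le[of z]])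
  also have "\<dots> \<le> mertens_prod y * 1"
    by (intro mult_left_mono prod_le_1 less_imp_le[OF mertens_prod_pos])
      (use prime_factor_bounds in \<open>force intro: less_imp_le\<close>)
  finally show ?thesis by simp
qed

lemma one_minus_ge_exp:
  assumes "0 \<le> x" "x \<le> 1 / 2"
  shows "exp (- 2 * x) \<le> 1 - (x::real)"
proof -
  have "1 \<le> (1 - x) * (1 + 2 * x)" using assms using mult_left_mono[of x "1 / 2" x] by (simp add: algebra_simps)
  also have "\<dots> \<le> (1 - x) * exp (2 * x)"
    using assms by (intro mult_left_mono exp_ge_add_one_self) auto
  finally show ?thesis by (simp add: exp_minus field_simps)
qed

text \<open>By the Chebyshev bound the block contains at most \<open>2 ^ Suc j / j\<close> primes,
  so their reciprocals sum to at most \<open>2 / j\<close>; each factor \<open>1 - 1 / p\<close> is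
  at least \<open>exp (- 2 / p)\<close>.\<close>

lemma mertens_prod_dyadic:
  assumes "j \<ge> 1"
  shows "mertens_prod (2 ^ j) * exp (- 4 / real j) \<le> mertens_prod (2 ^ Suc j)"
proof -
  define A where "A = {p::nat. prime p \<and> 2 ^ j < p \<and> p \<le> 2 ^ Suc j}"
  have fin: "finite A" by (rule finite_subset[OF _ finite_primes_le[of "2 ^ Suc j"]]) (auto simp: A_def)
  have *: "{p. prime p \<and> p \<le> 2 ^ Suc j} = {p. prime p \<and> p \<le> 2 ^ j} \<union> A"
    by (auto simp: A_def)
  have eq: "mertens_prod (2 ^ Suc j) = mertens_prod (2 ^ j) * (\<Prod>p\<in>A. 1 - 1 / real p)"
    unfolding mertens_prod_def *
    by (subst prod.union_disjoint) (auto simp: fin A_def finite_primes_le)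
  have "real j * real (card A) \<le> 2 ^ Suc j"
    using card_primes_dyadic[of j] unfolding A_def[symmetric]
    by (metis of_nat_le_iff of_nat_mult of_nat_numeral of_nat_power)
  hence cA: "real (card A) / 2 ^ j \<le> 2 / real j" using assms by (simp add: field_simps)
  have "(\<Sum>p\<in>A. 1 / real p) \<le> (\<Sum>p\<in>A. 1 / 2 ^ j)"
  proof (intro sum_mono divide_left_mono)
    fix p assume "p \<in> A"
    hence "real (2 ^ j) \<le> real p" by (simp add: A_def del: of_nat_power)
    thus "2 ^ j \<le> real p" by simp
  qed (auto simp: A_def prime_gt_0_nat)
  also have "\<dots> \<le> 2 / real j" using cA by simp
  finally have S: "(\<Sum>p\<in>A. 1 / real p) \<le> 2 / real j" .
  have "exp (- 4 / real j) \<le> exp (- 2 * (\<Sum>p\<in>A. 1 / real p))"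
    using S by simp
  also have "\<dots> = (\<Prod>p\<in>A. exp (- 2 * (1 / real p)))"
    by (simp add: exp_sum[OF fin, symmetric] sum_distrib_left)
  also have "\<dots> \<le> (\<Prod>p\<in>A. 1 - 1 / real p)"
  proof (intro prod_mono conjI one_minus_ge_exp)
    fix p assume "p \<in> A"
    hence "p \<ge> 2" by (auto simp: A_def prime_ge_2_nat)
    thus "1 / real p \<le> 1 / 2" by simp
  qed auto
  finally show ?thesis unfolding eq
    by (intro mult_left_mono) (auto simp: mertens_prod_pos less_imp_le)
qed

text \<open>Mertens' theorem gives the order \<open>1 / ln z\<close>, but any small negative power
  suffices here. Once \<open>4 / j \<le> \<epsilon> * ln 2\<close>, a dyadic step loses at most the
  factor \<open>2 powr (- \<epsilon>)\<close>; the steps before \<open>J0\<close> are absorbed in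
  the constant.\<close>

lemma mertens_prod_ge:
  assumes "0 < \<epsilon>"
  shows "\<exists>c>0. \<forall>z\<ge>1. c * real z powr (- \<epsilon>) \<le> mertens_prod z"
proof -
  define e where "e = \<epsilon> * ln 2"
  have e: "e > 0" using assms by (simp add: e_def)
  define J0 where "J0 = Suc (nat \<lceil>4 / e\<rceil>)"
  have J0: "4 / real j \<le> e" if "j \<ge> J0" for j
  proof -
    have "4 / e \<le> real j" using that unfolding J0_def by linarith
    moreover have "j > 0" using that by (simp add: J0_def)
    ultimately show ?thesis using e by (simp add: field_simps)
  qed
  define c0 where "c0 = mertens_prod (2 ^ J0)"
  have c0: "c0 > 0" by (simp add: c0_def mertens_prod_pos)
  have ge: "c0 * exp (- e * real (j - J0)) \<le> mertens_prod (2 ^ j)" if "j \<ge> J0" for j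
    using that
  proof (induction j rule: dec_induct)
    case base
    then show ?case by (simp add: c0_def)
  next
    case (step j)
    have "c0 * exp (- e * real (Suc j - J0)) = c0 * exp (- e * real (j - J0)) * exp (- e)"
      using step by (simp add: Suc_diff_le algebra_simps flip: exp_add)
    also have "\<dots> \<le> mertens_prod (2 ^ j) * exp (- 4 / real j)"
      using step J0[of j] by (intro mult_mono) (auto simp: mertens_prod_pos less_imp_le)
    also have "\<dots> \<le> mertens_prod (2 ^ Suc j)"
      using step by (intro mertens_prod_dyadic) (auto simp: J0_def)
    finally show ?case .
  qed
  have ge': "c0 * exp (- e * real j) \<le> mertens_prod (2 ^ j)" for j
  proof (cases "j \<ge> J0")
    case True
    have "c0 * exp (- e * real j) \<le> c0 * exp (- e * real (j - J0))"
      using c0 e by (intro mult_left_mono) auto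
    with ge[OF True] show ?thesis by linarith
  next
    case False
    have "c0 * exp (- e * real j) \<le> c0 * 1" using c0 e by (intro mult_left_mono) auto
    also have "\<dots> \<le> mertens_prod (2 ^ j)"
      using False by (auto simp: c0_def intro!: mertens_prod_antimono power_increasing)
    finally show ?thesis .
  qed
  have "c0 * exp (- e) * real z powr (- \<epsilon>) \<le> mertens_prod z" if z: "z \<ge> 1" for z
  proof -
    define j where "j = nat \<lceil>log 2 (real z)\<rceil>"
    have l0: "0 \<le> log 2 (real z)" using z by simp
    have j1: "log 2 (real z) \<le> real j" "real j \<le> log 2 (real z) + 1"
      using l0 unfolding j_def by linarith+
    have "real z \<le> 2 powr real j" using j1(1) z by (simp add: log_le_iff)
    hence "real z \<le> real (2 ^ j)" by (simp add: powr_realpow)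
    hence "z \<le> 2 ^ j" by (simp only: of_nat_le_iff)
    have el: "e * log 2 (real z) = \<epsilon> * ln (real z)" by (simp add: e_def log_def)
    have "- e * (log 2 (real z) + 1) = - e + - (\<epsilon> * ln (real z))"
      using el by (simp add: algebra_simps)
    hence "exp (- e * (log 2 (real z) + 1)) = exp (- e) * exp (- (\<epsilon> * ln (real z)))"
      by (simp only: exp_add)
    hence "c0 * exp (- e) * real z powr (- \<epsilon>) = c0 * exp (- e * (log 2 (real z) + 1))"
      using z by (simp add: powr_def)
    also have "\<dots> \<le> c0 * exp (- e * real j)"
      using j1(2) c0 e by (intro mult_left_mono) (auto simp: mult_left_mono)
    also have "\<dots> \<le> mertens_prod (2 ^ j)" by (rule ge')
    also have "\<dots> \<le> mertens_prod z" using \<open>z \<le> 2 ^ j\<close> by (rule mertens_prod_antimono)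
    finally show ?thesis .
  qed
  thus ?thesis using c0 by (intro exI[of _ "c0 * exp (- e)"]) auto
qed

text \<open>Both \<open>totient m / m\<close> and the Mertens product are products of factors
  \<open>1 - 1 / p\<close>; a prime that occurs in both is counted twice, which only lowers the left
  side. Removing the prime factors of \<open>m\<close> thus costs no more than
  \<open>totient m / m\<close>, a factor that the weight carries as well.\<close>

lemma sieve_sum_lower:
  assumes "m > 0"
  shows "real (totient m) / real m * mertens_prod z * (ln (real Q + 1) / 2)
           \<le> sieve_sum (prime_factors m \<union> {p. prime p \<and> p \<le> z}) Q"
proof -
  define S T where "S = prime_factors m" and "T = {p::nat. prime p \<and> p \<le> z}"
  have fin: "finite S" "finite T" by (auto simp: S_def T_def finite_primes_le)
  have pr: "prime p" if "p \<in> S \<union> T" for p using that by (auto simp: S_def T_def)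
  have f: "0 < 1 - 1 / real p" "1 - 1 / real p \<le> 1" if "p \<in> S \<union> T" for p
    using prime_factor_bounds[OF pr[OF that]] by auto
  have "real (totient m) / real m * mertens_prod z
      = (\<Prod>p\<in>S. 1 - 1 / real p) * (\<Prod>p\<in>T. 1 - 1 / real p)"
    using assms by (simp add: totient_formula2 mertens_prod_def S_def T_def)
  also have "\<dots> = (\<Prod>p\<in>S \<union> T. 1 - 1 / real p) * (\<Prod>p\<in>S \<inter> T. 1 - 1 / real p)"
    using fin by (simp add: prod.union_inter)
  also have "\<dots> \<le> (\<Prod>p\<in>S \<union> T. 1 - 1 / real p) * 1"
    using f by (intro mult_left_mono prod_le_1 prod_nonneg) (auto simp: less_imp_le)
  finally have 1: "real (totient m) / real m * mertens_prod z \<le> (\<Prod>p\<in>S \<union> T. 1 - 1 / real p)" by simp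
  have "real (totient m) / real m * mertens_prod z * (ln (real Q + 1) / 2)
      \<le> (\<Prod>p\<in>S \<union> T. 1 - 1 / real p) * sieve_sum {} Q"
    using f by (intro mult_mono 1 sieve_sum_empty_ge prod_nonneg) (auto simp: less_imp_le)
  also have "\<dots> \<le> sieve_sum (S \<union> T) Q"
    using fin pr by (intro sieve_sum_ge) auto
  finally show ?thesis by (simp add: S_def T_def)
qed

section \<open>The large sieve\<close>

lemma sum_ee_orthogonal:
  assumes "j < P" "l < P"
  shows "(\<Sum>n<P. ee (real n * ((real j - real l) / real P))) = (if j = l then of_nat P else 0)"
proof (cases "j = l")
  case False
  define d where "d = (real j - real l) / real P"
  have P: "P > 0" using assms by simp
  have "ee d \<noteq> 1"
  proof
    assume "ee d = 1"
    hence "sin (pi * d) = 0" using norm_ee_minus_1[of d] by simp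
    then obtain k :: int where k: "pi * d = of_int k * pi" by (auto simp: sin_zero_iff_int2)
    hence "d = of_int k" by simp
    hence "real_of_int (int j - int l) = real_of_int (k * int P)" using P by (simp add: d_def field_simps)
    hence eq: "int j - int l = k * int P" by (simp only: of_int_eq_iff)
    hence "int P dvd int j - int l" by simp
    hence "int P \<le> \<bar>int j - int l\<bar>" using False dvd_imp_le_int[of "int j - int l" "int P"] by simp
    thus False using assms by auto
  qed
  moreover have "ee d ^ P = 1"
  proof -
    have "ee d ^ P = ee (real P * d)" by (simp add: ee_nat_mult)
    also have "real P * d = of_int (int j - int l)" using P by (simp add: d_def)
    finally show ?thesis by (simp only: ee_of_int)
  qed
  ultimately have "(\<Sum>n<P. ee d ^ n) = 0" by (simp add: geometric_sum)
  thus ?thesis unfolding d_def[symmetric] ee_nat_mult using False by simp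
qed simp

lemma norm_sq_sum_ee:
  "complex_of_real ((norm (\<Sum>i\<in>Y. b i * ee (real n * y i)))\<^sup>2)
    = (\<Sum>i\<in>Y. \<Sum>l\<in>Y. b i * cnj (b l) * ee (real n * (y i - y l)))"
  unfolding complex_norm_square cnj_sum sum_product
  by (intro sum.cong refl) (simp add: right_diff_distrib ee_diff)

text \<open>Exponentials at distinct points of a grid of spacing \<open>1 / P\<close> are orthogonal
  over \<open>P\<close> consecutive integers, so the identity is exact for every \<theta>.\<close>

lemma parseval_points:
  assumes "finite X" "X \<subseteq> {..<P}"
  shows "(\<Sum>n<P. (norm (\<Sum>j\<in>X. c j * ee (real n * (\<theta> + real j / real P))))\<^sup>2)
    = real P * (\<Sum>j\<in>X. (norm (c j))\<^sup>2)"
proof -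
  have "complex_of_real (\<Sum>n<P. (norm (\<Sum>j\<in>X. c j * ee (real n * (\<theta> + real j / real P))))\<^sup>2)
     = (\<Sum>n<P. \<Sum>i\<in>X. \<Sum>l\<in>X. c i * cnj (c l) * ee (real n * ((real i - real l) / real P)))"
    unfolding of_real_sum norm_sq_sum_ee by (intro sum.cong refl) (simp add: diff_divide_distrib)
  also have "\<dots> = (\<Sum>i\<in>X. \<Sum>n<P. \<Sum>l\<in>X. c i * cnj (c l) * ee (real n * ((real i - real l) / real P)))"
    by (rule sum.swap)
  also have "\<dots> = (\<Sum>i\<in>X. \<Sum>l\<in>X. \<Sum>n<P. c i * cnj (c l) * ee (real n * ((real i - real l) / real P)))"
    by (intro sum.cong refl sum.swap)
  also have "\<dots> = (\<Sum>i\<in>X. \<Sum>l\<in>X. c i * cnj (c l) * (if i = l then of_nat P else 0))"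
  proof (intro sum.cong refl)
    fix i l assume "i \<in> X" "l \<in> X"
    hence "i < P" "l < P" using assms(2) by auto
    thus "(\<Sum>n<P. c i * cnj (c l) * ee (real n * ((real i - real l) / real P)))
        = c i * cnj (c l) * (if i = l then of_nat P else 0)"
      by (simp only: sum_distrib_left[symmetric] sum_ee_orthogonal)
  qed
  also have "\<dots> = (\<Sum>i\<in>X. c i * cnj (c i) * of_nat P)"
  proof (intro sum.cong refl)
    fix i assume "i \<in> X"
    have "(\<Sum>l\<in>X. c i * cnj (c l) * (if i = l then of_nat P else 0))
        = (\<Sum>l\<in>X. if i = l then c i * cnj (c l) * of_nat P else 0)"
      by (intro sum.cong refl) auto
    also have "\<dots> = c i * cnj (c i) * of_nat P" using assms(1) \<open>i \<in> X\<close> by simp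
    finally show "(\<Sum>l\<in>X. c i * cnj (c l) * (if i = l then of_nat P else 0)) = c i * cnj (c i) * of_nat P" .
  qed
  also have "\<dots> = complex_of_real (real P * (\<Sum>j\<in>X. (norm (c j))\<^sup>2))"
    by (simp only: complex_norm_square[symmetric] of_real_mult of_real_sum of_real_of_nat_eq
        sum_distrib_left mult.commute)
  finally show ?thesis by (simp only: of_real_eq_iff)
qed

lemma parseval_unimodular:
  assumes "X \<subseteq> {..N}" "\<And>x. x \<in> X \<Longrightarrow> norm (w x) = 1"
  shows "(\<Sum>n\<le>N. (norm (\<Sum>x\<in>X. w x * ee (real n * (\<theta> + real x / real (N + 1)))))\<^sup>2) = real (N + 1) * real (card X)"
proof -
  have "(\<Sum>n<N + 1. (norm (\<Sum>x\<in>X. w x * ee (real n * (\<theta> + real x / real (N + 1)))))\<^sup>2)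
      = real (N + 1) * (\<Sum>x\<in>X. (norm (w x))\<^sup>2)"
    using assms(1) by (intro parseval_points) (auto intro: finite_subset simp: less_Suc_eq_le)
  thus ?thesis using assms(2) by (simp add: lessThan_Suc_atMost)
qed

text \<open>Write \<open>W = 1 + (W - 1)\<close> and expand the square: each pair of frequencies
  meets the Fourier transform of \<open>W - 1\<close> at their difference, which is bounded by
  \<open>E\<close>. So the error depends only on the sum of the \<open>norm (b i)\<close>, whatever
  the spacing of the \<open>y i\<close>.\<close>

lemma weighted_sum_le:
  fixes W :: "nat \<Rightarrow> real"
  assumes E: "\<And>\<theta>. norm (\<Sum>n\<le>N. complex_of_real (W n - 1) * ee (real n * \<theta>)) \<le> E"
  shows "(\<Sum>n\<le>N. W n * (norm (\<Sum>i\<in>Y. b i * ee (real n * y i)))\<^sup>2)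
    \<le> (\<Sum>n\<le>N. (norm (\<Sum>i\<in>Y. b i * ee (real n * y i)))\<^sup>2) + E * (\<Sum>i\<in>Y. norm (b i))\<^sup>2"
proof -
  let ?s = "\<lambda>n. (norm (\<Sum>i\<in>Y. b i * ee (real n * y i)))\<^sup>2"
  have "complex_of_real (\<Sum>n\<le>N. (W n - 1) * ?s n)
      = (\<Sum>n\<le>N. \<Sum>i\<in>Y. \<Sum>l\<in>Y. (b i * cnj (b l)) * (complex_of_real (W n - 1) * ee (real n * (y i - y l))))"
    unfolding of_real_sum of_real_mult norm_sq_sum_ee sum_distrib_left
    by (intro sum.cong refl) (simp only: mult_ac)
  also have "\<dots> = (\<Sum>i\<in>Y. \<Sum>n\<le>N. \<Sum>l\<in>Y. (b i * cnj (b l)) * (complex_of_real (W n - 1) * ee (real n * (y i - y l))))"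
    by (rule sum.swap)
  also have "\<dots> = (\<Sum>i\<in>Y. \<Sum>l\<in>Y. \<Sum>n\<le>N. (b i * cnj (b l)) * (complex_of_real (W n - 1) * ee (real n * (y i - y l))))"
    by (intro sum.cong refl sum.swap)
  also have "\<dots> = (\<Sum>i\<in>Y. \<Sum>l\<in>Y. (b i * cnj (b l)) * (\<Sum>n\<le>N. complex_of_real (W n - 1) * ee (real n * (y i - y l))))"
    by (simp only: sum_distrib_left)
  finally have eq: "complex_of_real (\<Sum>n\<le>N. (W n - 1) * ?s n) = \<dots>" .
  have "norm (\<Sum>i\<in>Y. \<Sum>l\<in>Y. (b i * cnj (b l)) * (\<Sum>n\<le>N. complex_of_real (W n - 1) * ee (real n * (y i - y l))))
      \<le> (\<Sum>i\<in>Y. \<Sum>l\<in>Y. (norm (b i) * norm (b l)) * E)"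
    by (intro sum_norm_le) (auto simp: norm_mult simp del: of_real_diff intro!: mult_left_mono E)
  also have "\<dots> = E * (\<Sum>i\<in>Y. norm (b i))\<^sup>2"
    by (simp add: power2_eq_square sum_product sum_distrib_left sum_distrib_right mult_ac)
  finally have "\<bar>\<Sum>n\<le>N. (W n - 1) * ?s n\<bar> \<le> E * (\<Sum>i\<in>Y. norm (b i))\<^sup>2"
    unfolding eq[symmetric] norm_of_real .
  moreover have "(\<Sum>n\<le>N. W n * ?s n) = (\<Sum>n\<le>N. ?s n) + (\<Sum>n\<le>N. (W n - 1) * ?s n)"
    by (simp add: left_diff_distrib sum_subtractf)
  ultimately show ?thesis by linarith
qed

section \<open>Fractions with sifted denominators\<close>

definition sieve_moduli :: "nat set \<Rightarrow> nat \<Rightarrow> nat set" where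
  "sieve_moduli S Q = {q. q \<in> {1..Q} \<and> squarefree q \<and> (\<forall>p\<in>S. \<not> p dvd q)}"

text \<open>Fractions \<open>a / q\<close> are kept as pairs \<open>(q, a)\<close>, since the
  weights refer to the denominator. As the only totative of 1 is 1, the fraction belonging to
  \<open>q = 1\<close> is 1 and not 0.\<close>

definition sieve_fracs :: "nat set \<Rightarrow> nat \<Rightarrow> (nat \<times> nat) set" where
  "sieve_fracs S Q = Sigma (sieve_moduli S Q) totatives"

definition frac_val :: "nat \<times> nat \<Rightarrow> real" where
  "frac_val i = real (snd i) / real (fst i)"

lemma finite_sieve_moduli [simp]: "finite (sieve_moduli S Q)"
  by (simp add: sieve_moduli_def)

lemma finite_sieve_fracs [simp]: "finite (sieve_fracs S Q)"
  by (simp add: sieve_fracs_def)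

lemma sieve_sum_eq: "sieve_sum S Q = (\<Sum>q\<in>sieve_moduli S Q. 1 / real (totient q))"
  by (simp add: sieve_sum_def sieve_moduli_def)

lemma sieve_fracs_sum:
  "(\<Sum>i\<in>sieve_fracs S Q. g (fst i)) = (\<Sum>q\<in>sieve_moduli S Q. real (totient q) * g q)"
  unfolding sieve_fracs_def
  by (subst sum.Sigma[symmetric, where g = "\<lambda>q _. g q", unfolded case_prod_beta])
    (auto simp: totient_def)

lemma sieve_fracs_sum_sq:
  "(\<Sum>i\<in>sieve_fracs S Q. (1 / real (totient (fst i)))\<^sup>2) = sieve_sum S Q"
  unfolding sieve_fracs_sum[where g = "\<lambda>q. (1 / real (totient q))\<^sup>2"] sieve_sum_eq
  by (intro sum.cong) (auto simp: power2_eq_square)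

lemma sieve_fracs_sum_le:
  "(\<Sum>i\<in>sieve_fracs S Q. 1 / real (totient (fst i))) \<le> real Q"
proof -
  have "(\<Sum>i\<in>sieve_fracs S Q. 1 / real (totient (fst i))) \<le> (\<Sum>q\<in>sieve_moduli S Q. 1)"
    unfolding sieve_fracs_sum[where g = "\<lambda>q. 1 / real (totient q)"]
    by (intro sum_mono) auto
  also have "\<dots> \<le> real Q"
  proof -
    have "sieve_moduli S Q \<subseteq> {1..Q}" by (auto simp: sieve_moduli_def)
    hence "card (sieve_moduli S Q) \<le> card {1..Q}" by (intro card_mono) auto
    thus ?thesis by simp
  qed
  finally show ?thesis .
qed

text \<open>For squarefree \<open>q = p * k\<close> the totient factors as
  \<open>(p - 1) * totient k\<close>, and \<open>k\<close> is again a sieve modulus. So the part of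
  the sum that is divisible by \<open>p\<close> is at most \<open>sieve_sum S Q / (p - 1)\<close>,
  and \<open>p - 1 \<ge> z\<close>.\<close>

lemma sieve_fracs_sum_sq_dvd:
  assumes p: "prime p" "z < p" "1 \<le> z"
  shows "(\<Sum>i\<in>{i\<in>sieve_fracs S Q. p dvd fst i}. (1 / real (totient (fst i)))\<^sup>2) \<le> sieve_sum S Q / real z"
proof -
  let ?D = "{q\<in>sieve_moduli S Q. p dvd q}"
  have "{i\<in>sieve_fracs S Q. p dvd fst i} = Sigma ?D totatives"
    by (auto simp: sieve_fracs_def)
  hence "(\<Sum>i\<in>{i\<in>sieve_fracs S Q. p dvd fst i}. (1 / real (totient (fst i)))\<^sup>2)
      = (\<Sum>q\<in>?D. \<Sum>a\<in>totatives q. (1 / real (totient q))\<^sup>2)"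
    using sum.Sigma[of ?D totatives "\<lambda>q a. (1 / real (totient q))\<^sup>2"] by (simp add: case_prod_beta)
  also have "\<dots> = (\<Sum>q\<in>?D. 1 / real (totient q))"
    by (intro sum.cong) (auto simp: totient_def[symmetric] power2_eq_square)
  also have "\<dots> = (\<Sum>q\<in>?D. 1 / real (p - 1) * (1 / real (totient (q div p))))"
  proof (intro sum.cong refl)
    fix q assume "q \<in> ?D"
    then obtain k where k: "q = p * k" "squarefree q" by (auto simp: sieve_moduli_def)
    hence "coprime p k" using squarefree_mult_imp_coprime by simp
    thus "1 / real (totient q) = 1 / real (p - 1) * (1 / real (totient (q div p)))"
      using p k by (simp add: totient_mult_coprime totient_prime)
  qed
  also have "\<dots> = 1 / real (p - 1) * (\<Sum>q\<in>?D. 1 / real (totient (q div p)))"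
    by (simp only: sum_distrib_left)
  also have "(\<Sum>q\<in>?D. 1 / real (totient (q div p))) = (\<Sum>k\<in>(\<lambda>q. q div p) ` ?D. 1 / real (totient k))"
  proof -
    have "inj_on (\<lambda>q. q div p) ?D"
      using p by (auto simp: inj_on_def dest!: dvd_div_mult_self[THEN sym])
    thus ?thesis by (simp add: sum.reindex)
  qed
  also have "\<dots> \<le> sieve_sum S Q"
    unfolding sieve_sum_eq
  proof (intro sum_mono2)
    show "(\<lambda>q. q div p) ` ?D \<subseteq> sieve_moduli S Q"
    proof
      fix k assume "k \<in> (\<lambda>q. q div p) ` ?D"
      then obtain q where q: "q \<in> sieve_moduli S Q" "p dvd q" "k = q div p" by auto
      hence qk: "q = p * k" by simp
      have "k > 0" using q(1) qk by (auto simp: sieve_moduli_def intro!: Nat.gr0I)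
      moreover have "k \<le> q" using q(3) by simp
      hence "k \<le> Q" using q(1) by (simp add: sieve_moduli_def)
      moreover have "squarefree k" using squarefree_mono[of k q] q(1) qk by (simp add: sieve_moduli_def)
      moreover have "\<forall>p\<in>S. \<not> p dvd k" using q(1) qk by (auto simp: sieve_moduli_def)
      ultimately show "k \<in> sieve_moduli S Q" by (simp add: sieve_moduli_def)
    qed
  qed auto
  hence "1 / real (p - 1) * (\<Sum>k\<in>(\<lambda>q. q div p) ` ?D. 1 / real (totient k)) \<le> 1 / real (p - 1) * sieve_sum S Q"
    by (intro mult_left_mono) auto
  also have "\<dots> \<le> 1 / real z * sieve_sum S Q"
    using p by (intro mult_right_mono divide_left_mono) (auto simp: sieve_sum_def intro!: sum_nonneg mult_pos_pos)
  finally show ?thesis by simp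
qed

text \<open>The values lie in (0, 1], so an integral difference vanishes, and equal fractions in
  lowest terms have the same numerator and denominator.\<close>

lemma frac_val_inj:
  assumes "i \<in> sieve_fracs S Q" "j \<in> sieve_fracs S Q" "frac_val i - frac_val j \<in> \<int>"
  shows "i = j"
proof -
  obtain q a where i: "i = (q, a)" "q > 0" "0 < a" "a \<le> q" "coprime a q"
    using assms(1) by (auto simp: sieve_fracs_def sieve_moduli_def in_totatives_iff)
  obtain r d where j: "j = (r, d)" "r > 0" "0 < d" "d \<le> r" "coprime d r"
    using assms(2) by (auto simp: sieve_fracs_def sieve_moduli_def in_totatives_iff)
  have "0 < frac_val i" "frac_val i \<le> 1" "0 < frac_val j" "frac_val j \<le> 1"
    using i j by (auto simp: frac_val_def)
  moreover obtain k :: int where k: "frac_val i - frac_val j = of_int k" using assms(3) by (auto elim: Ints_cases)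
  ultimately have "of_int k < (1::real)" "of_int k > (- 1::real)" by linarith+
  hence "k = 0" by simp
  with k have "real a / real q = real d / real r" using i j by (simp add: frac_val_def)
  hence "real (a * r) = real (d * q)" using i j by (simp add: field_simps)
  hence eq: "a * r = d * q" by (simp only: of_nat_eq_iff)
  have "q dvd r" using eq i(5) by (metis coprime_commute coprime_dvd_mult_right_iff dvd_triv_right)
  moreover have "r dvd q" using eq j(5) by (metis coprime_commute coprime_dvd_mult_right_iff dvd_triv_right)
  ultimately have "q = r" by (rule dvd_antisym)
  with eq i show ?thesis by (simp add: j)
qed

lemma Ints_coprime_cancel:
  fixes v :: real and m q :: nat
  assumes "real m * v \<in> \<int>" "real q * v \<in> \<int>" "coprime m q"
  shows "v \<in> \<int>"
proof -
  obtain x y where "int m * x + int q * y = 1"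
    using bezout_int[of "int m" "int q"] assms(3) by (auto simp: coprime_iff_gcd_eq_1[symmetric] mult.commute gcd_int_int_eq)
  hence "v = of_int (int m * x + int q * y) * v" by simp
  also have "\<dots> = of_int x * (real m * v) + of_int y * (real q * v)" by (simp add: algebra_simps)
  also have "\<dots> \<in> \<int>" 
    by (rule Ints_add[OF Ints_mult[OF Ints_of_int assms(1)] Ints_mult[OF Ints_of_int assms(2)]])
  finally show ?thesis .
qed

text \<open>The integers \<open>r\<close> with \<open>r * v\<close> integral form an ideal; its
  least positive element divides all of them and is not 1 because \<open>v\<close> is not
  integral.\<close>

lemma Ints_least_denominator:
  fixes v :: real
  assumes "v \<notin> \<int>" "q > 0" "real q * v \<in> \<int>"
  obtains s where "s > (1::nat)" "\<And>r. real r * v \<in> \<int> \<Longrightarrow> s dvd r"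
proof -
  define s where "s = (LEAST d::nat. d > 0 \<and> real d * v \<in> \<int>)"
  have s: "s > 0 \<and> real s * v \<in> \<int>"
    unfolding s_def by (rule LeastI[of _ q]) (use assms in auto)
  have "s \<noteq> 1" using s assms(1) by auto
  hence s1: "s > 1" using s by simp
  have "s dvd r" if r: "real r * v \<in> \<int>" for r
  proof (rule ccontr)
    assume "\<not> s dvd r"
    hence pos: "r mod s > 0" by (simp add: mod_greater_zero_iff_not_dvd)
    have "real r = real (r div s) * real s + real (r mod s)"
      by (metis div_mult_mod_eq of_nat_add of_nat_mult)
    hence "real (r mod s) * v = real r * v - of_int (int (r div s)) * (real s * v)"
      by (simp add: algebra_simps)
    also have "\<dots> \<in> \<int>" 
      by (rule Ints_diff[OF r Ints_mult[OF Ints_of_int conjunct2[OF s]]])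
    finally have "s \<le> r mod s" using pos unfolding s_def by (intro Least_le) auto
    moreover have "r mod s < s" using s by simp
    ultimately show False by simp
  qed
  with s1 show thesis by (rule that)
qed

section \<open>The dual large sieve\<close>

definition near_int :: "real \<Rightarrow> real \<Rightarrow> bool" where
  "near_int \<rho> x \<longleftrightarrow> (\<exists>k::int. \<bar>x - of_int k\<bar> < \<rho>)"

text \<open>In the intended instance \<open>S\<close> consists of the prime factors of
  \<open>m\<close> and all primes up to \<open>z\<close>. Coprimality to \<open>m\<close> makes it
  possible to cancel \<open>m\<close> in congruences between fractions modulo 1; the second
  assumption forces every prime factor of a modulus above \<open>z\<close>.\<close>

locale sieve_setup =
  fixes S :: "nat set" and m z Q :: nat
  assumes coprime_m: "\<And>q. q \<in> sieve_moduli S Q \<Longrightarrow> coprime m q"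
    and small_primes: "\<And>p. prime p \<Longrightarrow> p \<le> z \<Longrightarrow> p \<in> S"
    and S_primes: "\<And>p. p \<in> S \<Longrightarrow> prime p"
    and z_ge_1: "1 \<le> z" and Q_ge_1: "1 \<le> Q"
begin

abbreviation "I \<equiv> sieve_fracs S Q"
abbreviation "G \<equiv> sieve_sum S Q"
definition wt :: "nat \<times> nat \<Rightarrow> real" where "wt i = 1 / real (totient (fst i))"
text \<open>A difference of two differences of fractions, also when multiplied by \<open>m\<close>,
  has a denominator of at most \<open>Q ^ 4\<close>. Since \<open>2 * \<rho> * Q ^ 4 = 1\<close>,
  such a number is an integer as soon as it is closer than \<open>2 * \<rho>\<close> to one.\<close>

definition "\<rho> = 1 / (2 * real Q ^ 4)"

lemma wt_nonneg: "0 \<le> wt i"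
  by (simp add: wt_def)

lemma fst_frac: "i \<in> I \<Longrightarrow> fst i \<in> sieve_moduli S Q"
  by (auto simp: sieve_fracs_def)

lemma moduli_bounds: "q \<in> sieve_moduli S Q \<Longrightarrow> 1 \<le> q \<and> q \<le> Q"
  by (auto simp: sieve_moduli_def)

lemma mult_frac_val_Ints:
  assumes "i \<in> I"
  shows "real (fst i) * frac_val i \<in> \<int>"
  using moduli_bounds[OF fst_frac[OF assms]] by (simp add: frac_val_def)

text \<open>Subtracting the two approximations eliminates \<theta>: \<open>m * v\<close> is closer
  than \<open>2 * \<rho>\<close> to an integer, and multiplication by \<open>D \<le> Q ^ 4\<close>
  makes it integral, so it is an integer itself. As \<open>D\<close> is coprime to \<open>m\<close>,
  so is \<open>v\<close>.\<close>

lemma near_frac_diff: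
  assumes i: "i \<in> I" "i' \<in> I" "j \<in> I" "j' \<in> I"
    and n1: "near_int \<rho> (\<theta> + real m * (frac_val i - frac_val i'))"
    and n2: "near_int \<rho> (\<theta> + real m * (frac_val j - frac_val j'))"
  shows "(frac_val i - frac_val i') - (frac_val j - frac_val j') \<in> \<int>"
proof -
  define v where "v = (frac_val i - frac_val i') - (frac_val j - frac_val j')"
  define D where "D = fst i * fst i' * fst j * fst j'"
  have q: "1 \<le> fst k \<and> fst k \<le> Q" if "k \<in> I" for k
    using moduli_bounds[OF fst_frac[OF that]] .
  have "D \<le> Q * Q * Q * Q" unfolding D_def using q i by (intro mult_le_mono) auto
  hence "real D \<le> real (Q * Q * Q * Q)" by (simp only: of_nat_le_iff)
  hence DQ: "real D \<le> real Q ^ 4" by (simp add: power4_eq_xxxx)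
  have D0: "D > 0"
    using q[OF i(1)] q[OF i(2)] q[OF i(3)] q[OF i(4)] unfolding D_def by simp
  have Dv: "real D * v \<in> \<int>"
  proof -
    have "real D * v = of_nat (fst i' * fst j * fst j') * (real (fst i) * frac_val i)
        - of_nat (fst i * fst j * fst j') * (real (fst i') * frac_val i')
        - of_nat (fst i * fst i' * fst j') * (real (fst j) * frac_val j)
        + of_nat (fst i * fst i' * fst j) * (real (fst j') * frac_val j')"
      by (simp add: D_def v_def algebra_simps)
    also have "\<dots> \<in> \<int>"
      by (intro Ints_add Ints_diff Ints_mult[OF Ints_of_nat] mult_frac_val_Ints i)
    finally show ?thesis .
  qed
  obtain k1 k2 :: int where k: "\<bar>\<theta> + real m * (frac_val i - frac_val i') - of_int k1\<bar> < \<rho>"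
    "\<bar>\<theta> + real m * (frac_val j - frac_val j') - of_int k2\<bar> < \<rho>"
    using n1 n2 unfolding near_int_def by blast
  have "real m * v - of_int (k1 - k2)
      = (\<theta> + real m * (frac_val i - frac_val i') - of_int k1) - (\<theta> + real m * (frac_val j - frac_val j') - of_int k2)"
    by (simp add: v_def algebra_simps)
  hence "\<bar>real m * v - of_int (k1 - k2)\<bar> < 2 * \<rho>" using k by linarith
  hence "real D * \<bar>real m * v - of_int (k1 - k2)\<bar> < real D * (2 * \<rho>)" using D0 by simp
  also have "\<dots> \<le> real Q ^ 4 * (2 * \<rho>)" using DQ by (intro mult_right_mono) (auto simp: \<rho>_def)
  also have "\<dots> = 1" using Q_ge_1 by (simp add: \<rho>_def)
  finally have lt1: "\<bar>of_nat m * (real D * v) - of_nat D * of_int (k1 - k2)\<bar> < 1"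
    using D0 by (simp add: abs_mult_pos' algebra_simps)
  have "of_nat m * (real D * v) - of_nat D * of_int (k1 - k2) \<in> \<int>"
    by (intro Ints_diff Ints_mult Dv) auto
  then obtain w :: int where w: "of_nat m * (real D * v) - of_nat D * of_int (k1 - k2) = of_int w"
    by (rule Ints_cases)
  hence "w = 0" using lt1 by simp
  hence "real D * (real m * v) = real D * of_int (k1 - k2)" using w by (simp add: algebra_simps)
  hence "real m * v = of_int (k1 - k2)" using D0 by simp
  hence mv: "real m * v \<in> \<int>" by simp
  have "coprime m D" unfolding D_def using coprime_m fst_frac i by auto
  thus ?thesis using Ints_coprime_cancel[OF mv Dv] by (simp add: v_def)
qed

text \<open>Arithmetic-geometric mean with the weight \<open>sqrt z\<close>: the fractions
  \<open>f k\<close> have denominators divisible by \<open>p\<close>, so their squared weights sum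
  to at most \<open>G / z\<close>, those of the \<open>g k\<close> to at most \<open>G\<close>, and
  the weight balances the two. Injectivity ensures that no fraction is counted twice.\<close>

lemma half_pairs_le:
  assumes T: "T \<subseteq> I \<times> I" and inj: "inj_on f T" "inj_on g T"
    and fI: "\<And>k. k \<in> T \<Longrightarrow> f k \<in> I \<and> p dvd fst (f k)" and gI: "\<And>k. k \<in> T \<Longrightarrow> g k \<in> I"
    and p: "prime p" "z < p"
  shows "(\<Sum>k\<in>T. wt (f k) * wt (g k)) \<le> G / sqrt (real z)"
proof -
  have fin: "finite T" by (rule finite_subset[OF T]) simp
  define s where "s = sqrt (real z)"
  have s: "s > 0" "s * s = real z" using z_ge_1 by (auto simp: s_def)
  have "wt a * wt b \<le> (s * (wt a)\<^sup>2 + (wt b)\<^sup>2 / s) / 2" for a b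
  proof -
    have "0 \<le> (s * wt a - wt b)\<^sup>2 / s" using s by simp
    also have "\<dots> = s * (wt a)\<^sup>2 - 2 * (wt a * wt b) + (wt b)\<^sup>2 / s"
      using s by (simp add: power2_eq_square field_simps)
    finally show ?thesis by simp
  qed
  hence "(\<Sum>k\<in>T. wt (f k) * wt (g k)) \<le> (\<Sum>k\<in>T. (s * (wt (f k))\<^sup>2 + (wt (g k))\<^sup>2 / s) / 2)"
    by (intro sum_mono)
  also have "\<dots> = (s * (\<Sum>k\<in>T. (wt (f k))\<^sup>2) + (\<Sum>k\<in>T. (wt (g k))\<^sup>2) / s) / 2"
    by (simp add: sum_divide_distrib sum.distrib sum_distrib_left add_divide_distrib)
  also have "(\<Sum>k\<in>T. (wt (f k))\<^sup>2) = (\<Sum>i\<in>f ` T. (wt i)\<^sup>2)"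
    by (simp add: sum.reindex[OF inj(1)])
  also have "(\<Sum>k\<in>T. (wt (g k))\<^sup>2) = (\<Sum>i\<in>g ` T. (wt i)\<^sup>2)"
    by (simp add: sum.reindex[OF inj(2)])
  also have "(s * (\<Sum>i\<in>f ` T. (wt i)\<^sup>2) + (\<Sum>i\<in>g ` T. (wt i)\<^sup>2) / s) / 2 \<le> (s * (G / real z) + G / s) / 2"
  proof -
    have "(\<Sum>i\<in>f ` T. (wt i)\<^sup>2) \<le> (\<Sum>i\<in>{i\<in>I. p dvd fst i}. (wt i)\<^sup>2)"
      using fI by (intro sum_mono2) auto
    also have "\<dots> \<le> G / real z"
      unfolding wt_def using p z_ge_1 by (intro sieve_fracs_sum_sq_dvd)
    finally have a: "(\<Sum>i\<in>f ` T. (wt i)\<^sup>2) \<le> G / real z" .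
    have "(\<Sum>i\<in>g ` T. (wt i)\<^sup>2) \<le> (\<Sum>i\<in>I. (wt i)\<^sup>2)"
      using gI by (intro sum_mono2) auto
    also have "\<dots> = G" unfolding wt_def by (rule sieve_fracs_sum_sq)
    finally have b: "(\<Sum>i\<in>g ` T. (wt i)\<^sup>2) \<le> G" .
    show ?thesis using s by (intro divide_right_mono add_mono mult_left_mono a b) auto
  qed
  also have "\<dots> = G / s" using s(1) unfolding s(2)[symmetric] by (simp add: field_simps)
  finally show ?thesis by (simp add: s_def)
qed

text \<open>All near pairs have the same nonzero difference modulo 1, so some prime \<open>p > z\<close> divides one
  of the two denominators of each of them; and each member of a near pair determines the other.\<close>

lemma near_pairs_sum_le:
  "(\<Sum>k\<in>{k\<in>I \<times> I. fst k \<noteq> snd k \<and> near_int \<rho> (\<theta> + real m * (frac_val (fst k) - frac_val (snd k)))}.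
      wt (fst k) * wt (snd k)) \<le> 2 * G / sqrt (real z)"
proof -
  define T where "T = {k\<in>I \<times> I. fst k \<noteq> snd k \<and> near_int \<rho> (\<theta> + real m * (frac_val (fst k) - frac_val (snd k)))}"
  have G0: "0 \<le> G" unfolding sieve_sum_def by (intro sum_nonneg) auto
  have fin: "finite T" by (simp add: T_def)
  show ?thesis
  proof (cases "T = {}")
    case True
    then show ?thesis using G0 unfolding T_def[symmetric] by simp
  next
    case False
    then obtain j j' where jj: "(j, j') \<in> T" by auto
    have TI: "i \<in> I" "i' \<in> I" if "(i, i') \<in> T" for i i' using that by (auto simp: T_def)
    have cong: "(frac_val i - frac_val i') - (frac_val l - frac_val l') \<in> \<int>"
      if "(i, i') \<in> T" "(l, l') \<in> T" for i i' l l'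
      using that by (intro near_frac_diff[where \<theta> = \<theta>]) (auto simp: T_def)
    define v where "v = frac_val j - frac_val j'"
    have "v \<notin> \<int>" using frac_val_inj[of j S Q j'] jj by (auto simp: T_def v_def)
    have den: "real (fst i * fst i') * v \<in> \<int>" if ii: "(i, i') \<in> T" for i i'
    proof -
      have "real (fst i * fst i') * v
          = real (fst i') * (real (fst i) * frac_val i) - real (fst i) * (real (fst i') * frac_val i')
            - real (fst i * fst i') * ((frac_val i - frac_val i') - v)"
        by (simp add: algebra_simps)
      also have "\<dots> \<in> \<int>"
        by (rule Ints_diff[OF Ints_diff[OF Ints_mult[OF Ints_of_nat mult_frac_val_Ints[OF TI(1)[OF ii]]]
              Ints_mult[OF Ints_of_nat mult_frac_val_Ints[OF TI(2)[OF ii]]]]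
              Ints_mult[OF Ints_of_nat cong[OF ii jj, folded v_def]]])
      finally show ?thesis .
    qed
    have "fst j * fst j' > 0" 
      using moduli_bounds[OF fst_frac[OF TI(1)[OF jj]]] moduli_bounds[OF fst_frac[OF TI(2)[OF jj]]]
      by simp
    then obtain s where s: "s > 1" "\<And>r. real r * v \<in> \<int> \<Longrightarrow> s dvd r"
      using Ints_least_denominator[OF \<open>v \<notin> \<int>\<close> _ den[OF jj]] by blast
    \<comment> \<open>One prime serves all pairs: the common difference \<open>v\<close> has the
      denominator \<open>s > 1\<close>, and \<open>s\<close> divides the product of the two
      denominators of every near pair.\<close>
    obtain p where p: "prime p" "p dvd s" using prime_factor_nat[of s] s(1) by auto
    have pd: "p dvd fst i \<or> p dvd fst i'" if "(i, i') \<in> T" for i i'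
    proof -
      have "p dvd fst i * fst i'" using p(2) s(2)[OF den[OF that]] by (rule dvd_trans)
      thus ?thesis using p(1) by (simp add: prime_dvd_mult_iff)
    qed
    have "p \<notin> S" using pd[OF jj] fst_frac[OF TI(1)[OF jj]] fst_frac[OF TI(2)[OF jj]]
      by (auto simp: sieve_moduli_def)
    hence zp: "z < p" using small_primes[OF p(1)] by (meson not_le)
    have inj1: "inj_on fst T"
    proof (rule inj_onI)
      fix x y assume *: "x \<in> T" "y \<in> T" "fst x = fst y"
      obtain i i' l' where x: "x = (i, i')" "y = (i, l')" using *(3) by (cases x, cases y) auto
      have "frac_val l' - frac_val i' \<in> \<int>" using cong[of i i' i l'] * x by simp
      hence "l' = i'" using frac_val_inj TI * x by blast
      thus "x = y" using x by simp
    qed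
    have inj2: "inj_on snd T"
    proof (rule inj_onI)
      fix x y assume *: "x \<in> T" "y \<in> T" "snd x = snd y"
      obtain i i' l where x: "x = (i, i')" "y = (l, i')" using *(3) by (cases x, cases y) auto
      have "frac_val i - frac_val l \<in> \<int>" using cong[of i i' l i'] * x by simp
      hence "i = l" using frac_val_inj TI * x by blast
      thus "x = y" using x by simp
    qed
    define T1 T2 where "T1 = {k\<in>T. p dvd fst (fst k)}" and "T2 = {k\<in>T. p dvd fst (snd k)}"
    have "p dvd fst (fst k) \<or> p dvd fst (snd k)" if "k \<in> T" for k
      using pd[of "fst k" "snd k"] that by simp
    hence TT: "T = T1 \<union> T2" unfolding T1_def T2_def by blast
    have "(\<Sum>k\<in>T1 \<union> T2. wt (fst k) * wt (snd k)) + (\<Sum>k\<in>T1 \<inter> T2. wt (fst k) * wt (snd k))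
        = (\<Sum>k\<in>T1. wt (fst k) * wt (snd k)) + (\<Sum>k\<in>T2. wt (fst k) * wt (snd k))"
      by (rule sum.union_inter) (auto simp: T1_def T2_def fin)
    moreover have "0 \<le> (\<Sum>k\<in>T1 \<inter> T2. wt (fst k) * wt (snd k))"
      by (intro sum_nonneg) (simp add: wt_nonneg)
    ultimately have "(\<Sum>k\<in>T. wt (fst k) * wt (snd k)) \<le> (\<Sum>k\<in>T1. wt (fst k) * wt (snd k)) + (\<Sum>k\<in>T2. wt (fst k) * wt (snd k))"
      unfolding TT by linarith
    also have "\<dots> \<le> G / sqrt (real z) + G / sqrt (real z)"
    proof (rule add_mono)
      show "(\<Sum>k\<in>T1. wt (fst k) * wt (snd k)) \<le> G / sqrt (real z)"
        by (rule half_pairs_le[OF _ _ _ _ _ p(1) zp])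
          (auto simp: T1_def T_def intro: inj_on_subset[OF inj1] inj_on_subset[OF inj2])
      have "(\<Sum>k\<in>T2. wt (snd k) * wt (fst k)) \<le> G / sqrt (real z)"
        by (rule half_pairs_le[OF _ _ _ _ _ p(1) zp])
          (auto simp: T2_def T_def intro: inj_on_subset[OF inj1] inj_on_subset[OF inj2])
      thus "(\<Sum>k\<in>T2. wt (fst k) * wt (snd k)) \<le> G / sqrt (real z)" by (simp only: mult.commute)
    qed
    finally show ?thesis by (simp add: T_def)
  qed
qed

text \<open>For a near pair the inner sum is estimated trivially by \<open>P\<close>, for any other
  pair as a geometric sum by \<open>1 / \<rho> = 2 * Q ^ 4\<close>; all pairs together have weight
  at most \<open>Q\<^sup>2\<close>.\<close>

lemma off_diagonal_sum_le:
  "(\<Sum>k\<in>{k\<in>I \<times> I. fst k \<noteq> snd k}. wt (fst k) * wt (snd k) *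
      norm (\<Sum>n<P. ee (real n * (\<theta> + real m * (frac_val (fst k) - frac_val (snd k))))))
    \<le> 2 * G / sqrt (real z) * real P + 2 * real Q ^ 6"
proof -
  define \<tau> where "\<tau> = (\<lambda>k. \<theta> + real m * (frac_val (fst k) - frac_val (snd k)))"
  define D where "D = (\<lambda>k. norm (\<Sum>n<P. ee (real n * \<tau> k)))"
  define A where "A = {k\<in>I \<times> I. fst k \<noteq> snd k}"
  have fin: "finite A" by (simp add: A_def)
  have rho: "\<rho> > 0" using Q_ge_1 by (simp add: \<rho>_def)
  have Dn: "D k \<le> (if near_int \<rho> (\<tau> k) then real P else 0) + 2 * real Q ^ 4" for k
  proof (cases "near_int \<rho> (\<tau> k)")
    case True
    have "D k \<le> (\<Sum>n<P. 1)" unfolding D_def by (rule sum_norm_le) simp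
    thus ?thesis using True by (simp add: add_increasing2)
  next
    case False
    hence "\<And>l::int. \<rho> \<le> \<bar>\<tau> k - of_int l\<bar>" by (auto simp: near_int_def not_less)
    from norm_sum_ee_le[OF this rho, of P] have "D k \<le> 1 / \<rho>" by (simp add: D_def)
    thus ?thesis using False by (simp add: \<rho>_def)
  qed
  have "(\<Sum>k\<in>A. wt (fst k) * wt (snd k) * D k)
      \<le> (\<Sum>k\<in>A. wt (fst k) * wt (snd k) * ((if near_int \<rho> (\<tau> k) then real P else 0) + 2 * real Q ^ 4))"
    by (intro sum_mono mult_left_mono Dn) (auto simp: wt_nonneg)
  also have "\<dots> = (\<Sum>k\<in>A. if near_int \<rho> (\<tau> k) then wt (fst k) * wt (snd k) * real P else 0)
      + (\<Sum>k\<in>A. wt (fst k) * wt (snd k)) * (2 * real Q ^ 4)"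
    unfolding sum_distrib_right sum.distrib[symmetric] by (intro sum.cong) (auto simp: algebra_simps)
  finally have le: "(\<Sum>k\<in>A. wt (fst k) * wt (snd k) * D k)
      \<le> (\<Sum>k\<in>A. if near_int \<rho> (\<tau> k) then wt (fst k) * wt (snd k) * real P else 0)
      + (\<Sum>k\<in>A. wt (fst k) * wt (snd k)) * (2 * real Q ^ 4)" .
  have eqN: "{k\<in>A. near_int \<rho> (\<tau> k)} = {k\<in>I \<times> I. fst k \<noteq> snd k \<and> near_int \<rho> (\<theta> + real m * (frac_val (fst k) - frac_val (snd k)))}"
    by (auto simp: A_def \<tau>_def)
  have "(\<Sum>k\<in>A. if near_int \<rho> (\<tau> k) then wt (fst k) * wt (snd k) * real P else 0)
      = (\<Sum>k\<in>{k\<in>A. near_int \<rho> (\<tau> k)}. wt (fst k) * wt (snd k) * real P)"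
    by (rule sum.inter_filter[OF fin, symmetric])
  also have "\<dots> = (\<Sum>k\<in>{k\<in>A. near_int \<rho> (\<tau> k)}. wt (fst k) * wt (snd k)) * real P"
    by (rule sum_distrib_right[symmetric])
  also have "\<dots> \<le> 2 * G / sqrt (real z) * real P"
    unfolding eqN by (intro mult_right_mono near_pairs_sum_le) auto
  finally have near: "(\<Sum>k\<in>A. if near_int \<rho> (\<tau> k) then wt (fst k) * wt (snd k) * real P else 0)
      \<le> 2 * G / sqrt (real z) * real P" .
  have "(\<Sum>k\<in>A. wt (fst k) * wt (snd k)) \<le> (\<Sum>k\<in>I \<times> I. wt (fst k) * wt (snd k))"
    by (intro sum_mono2) (auto simp: A_def wt_nonneg)
  also have "\<dots> = (\<Sum>i\<in>I. wt i)\<^sup>2"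
    by (simp add: power2_eq_square sum_product sum.cartesian_product case_prod_beta)
  also have "\<dots> \<le> (real Q)\<^sup>2"
    using sieve_fracs_sum_le[of S Q] by (intro power_mono) (auto simp: wt_def sum_nonneg)
  finally have "(\<Sum>k\<in>A. wt (fst k) * wt (snd k)) * (2 * real Q ^ 4) \<le> (real Q)\<^sup>2 * (2 * real Q ^ 4)"
    by (intro mult_right_mono) auto
  also have "(real Q)\<^sup>2 * (2 * real Q ^ 4) = 2 * real Q ^ 6"
    using power_add[of "real Q" 2 4] by simp
  finally show ?thesis using le near unfolding A_def D_def \<tau>_def by linarith
qed

text \<open>The square is expanded over pairs of fractions, and Parseval evaluates the diagonal. Off
  the diagonal the points \<open>x\<close> and \<open>y\<close> only add the shift
  \<open>(x - y) / P\<close>, so \<open>off_diagonal_sum_le\<close>, being uniform in its \<theta>,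
  applies to each of the \<open>(card X)\<^sup>2\<close> pairs of points.\<close>

lemma sieve_large_sieve:
  assumes X: "finite X" "X \<subseteq> {..<P}" and c: "\<And>x. x \<in> X \<Longrightarrow> norm (c x) = 1"
    and u: "\<And>i. i \<in> I \<Longrightarrow> norm (u i) = wt i"
  shows "(\<Sum>n<P. (norm (\<Sum>i\<in>I. u i * (\<Sum>x\<in>X. c x * ee (real n * (\<theta> + real m * frac_val i + real x / real P)))))\<^sup>2)
    \<le> real P * real (card X) * G + (real (card X))\<^sup>2 * (2 * G / sqrt (real z) * real P + 2 * real Q ^ 6)"
proof -
  define F where "F = (\<lambda>i n. \<Sum>x\<in>X. c x * ee (real n * (\<theta> + real m * frac_val i + real x / real P)))"
  define B where "B = (\<lambda>i j. \<Sum>n<P. F i n * cnj (F j n))"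
  define A where "A = {k\<in>I \<times> I. fst k \<noteq> snd k}"
  have "complex_of_real (\<Sum>n<P. (norm (\<Sum>i\<in>I. u i * F i n))\<^sup>2)
      = (\<Sum>n<P. \<Sum>i\<in>I. \<Sum>j\<in>I. u i * cnj (u j) * (F i n * cnj (F j n)))"
    unfolding of_real_sum complex_norm_square cnj_sum sum_product
    by (intro sum.cong refl) (simp add: mult_ac)
  also have "\<dots> = (\<Sum>i\<in>I. \<Sum>n<P. \<Sum>j\<in>I. u i * cnj (u j) * (F i n * cnj (F j n)))"
    by (rule sum.swap)
  also have "\<dots> = (\<Sum>i\<in>I. \<Sum>j\<in>I. \<Sum>n<P. u i * cnj (u j) * (F i n * cnj (F j n)))"
    by (intro sum.cong refl sum.swap)
  also have "\<dots> = (\<Sum>i\<in>I. \<Sum>j\<in>I. u i * cnj (u j) * B i j)"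
    by (simp only: B_def sum_distrib_left)
  also have "\<dots> = (\<Sum>k\<in>I \<times> I. u (fst k) * cnj (u (snd k)) * B (fst k) (snd k))"
    by (simp add: sum.cartesian_product case_prod_beta)
  also have "\<dots> = (\<Sum>k\<in>{k\<in>I \<times> I. fst k = snd k}. u (fst k) * cnj (u (snd k)) * B (fst k) (snd k))
      + (\<Sum>k\<in>A. u (fst k) * cnj (u (snd k)) * B (fst k) (snd k))"
    unfolding A_def by (subst sum.union_disjoint[symmetric]) (auto intro!: sum.cong)
  also have "{k\<in>I \<times> I. fst k = snd k} = (\<lambda>i. (i, i)) ` I" by auto
  also have "(\<Sum>k\<in>(\<lambda>i. (i, i)) ` I. u (fst k) * cnj (u (snd k)) * B (fst k) (snd k))
      = (\<Sum>i\<in>I. u i * cnj (u i) * B i i)"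
    by (subst sum.reindex) (auto simp: inj_on_def)
  finally have eq: "complex_of_real (\<Sum>n<P. (norm (\<Sum>i\<in>I. u i * F i n))\<^sup>2)
      = (\<Sum>i\<in>I. u i * cnj (u i) * B i i) + (\<Sum>k\<in>A. u (fst k) * cnj (u (snd k)) * B (fst k) (snd k))" .
  have "(\<Sum>n<P. (norm (\<Sum>i\<in>I. u i * F i n))\<^sup>2)
      \<le> norm (complex_of_real (\<Sum>n<P. (norm (\<Sum>i\<in>I. u i * F i n))\<^sup>2))"
    unfolding norm_of_real by (rule abs_ge_self)
  also have "\<dots> = norm ((\<Sum>i\<in>I. u i * cnj (u i) * B i i) + (\<Sum>k\<in>A. u (fst k) * cnj (u (snd k)) * B (fst k) (snd k)))"
    unfolding eq ..
  also have "\<dots> \<le> (\<Sum>i\<in>I. (wt i)\<^sup>2 * (real P * real (card X)))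
      + (\<Sum>k\<in>A. wt (fst k) * wt (snd k) * norm (B (fst k) (snd k)))"
  proof (rule order_trans[OF norm_triangle_ineq add_mono])
    show "norm (\<Sum>i\<in>I. u i * cnj (u i) * B i i) \<le> (\<Sum>i\<in>I. (wt i)\<^sup>2 * (real P * real (card X)))"
    proof (rule sum_norm_le)
      fix i assume i: "i \<in> I"
      have "B i i = complex_of_real (\<Sum>n<P. (norm (F i n))\<^sup>2)"
        unfolding B_def of_real_sum complex_norm_square ..
      also have "(\<Sum>n<P. (norm (F i n))\<^sup>2) = real P * (\<Sum>x\<in>X. (norm (c x))\<^sup>2)"
        unfolding F_def by (rule parseval_points[OF X])
      also have "\<dots> = real P * real (card X)" using c by simp
      finally have "norm (B i i) = real P * real (card X)" by (simp add: norm_mult)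
      thus "norm (u i * cnj (u i) * B i i) \<le> (wt i)\<^sup>2 * (real P * real (card X))"
        using u[OF i] by (simp add: norm_mult power2_eq_square)
    qed
    show "norm (\<Sum>k\<in>A. u (fst k) * cnj (u (snd k)) * B (fst k) (snd k))
        \<le> (\<Sum>k\<in>A. wt (fst k) * wt (snd k) * norm (B (fst k) (snd k)))"
      by (rule sum_norm_le) (auto simp: norm_mult A_def u)
  qed
  also have "(\<Sum>i\<in>I. (wt i)\<^sup>2 * (real P * real (card X))) = real P * real (card X) * G"
    unfolding sum_distrib_right[symmetric] wt_def sieve_fracs_sum_sq by simp
  also have "(\<Sum>k\<in>A. wt (fst k) * wt (snd k) * norm (B (fst k) (snd k)))
     \<le> (\<Sum>k\<in>A. wt (fst k) * wt (snd k) * (\<Sum>x\<in>X. \<Sum>y\<in>X. norm (\<Sum>n<P.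
          ee (real n * ((real x / real P - real y / real P) + real m * (frac_val (fst k) - frac_val (snd k)))))))"
  proof (intro sum_mono mult_left_mono)
    fix k assume "k \<in> A"
    have "B (fst k) (snd k) = (\<Sum>n<P. \<Sum>x\<in>X. \<Sum>y\<in>X. (c x * cnj (c y)) *
          ee (real n * ((real x / real P - real y / real P) + real m * (frac_val (fst k) - frac_val (snd k)))))"
      unfolding B_def F_def cnj_sum sum_product
    proof (intro sum.cong refl)
      fix n x y
      have "real n * ((real x / real P - real y / real P) + real m * (frac_val (fst k) - frac_val (snd k)))
         = real n * (\<theta> + real m * frac_val (fst k) + real x / real P) - real n * (\<theta> + real m * frac_val (snd k) + real y / real P)"
        by (simp add: algebra_simps)
      thus "c x * ee (real n * (\<theta> + real m * frac_val (fst k) + real x / real P)) *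
          cnj (c y * ee (real n * (\<theta> + real m * frac_val (snd k) + real y / real P)))
        = (c x * cnj (c y)) *
          ee (real n * ((real x / real P - real y / real P) + real m * (frac_val (fst k) - frac_val (snd k))))"
        by (simp only: ee_diff complex_cnj_mult mult_ac)
    qed
    also have "\<dots> = (\<Sum>x\<in>X. \<Sum>n<P. \<Sum>y\<in>X. (c x * cnj (c y)) *
          ee (real n * ((real x / real P - real y / real P) + real m * (frac_val (fst k) - frac_val (snd k)))))"
      by (rule sum.swap)
    also have "\<dots> = (\<Sum>x\<in>X. \<Sum>y\<in>X. \<Sum>n<P. (c x * cnj (c y)) *
          ee (real n * ((real x / real P - real y / real P) + real m * (frac_val (fst k) - frac_val (snd k)))))"
      by (intro sum.cong refl sum.swap)
    also have "norm \<dots> \<le> (\<Sum>x\<in>X. \<Sum>y\<in>X. norm (\<Sum>n<P.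
          ee (real n * ((real x / real P - real y / real P) + real m * (frac_val (fst k) - frac_val (snd k))))))"
      by (intro sum_norm_le) (auto simp: sum_distrib_left[symmetric] norm_mult c)
    finally show "norm (B (fst k) (snd k)) \<le> (\<Sum>x\<in>X. \<Sum>y\<in>X. norm (\<Sum>n<P.
          ee (real n * ((real x / real P - real y / real P) + real m * (frac_val (fst k) - frac_val (snd k))))))" .
  qed (auto simp: wt_nonneg)
  also have "\<dots> = (\<Sum>x\<in>X. \<Sum>y\<in>X. \<Sum>k\<in>A. wt (fst k) * wt (snd k) * norm (\<Sum>n<P.
          ee (real n * ((real x / real P - real y / real P) + real m * (frac_val (fst k) - frac_val (snd k))))))"
    unfolding sum_distrib_left
    by (subst sum.swap, intro sum.cong refl, subst sum.swap, rule refl)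
  also have "\<dots> \<le> (\<Sum>x\<in>X. \<Sum>y\<in>X. 2 * G / sqrt (real z) * real P + 2 * real Q ^ 6)"
    unfolding A_def by (intro sum_mono off_diagonal_sum_le)
  also have "\<dots> = (real (card X))\<^sup>2 * (2 * G / sqrt (real z) * real P + 2 * real Q ^ 6)"
    by (simp add: power2_eq_square)
  finally show ?thesis by (simp add: F_def)
qed

end

context sieve_setup
begin

lemma sieve_sum_ge_1: "1 \<le> G"
proof -
  have "\<not> p dvd 1" if "p \<in> S" for p using S_primes[OF that] not_prime_unit by blast
  hence "1 \<in> sieve_moduli S Q" using Q_ge_1 by (auto simp: sieve_moduli_def)
  hence "(\<Sum>q\<in>{1}. 1 / real (totient q)) \<le> G"
    unfolding sieve_sum_eq by (intro sum_mono2) auto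
  thus ?thesis by simp
qed

text \<open>If \<open>t = m n + b\<close> is coprime to all moduli, then the Ramanujan sum of each modulus \<open>q\<close> at \<open>t\<close> has
  the constant value \<open>\<plusminus>1\<close>. So \<open>G\<close> times the exponential at \<open>n \<xi>\<close> is a fixed linear combination of the
  exponentials at \<open>n (\<xi> + m a / q)\<close>, and the gain in the bound is the factor \<open>1 / G\<close> that this produces.\<close>

lemma sieve_dual_bound:
  fixes c :: "nat \<Rightarrow> complex" and lam W :: "nat \<Rightarrow> real"
  assumes X: "finite X" "X \<subseteq> {..N}" and c: "\<And>x. x \<in> X \<Longrightarrow> norm (c x) = 1"
    and L: "L \<subseteq> {..N}" and cop: "\<And>n q. n \<in> L \<Longrightarrow> q \<in> sieve_moduli S Q \<Longrightarrow> coprime (m * n + b) q"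
    and lam: "\<And>n. n \<in> L \<Longrightarrow> 0 \<le> lam n" "\<And>n. n \<in> L \<Longrightarrow> lam n \<le> H * W n" and "0 \<le> H" and W: "\<And>n. 0 \<le> W n"
    and E: "\<And>\<theta>. norm (\<Sum>n\<le>N. complex_of_real (W n - 1) * ee (real n * \<theta>)) \<le> E"
  shows "(\<Sum>n\<in>L. lam n * (norm (\<Sum>x\<in>X. c x * ee (real n * (\<theta> + real x / real (N + 1)))))\<^sup>2)
    \<le> H / G\<^sup>2 * (real (N + 1) * real (card X) * G
        + (real (card X))\<^sup>2 * (2 * G / sqrt (real z) * real (N + 1) + 2 * real Q ^ 6)
        + E * (real (card X) * real Q)\<^sup>2)"
proof -
  \<comment> \<open>The phase \<open>ee (b * a / q)\<close> moves the argument from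
    \<open>m * n\<close> to \<open>m * n + b\<close>. The conjugate Ramanujan sum cancels the value
    of the sum over \<open>a\<close>, so that each modulus contributes \<open>1 / totient q\<close>,
    in total \<open>G\<close>.\<close>
  define u where "u = (\<lambda>i. ee (real b * frac_val i) * cnj (ramanujan_one (fst i)) / of_nat (totient (fst i)))"
  define s where "s = (\<lambda>n. \<Sum>x\<in>X. c x * ee (real n * (\<theta> + real x / real (N + 1))))"
  define R where "R = (\<lambda>n. norm (\<Sum>i\<in>I. u i * (\<Sum>x\<in>X. c x * ee (real n * (\<theta> + real m * frac_val i + real x / real (N + 1))))))"
  have E0: "0 \<le> E" using E[of 0] norm_ge_zero order_trans by blast
  have u: "norm (u i) = wt i" if "i \<in> I" for i
  proof -
    have "squarefree (fst i)" using fst_frac[OF that] by (simp add: sieve_moduli_def)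
    thus ?thesis by (simp add: u_def norm_mult norm_divide norm_ramanujan_one wt_def)
  qed
  have G0: "0 < G" using sieve_sum_ge_1 by simp
  have key: "(\<Sum>i\<in>I. u i * ee (real n * (real m * frac_val i))) = of_real G" if n: "n \<in> L" for n
  proof -
    have "(\<Sum>i\<in>I. u i * ee (real n * (real m * frac_val i)))
        = (\<Sum>q\<in>sieve_moduli S Q. \<Sum>a\<in>totatives q. cnj (ramanujan_one q) / of_nat (totient q) * ee (real (a * (m * n + b)) / real q))"
      unfolding sieve_fracs_def
    proof (subst sum.Sigma)
      show "(\<Sum>i\<in>Sigma (sieve_moduli S Q) totatives. u i * ee (real n * (real m * frac_val i)))
        = (\<Sum>(q, a)\<in>Sigma (sieve_moduli S Q) totatives. cnj (ramanujan_one q) / of_nat (totient q) * ee (real (a * (m * n + b)) / real q))"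
      proof (intro sum.cong refl)
        fix i :: "nat \<times> nat"
        obtain q a where i: "i = (q, a)" by (cases i)
        have "real (a * (m * n + b)) / real q = real b * frac_val i + real n * (real m * frac_val i)"
          by (simp add: i frac_val_def add_divide_distrib algebra_simps)
        hence "ee (real (a * (m * n + b)) / real q) = ee (real b * frac_val i) * ee (real n * (real m * frac_val i))"
          by (simp only: ee_add)
        thus "u i * ee (real n * (real m * frac_val i)) = (case i of (q, a) \<Rightarrow>
            cnj (ramanujan_one q) / of_nat (totient q) * ee (real (a * (m * n + b)) / real q))"
          by (simp add: i u_def)
      qed
    qed auto
    also have "\<dots> = (\<Sum>q\<in>sieve_moduli S Q. of_real (1 / real (totient q)))"
    proof (intro sum.cong refl)
      fix q assume q: "q \<in> sieve_moduli S Q"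
      have "(\<Sum>a\<in>totatives q. ee (real (a * (m * n + b)) / real q)) = ramanujan_one q"
        using cop[OF n q] moduli_bounds[OF q] by (intro ramanujan_sum_coprime) auto
      hence "(\<Sum>a\<in>totatives q. cnj (ramanujan_one q) / of_nat (totient q) * ee (real (a * (m * n + b)) / real q))
          = ramanujan_one q * cnj (ramanujan_one q) / of_nat (totient q)"
        by (simp only: sum_distrib_left[symmetric]) simp
      also have "ramanujan_one q * cnj (ramanujan_one q) = 1"
        using q by (simp add: complex_norm_square[symmetric] norm_ramanujan_one sieve_moduli_def)
      finally show "(\<Sum>a\<in>totatives q. cnj (ramanujan_one q) / of_nat (totient q) * ee (real (a * (m * n + b)) / real q))
          = of_real (1 / real (totient q))" by simp
    qed
    also have "\<dots> = of_real G" by (simp add: sieve_sum_eq)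
    finally show ?thesis .
  qed
  have Rs: "R n = G * norm (s n)" if n: "n \<in> L" for n
  proof -
    have "(\<Sum>i\<in>I. u i * (\<Sum>x\<in>X. c x * ee (real n * (\<theta> + real m * frac_val i + real x / real (N + 1)))))
       = (\<Sum>i\<in>I. (u i * ee (real n * (real m * frac_val i))) * s n)"
    proof (intro sum.cong refl)
      fix i
      have "real n * (\<theta> + real m * frac_val i + real x / real (N + 1))
          = real n * (real m * frac_val i) + real n * (\<theta> + real x / real (N + 1))" for x
        by (simp add: algebra_simps)
      thus "u i * (\<Sum>x\<in>X. c x * ee (real n * (\<theta> + real m * frac_val i + real x / real (N + 1))))
          = (u i * ee (real n * (real m * frac_val i))) * s n"
        by (simp only: s_def ee_add sum_distrib_left mult_ac)
    qed
    also have "\<dots> = of_real G * s n" using key[OF n] by (simp only: sum_distrib_right[symmetric])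
    finally show ?thesis using G0 by (simp add: R_def norm_mult)
  qed
  have "(\<Sum>n\<in>L. lam n * (norm (s n))\<^sup>2) = (\<Sum>n\<in>L. lam n * (R n)\<^sup>2) / G\<^sup>2"
    unfolding sum_divide_distrib using G0 by (intro sum.cong) (auto simp: Rs power_mult_distrib)
  also have "\<dots> \<le> (\<Sum>n\<in>L. H * W n * (R n)\<^sup>2) / G\<^sup>2"
    by (intro divide_right_mono sum_mono mult_right_mono lam) auto
  also have "\<dots> \<le> (\<Sum>n\<le>N. H * W n * (R n)\<^sup>2) / G\<^sup>2"
    using W \<open>0 \<le> H\<close> L by (intro divide_right_mono sum_mono2) auto
  also have "\<dots> = H / G\<^sup>2 * (\<Sum>n\<le>N. W n * (R n)\<^sup>2)"
    by (simp add: sum_distrib_left sum_divide_distrib mult_ac)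
  also have "\<dots> \<le> H / G\<^sup>2 * (real (N + 1) * real (card X) * G
        + (real (card X))\<^sup>2 * (2 * G / sqrt (real z) * real (N + 1) + 2 * real Q ^ 6)
        + E * (real (card X) * real Q)\<^sup>2)"
  proof (rule mult_left_mono)
    \<comment> \<open>\<open>R\<close> is read as one exponential sum with a frequency for each pair
      of a fraction and a point, so that replacing \<open>W\<close> by 1 costs only the sum of the
      absolute coefficients, at most \<open>card X * Q\<close>.\<close>
    define \<beta> where "\<beta> = (\<lambda>k::(nat \<times> nat) \<times> nat. u (fst k) * c (snd k))"
    define \<eta> where "\<eta> = (\<lambda>k::(nat \<times> nat) \<times> nat. \<theta> + real m * frac_val (fst k) + real (snd k) / real (N + 1))"
    have Rn: "R n = norm (\<Sum>k\<in>I \<times> X. \<beta> k * ee (real n * \<eta> k))" for n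
      unfolding R_def \<beta>_def \<eta>_def
      by (simp only: sum_distrib_left sum.cartesian_product split_def mult.assoc)
    have bsum: "(\<Sum>k\<in>I \<times> X. norm (\<beta> k)) \<le> real (card X) * real Q"
    proof -
      have "(\<Sum>k\<in>I \<times> X. norm (\<beta> k)) = (\<Sum>i\<in>I. \<Sum>x\<in>X. norm (u i) * norm (c x))"
        by (simp add: \<beta>_def norm_mult sum.cartesian_product case_prod_beta)
      also have "\<dots> = (\<Sum>i\<in>I. wt i * real (card X))"
        by (intro sum.cong refl) (simp add: u c mult.commute)
      also have "\<dots> = (\<Sum>i\<in>I. wt i) * real (card X)"
        by (rule sum_distrib_right[symmetric])
      also have "\<dots> \<le> real Q * real (card X)"
        using sieve_fracs_sum_le[of S Q] by (intro mult_right_mono) (auto simp: wt_def)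
      finally show ?thesis by (simp add: mult.commute)
    qed
    have "(\<Sum>n\<le>N. W n * (R n)\<^sup>2) \<le> (\<Sum>n\<le>N. (R n)\<^sup>2) + E * (\<Sum>k\<in>I \<times> X. norm (\<beta> k))\<^sup>2"
      unfolding Rn by (rule weighted_sum_le[OF E])
    also have "\<dots> \<le> (\<Sum>n\<le>N. (R n)\<^sup>2) + E * (real (card X) * real Q)\<^sup>2"
      using bsum E0 by (intro add_left_mono mult_left_mono power_mono) (auto intro: sum_nonneg)
    also have "(\<Sum>n\<le>N. (R n)\<^sup>2) = (\<Sum>n<N + 1. (R n)\<^sup>2)"
      by (simp add: lessThan_Suc_atMost)
    also have "\<dots> \<le> real (N + 1) * real (card X) * G
        + (real (card X))\<^sup>2 * (2 * G / sqrt (real z) * real (N + 1) + 2 * real Q ^ 6)"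
      unfolding R_def using X c u by (intro sieve_large_sieve) (auto simp: less_Suc_eq_le)
    finally show "(\<Sum>n\<le>N. W n * (R n)\<^sup>2) \<le> real (N + 1) * real (card X) * G
        + (real (card X))\<^sup>2 * (2 * G / sqrt (real z) * real (N + 1) + 2 * real Q ^ 6)
        + E * (real (card X) * real Q)\<^sup>2" by simp
  qed (use \<open>0 \<le> H\<close> in auto)
  finally show ?thesis by (simp add: s_def)
qed

end

text \<open>The smallest value on \<open>X\<close> is a level attained on all of \<open>X\<close>,
  hence bounded in terms of \<open>card X\<close>. Removing its point and repeating shows that the
  \<open>j\<close>-th largest value is at most \<open>sqrt (A * j powr (- \<tau>))\<close>.\<close>

lemma sum_powr_rank_le:
  fixes s :: "'a \<Rightarrow> real"
  assumes "finite X" "0 \<le> A" "0 < r" "\<And>x. x \<in> X \<Longrightarrow> 0 \<le> s x"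
    and "\<And>Y \<alpha>. Y \<subseteq> X \<Longrightarrow> Y \<noteq> {} \<Longrightarrow> 0 \<le> \<alpha> \<Longrightarrow> (\<And>x. x \<in> Y \<Longrightarrow> \<alpha> \<le> s x) \<Longrightarrow> \<alpha>\<^sup>2 \<le> A * real (card Y) powr (- \<tau>)"
  shows "(\<Sum>x\<in>X. s x powr r) \<le> A powr (r / 2) * (\<Sum>j=1..card X. real j powr (- (\<tau> * r / 2)))"
  using assms(1,4,5)
proof (induction "card X" arbitrary: X)
  case 0
  then show ?case by simp
next
  case (Suc k)
  have ne: "X \<noteq> {}" using Suc.hyps(2) by auto
  obtain x where x: "x \<in> X" "\<And>y. y \<in> X \<Longrightarrow> s x \<le> s y"
    using arg_min_if_finite(1)[OF Suc.prems(1) ne, of s] arg_min_least[OF Suc.prems(1) ne, of _ s] by blast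
  have c: "card (X - {x}) = k" using Suc.hyps(2) x Suc.prems(1) by simp
  have IH: "(\<Sum>y\<in>X - {x}. s y powr r) \<le> A powr (r / 2) * (\<Sum>j=1..k. real j powr (- (\<tau> * r / 2)))"
    unfolding c[symmetric]
    by (rule Suc.hyps(1)[OF c[symmetric]]) (use Suc.prems in \<open>auto intro!: Suc.prems(3)\<close>)
  have "(s x)\<^sup>2 \<le> A * real (Suc k) powr (- \<tau>)"
    using Suc.prems(3)[of X "s x"] ne x Suc.prems(2) Suc.hyps(2) by simp
  hence "((s x)\<^sup>2) powr (r / 2) \<le> (A * real (Suc k) powr (- \<tau>)) powr (r / 2)"
    using assms(3) by (intro powr_mono2) auto
  also have "\<dots> = A powr (r / 2) * real (Suc k) powr (- (\<tau> * r / 2))"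
    using assms(2) by (simp add: powr_mult powr_powr)
  also have "((s x)\<^sup>2) powr (r / 2) = s x powr r"
    using Suc.prems(2)[OF x(1)] by (cases "s x = 0") (auto simp: powr_powr simp flip: powr_numeral)
  finally have "s x powr r \<le> A powr (r / 2) * real (Suc k) powr (- (\<tau> * r / 2))" .
  moreover have "(\<Sum>y\<in>X. s y powr r) = s x powr r + (\<Sum>y\<in>X - {x}. s y powr r)"
    using x(1) Suc.prems(1) by (rule sum.remove[rotated])
  ultimately show ?case using IH unfolding Suc.hyps(2)[symmetric] by (simp add: algebra_simps)
qed

lemma integral_split_equal_parts:
  fixes g :: "real \<Rightarrow> real"
  assumes "continuous_on UNIV g" "0 \<le> (d::real)"
  shows "integral {0..real k * d} g = integral {0..d} (\<lambda>\<theta>. \<Sum>j<k. g (\<theta> + real j * d))"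
proof (induction k)
  case 0
  then show ?case by simp
next
  case (Suc k)
  have int: "f integrable_on {a..b}" if "continuous_on UNIV f" for f :: "real \<Rightarrow> real" and a b
    using that by (intro integrable_continuous_real continuous_on_subset[OF that]) auto
  have cont: "continuous_on UNIV (\<lambda>\<theta>. g (\<theta> + e))" for e
    by (rule continuous_on_compose2[OF assms(1)]) (auto intro!: continuous_intros)
  have "integral {0..real (Suc k) * d} g = integral {0..real k * d} g + integral {real k * d..real (Suc k) * d} g"
    using assms(2) int[OF assms(1)]
    by (intro Henstock_Kurzweil_Integration.integral_combine[symmetric]) (auto intro: mult_right_mono)
  also have "integral {real k * d..real (Suc k) * d} g = integral {0 + real k * d..d + real k * d} g"
    by (simp add: algebra_simps)
  also have "\<dots> = integral {0..d} (g \<circ> (\<lambda>x. x + real k * d))"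
    by (rule integral_shift[symmetric]) (rule continuous_on_subset[OF assms(1)], simp)
  finally show ?case
    unfolding Suc.IH using int[OF cont] int[OF continuous_on_sum, of "{..<k}" "\<lambda>j \<theta>. g (\<theta> + real j * d)"] cont
    by (simp add: o_def integral_add)
qed

text \<open>The unit interval is cut into \<open>P\<close> pieces of length \<open>1 / P\<close>;
  translating them to the first one turns the integral into an integral over \<theta> of sums over
  the shifted grid.\<close>

lemma Lr_norm_torus_le:
  assumes cont: "continuous_on UNIV F" and "0 < r" "0 < P"
    and B: "\<And>\<theta>. (\<Sum>j<P. norm (F (\<theta> + real j / real P)) powr r) \<le> B"
  shows "Lr_norm_torus r F \<le> (B / real P) powr (1 / r)"
proof -
  define g where "g = (\<lambda>\<theta>. norm (F \<theta>) powr r)"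
  have cg: "continuous_on UNIV g"
    unfolding g_def using assms(2) cont by (intro continuous_on_powr' continuous_intros) auto
  have int: "set_integrable lborel {0..1} g"
    by (intro borel_integrable_atLeastAtMost' continuous_on_subset[OF cg]) auto
  have "(LINT \<xi>:{0..<1}|lborel. g \<xi>) = (LINT \<xi>:{0..1}|lborel. g \<xi>)"
    by (rule set_integral_discrete_difference[of "{1}"]) auto
  also have "\<dots> = integral {0..1} g" by (rule set_borel_integral_eq_integral(2)[OF int])
  also have "\<dots> = integral {0..real P * (1 / real P)} g" using assms(3) by simp
  also have "\<dots> = integral {0..1 / real P} (\<lambda>\<theta>. \<Sum>j<P. g (\<theta> + real j * (1 / real P)))"
    by (rule integral_split_equal_parts[OF cg]) simp
  also have "\<dots> \<le> integral {0..1 / real P} (\<lambda>\<theta>. B)"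
  proof (rule integral_le)
    have "continuous_on UNIV (\<lambda>\<theta>. g (\<theta> + e))" for e
      by (rule continuous_on_compose2[OF cg]) (auto intro!: continuous_intros)
    thus "(\<lambda>\<theta>. \<Sum>j<P. g (\<theta> + real j * (1 / real P))) integrable_on {0..1 / real P}"
      by (intro integrable_continuous_real continuous_on_sum) (auto intro: continuous_on_subset)
  qed (use B in \<open>auto simp: g_def\<close>)
  also have "\<dots> = B / real P" by simp
  finally have "(LINT \<xi>:{0..<1}|lborel. g \<xi>) \<le> B / real P" .
  moreover have "0 \<le> (LINT \<xi>:{0..<1}|lborel. g \<xi>)"
    unfolding set_lebesgue_integral_def by (intro integral_nonneg_AE) (auto simp: g_def)
  ultimately show ?thesis
    unfolding Lr_norm_torus_def g_def using assms(2) by (intro powr_mono2) auto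
qed

section \<open>The inverse of a function of the class\<close>

lemma deriv_on_works:
  assumes "f differentiable_on S" "x \<in> S"
  shows "(f has_real_derivative deriv_on S f x) (at x within S)"
  using assms unfolding differentiable_on_def deriv_on_def
  by (simp add: vector_derivative_works has_real_derivative_iff_has_vector_derivative)

lemma at_within_Ici_neq_bot:
  assumes "(a::real) \<le> x"
  shows "at x within {a..} \<noteq> bot"
proof
  assume "at x within {a..} = bot"
  moreover have "at_right x \<le> at x within {a..}" using assms by (intro at_le) auto
  ultimately show False using trivial_limit_at_right_real[of x] by (simp add: bot_unique)
qed

lemma deriv_within_Ici_unique:
  assumes "(f has_real_derivative D) (at x within {a..})" "(f has_real_derivative D') (at x within {a..})"
    and "(a::real) \<le> x"
  shows "D = D'"
  using assms vector_derivative_unique_within[OF at_within_Ici_neq_bot[OF assms(3)]]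
  by (simp add: has_real_derivative_iff_has_vector_derivative)

lemma has_derivative_Ici_subset:
  assumes "(f has_real_derivative D) (at x within {a..})" "a \<le> u"
  shows "(f has_derivative (*) D) (at x within {u..(v::real)})"
  using DERIV_subset[OF assms(1), of "{u..v}"] assms(2) unfolding has_field_derivative_def by auto

lemma has_derivative_Ici_interior:
  assumes "(f has_real_derivative D) (at x within {a..})" "(a::real) < x"
  shows "(f has_real_derivative D) (at x)"
proof -
  have "at x within {a..} = at x"
    by (rule at_within_interior) (use assms(2) in simp)
  with assms(1) show ?thesis by simp
qed

lemma deriv_integral_Ici:
  assumes "continuous_on {a..} g" "(a::real) \<le> x"
  shows "((\<lambda>u. integral {a..u} g) has_real_derivative g x) (at x within {a..})"
proof -
  have "((\<lambda>u. integral {a..u} g) has_vector_derivative g x) (at x within {a..x + 1})"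
    using assms by (intro integral_has_vector_derivative continuous_on_subset[OF assms(1)]) auto
  moreover have "at x within {a..x + 1} = at x within {a..}"
    by (rule at_within_nhd[of _ "{..<x + 1}"]) auto
  ultimately show ?thesis by (simp add: has_real_derivative_iff_has_vector_derivative)
qed

locale ps_function =
  fixes c x0 :: real and h :: "real \<Rightarrow> real"
  assumes c_ge_1: "1 \<le> c" and h_class: "h \<in> F_class c x0"
begin

definition "H1 = deriv_on {x0..} h"
definition "H2 = deriv_on {x0..} H1"

lemma x0_ge_1: "1 \<le> x0" and h_ge_1: "x0 \<le> x \<Longrightarrow> 1 \<le> h x"
  using h_class by (auto simp: F_class_def)

lemma h_deriv: "x0 \<le> x \<Longrightarrow> (h has_real_derivative H1 x) (at x within {x0..})"
  and H1_deriv: "x0 \<le> x \<Longrightarrow> (H1 has_real_derivative H2 x) (at x within {x0..})"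
  using h_class unfolding F_class_def H1_def H2_def
  by (auto simp: numeral_3_eq_3 intro!: deriv_on_works)

lemma H1_pos: "x0 \<le> x \<Longrightarrow> 0 < H1 x" and H2_pos: "x0 \<le> x \<Longrightarrow> 0 < H2 x"
  using h_class unfolding F_class_def H1_def H2_def by (auto simp: numeral_2_eq_2)

lemma H1_strict_mono:
  assumes "x0 \<le> x" "x < y"
  shows "H1 x < H1 y"
proof -
  have "\<exists>z\<in>{x<..<y}. H1 y - H1 x = H2 z * (y - x)"
    using assms by (intro mvt_simple has_derivative_Ici_subset[OF H1_deriv]) auto
  then obtain z where z: "z \<in> {x<..<y}" "H1 y - H1 x = H2 z * (y - x)" by blast
  hence "H2 z * (y - x) > 0" using assms H2_pos[of z] by auto
  with z show ?thesis by simp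
qed

lemma H1_mono: "x0 \<le> x \<Longrightarrow> x \<le> y \<Longrightarrow> H1 x \<le> H1 y"
  using H1_strict_mono[of x y] by (cases "x = y") auto

lemma h_increment_ge:
  assumes "x0 \<le> x" "x \<le> y"
  shows "H1 x * (y - x) \<le> h y - h x"
proof (cases "x = y")
  case False
  with assms have "x < y" by simp
  have "\<exists>z\<in>{x<..<y}. h y - h x = H1 z * (y - x)"
    using assms \<open>x < y\<close> by (intro mvt_simple has_derivative_Ici_subset[OF h_deriv]) auto
  then obtain z where z: "z \<in> {x<..<y}" "h y - h x = H1 z * (y - x)" by blast
  thus ?thesis using assms H1_mono[of x z] by (auto intro!: mult_right_mono)
qed simp

lemma h_strict_mono:
  assumes "x0 \<le> x" "x < y"
  shows "h x < h y"
proof -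
  have "0 < H1 x * (y - x)" using H1_pos[OF assms(1)] assms by simp
  also have "\<dots> \<le> h y - h x" using h_increment_ge assms by simp
  finally show ?thesis by simp
qed

lemma h_at_top: "filterlim h at_top at_top"
proof (rule filterlim_at_top_mono)
  show "filterlim (\<lambda>x. h x0 + H1 x0 * (x - x0)) at_top at_top"
  proof -
    have "filterlim (\<lambda>x. a + b * (x - d)) at_top at_top" if "0 < b" for a b d :: real
      using that by real_asymp
    thus ?thesis using H1_pos[of x0] by simp
  qed
  show "\<forall>\<^sub>F x in at_top. h x0 + H1 x0 * (x - x0) \<le> h x"
    using eventually_ge_at_top[of x0]
    by eventually_elim (use h_increment_ge[of x0] in \<open>simp add: algebra_simps\<close>)
qed

text \<open>Logarithmic differentiation of the representation of \<open>h\<close>, carried out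
  twice. For \<open>c > 1\<close> the bracket in the formula for \<open>H2\<close> tends to
  \<open>c * (c - 1)\<close>; for \<open>c = 1\<close> it tends to 0 like \<theta>, so the
  information special to that case has to be passed on.\<close>

lemma log_derivative:
  obtains \<theta> T where
    "\<And>x. x0 \<le> x \<Longrightarrow> (\<theta> has_real_derivative T x) (at x within {x0..})"
    "\<And>x. x0 \<le> x \<Longrightarrow> x * H1 x = h x * (c + \<theta> x)"
    "\<And>x. x0 \<le> x \<Longrightarrow> x\<^sup>2 * H2 x = h x * ((c + \<theta> x) * (c - 1 + \<theta> x) + x * T x)"
    "(\<theta> \<longlongrightarrow> 0) at_top"
    "c > 1 \<Longrightarrow> ((\<lambda>x. x * T x) \<longlongrightarrow> 0) at_top"
    "c = 1 \<Longrightarrow> ((\<lambda>x. x * T x / \<theta> x) \<longlongrightarrow> 0) at_top"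
    "c = 1 \<Longrightarrow> (\<forall>x\<ge>x0. 0 < \<theta> x)"
    "c = 1 \<Longrightarrow> (\<forall>\<epsilon>>0. \<exists>K>0. \<forall>x\<ge>x0. 1 / \<theta> x \<le> K * x powr \<epsilon>)"
proof -
  from h_class obtain \<theta> C where *: "C_k_on 2 \<theta> {x0..}" "0 < C"
      "\<forall>x\<ge>x0. h x = C * x powr c * exp (integral {x0..x} (\<lambda>t. \<theta> t / t))"
      "c > 1 \<longrightarrow> (\<theta> \<longlongrightarrow> 0) at_top \<and> ((\<lambda>x. x * deriv_on {x0..} \<theta> x) \<longlongrightarrow> 0) at_top"
      "c = 1 \<longrightarrow> (\<forall>x\<ge>x0. 0 < \<theta> x) \<and> (\<forall>\<epsilon>>0. \<exists>K>0. \<forall>x\<ge>x0. 1 / \<theta> x \<le> K * x powr \<epsilon>) \<and>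
           (\<theta> \<longlongrightarrow> 0) at_top \<and>
           ((\<lambda>x. x * deriv_on {x0..} \<theta> x / \<theta> x) \<longlongrightarrow> 0) at_top"
    unfolding F_class_def by auto
  define T where "T = deriv_on {x0..} \<theta>"
  have T: "(\<theta> has_real_derivative T x) (at x within {x0..})" if "x0 \<le> x" for x
    using *(1) that unfolding T_def by (intro deriv_on_works) (auto simp: numeral_2_eq_2)
  have cont: "continuous_on {x0..} \<theta>"
    using T DERIV_continuous_on[of "{x0..}" \<theta> T] by auto
  define g where "g = (\<lambda>t. \<theta> t / t)"
  have cg: "continuous_on {x0..} g"
    unfolding g_def using cont x0_ge_1 by (intro continuous_intros) auto
  have e1: "x * H1 x = h x * (c + \<theta> x)" if x: "x0 \<le> x" for x
  proof -
    have x1: "x \<ge> 1" using x x0_ge_1 by simp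
    let ?F = "\<lambda>x. C * x powr c * exp (integral {x0..x} g)"
    have "(?F has_real_derivative (?F x * (c + \<theta> x) / x)) (at x within {x0..})"
    proof -
      have d1: "((\<lambda>x. x powr c) has_real_derivative c * x powr (c - 1)) (at x within {x0..})"
        using x1 by (intro DERIV_subset[OF has_real_derivative_powr]) auto
      have "(?F has_real_derivative (C * (c * x powr (c - 1)) * exp (integral {x0..x} g)
            + C * x powr c * (exp (integral {x0..x} g) * g x))) (at x within {x0..})"
        by (rule derivative_eq_intros d1 deriv_integral_Ici[OF cg x] refl | simp add: algebra_simps)+
      moreover have "C * (c * x powr (c - 1)) * exp (integral {x0..x} g)
            + C * x powr c * (exp (integral {x0..x} g) * g x) = ?F x * (c + \<theta> x) / x"
        using x1 by (simp add: powr_diff g_def field_simps)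
      ultimately show ?thesis by (simp only:)
    qed
    hence "(h has_real_derivative (?F x * (c + \<theta> x) / x)) (at x within {x0..})"
      by (rule has_field_derivative_transform_within[of _ _ _ _ 1]) (use x *(3) in \<open>auto simp: g_def\<close>)
    from deriv_within_Ici_unique[OF h_deriv[OF x] this x]
    have "H1 x = h x * (c + \<theta> x) / x" using *(3) x by (simp add: g_def)
    thus ?thesis using x1 by simp
  qed
  have e2: "x\<^sup>2 * H2 x = h x * ((c + \<theta> x) * (c - 1 + \<theta> x) + x * T x)" if x: "x0 \<le> x" for x
  proof -
    have x1: "x \<ge> 1" using x x0_ge_1 by simp
    have "((\<lambda>x. h x * (c + \<theta> x)) has_real_derivative (H1 x * (c + \<theta> x) + T x * h x)) (at x within {x0..})"
      by (rule derivative_eq_intros h_deriv[OF x] T[OF x] refl | simp)+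
    moreover have "((\<lambda>x. x * H1 x) has_real_derivative (H1 x + H2 x * x)) (at x within {x0..})"
      by (rule derivative_eq_intros H1_deriv[OF x] refl | simp)+
    hence "((\<lambda>x. h x * (c + \<theta> x)) has_real_derivative (H1 x + H2 x * x)) (at x within {x0..})"
      by (rule has_field_derivative_transform_within[of _ _ _ _ 1]) (use x e1 in auto)
    ultimately have "H1 x * (c + \<theta> x) + T x * h x = H1 x + H2 x * x"
      using deriv_within_Ici_unique x by blast
    hence "x * (H1 x * (c + \<theta> x) + T x * h x) = x * (H1 x + H2 x * x)" by simp
    hence "x\<^sup>2 * H2 x = (x * H1 x) * (c + \<theta> x - 1) + x * T x * h x"
      by (simp add: algebra_simps power2_eq_square)
    also have "\<dots> = h x * ((c + \<theta> x) * (c - 1 + \<theta> x) + x * T x)"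
      unfolding e1[OF x] by (simp add: algebra_simps)
    finally show ?thesis .
  qed
  have lim: "(\<theta> \<longlongrightarrow> 0) at_top" using *(4,5) c_ge_1 by (cases "c = 1") auto
  show thesis
    by (rule that[of \<theta> T]) (use T e1 e2 lim *(4,5) in \<open>auto simp: T_def\<close>)
qed

text \<open>This amounts to bounds for \<open>c + \<theta>\<close>. Near infinity \<theta> is small;
  on the remaining compact interval extrema exist, and the minimum of \<open>c + \<theta>\<close> is
  positive because the derivative of \<open>h\<close> is.\<close>

lemma H1_bounds:
  obtains c1 c2 where "0 < c1" "c1 \<le> c2"
    "\<And>x. x0 \<le> x \<Longrightarrow> c1 * h x \<le> x * H1 x" "\<And>x. x0 \<le> x \<Longrightarrow> x * H1 x \<le> c2 * h x"
proof -
  obtain \<theta> T where T: "\<And>x. x0 \<le> x \<Longrightarrow> (\<theta> has_real_derivative T x) (at x within {x0..})"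
    and e1: "\<And>x. x0 \<le> x \<Longrightarrow> x * H1 x = h x * (c + \<theta> x)" and lim: "(\<theta> \<longlongrightarrow> 0) at_top"
    by (rule log_derivative) (rule that; assumption)
  have cont: "continuous_on {x0..} \<theta>"
    using T DERIV_continuous_on[of "{x0..}" \<theta> T] by auto
  have "\<forall>\<^sub>F x in at_top. \<bar>\<theta> x\<bar> < 1 / 2"
    using order_tendstoD(2)[OF tendsto_rabs[OF lim], of "1 / 2"] by simp
  then obtain X where X: "\<And>x. X \<le> x \<Longrightarrow> \<bar>\<theta> x\<bar> < 1 / 2" by (auto simp: eventually_at_top_linorder)
  define X' where "X' = max x0 X"
  have cont': "continuous_on {x0..X'} \<theta>" by (rule continuous_on_subset[OF cont]) auto
  have ne: "{x0..X'} \<noteq> {}" by (simp add: X'_def)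
  obtain a where a: "a \<in> {x0..X'}" "\<And>y. y \<in> {x0..X'} \<Longrightarrow> \<theta> a \<le> \<theta> y"
    using continuous_attains_inf[OF compact_Icc ne cont'] by blast
  obtain b where b: "b \<in> {x0..X'}" "\<And>y. y \<in> {x0..X'} \<Longrightarrow> \<theta> y \<le> \<theta> b"
    using continuous_attains_sup[OF compact_Icc ne cont'] by blast
  define c1 where "c1 = min (1 / 2) (c + \<theta> a)"
  define c2 where "c2 = max (c + 1 / 2) (c + \<theta> b)"
  have "0 < a * H1 a" using a(1) H1_pos[of a] x0_ge_1 by (intro mult_pos_pos) auto
  hence "0 < h a * (c + \<theta> a)" using e1[of a] a(1) by simp
  hence "0 < c + \<theta> a" using h_ge_1[of a] a by (auto simp: zero_less_mult_iff)
  hence c1: "0 < c1" by (simp add: c1_def)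
  have b1: "c1 \<le> c + \<theta> x" "c + \<theta> x \<le> c2" if "x0 \<le> x" for x
  proof -
    have "c1 \<le> c + \<theta> x \<and> c + \<theta> x \<le> c2"
    proof (cases "x \<le> X'")
      case True
      with a(2)[of x] b(2)[of x] that show ?thesis by (auto simp: c1_def c2_def)
    next
      case False
      hence "\<bar>\<theta> x\<bar> < 1 / 2" using X by (simp add: X'_def)
      thus ?thesis using c_ge_1 by (auto simp: c1_def c2_def)
    qed
    thus "c1 \<le> c + \<theta> x" "c + \<theta> x \<le> c2" by auto
  qed
  show thesis
  proof (rule that[OF c1])
    show "c1 \<le> c2" using b1[of x0] by simp
    fix x assume x: "x0 \<le> x"
    show "c1 * h x \<le> x * H1 x" "x * H1 x \<le> c2 * h x"
      using mult_right_mono[OF b1(1)[OF x], of "h x"] mult_right_mono[OF b1(2)[OF x], of "h x"] h_ge_1[OF x]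
      unfolding e1[OF x] by (simp_all only: mult.commute)
  qed
qed

text \<open>For \<open>a = c + \<epsilon> / 2\<close> and \<open>a = c - \<epsilon> / 2\<close> the
  derivative \<open>(c + \<theta> x - a) / x\<close> of \<open>ln (h x) - a * ln x\<close>
  eventually has constant sign; the other \<open>\<epsilon> / 2\<close> absorbs the value at the
  starting point.\<close>

lemma h_growth:
  assumes "0 < \<epsilon>"
  shows "\<forall>\<^sub>F x in at_top. x powr (c - \<epsilon>) \<le> h x \<and> h x \<le> x powr (c + \<epsilon>)"
proof -
  obtain \<theta> T where e1: "\<And>x. x0 \<le> x \<Longrightarrow> x * H1 x = h x * (c + \<theta> x)" and lim: "(\<theta> \<longlongrightarrow> 0) at_top"
    by (rule log_derivative) (rule that; assumption)
  have "\<forall>\<^sub>F x in at_top. \<bar>\<theta> x\<bar> < \<epsilon> / 2"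
    using order_tendstoD(2)[OF tendsto_rabs[OF lim], of "\<epsilon> / 2"] assms by simp
  then obtain X0 where X0: "\<And>x. X0 \<le> x \<Longrightarrow> \<bar>\<theta> x\<bar> < \<epsilon> / 2" by (auto simp: eventually_at_top_linorder)
  define X where "X = max (x0 + 1) X0"
  have X: "X > x0" "X \<ge> 1" using x0_ge_1 by (auto simp: X_def)
  have d: "((\<lambda>x. ln (h x) - a * ln x) has_real_derivative ((c + \<theta> x - a) / x)) (at x)" if x: "X \<le> x" for x a
  proof -
    have x1: "x0 < x" "1 \<le> x" using X x by auto
    have "((\<lambda>x. ln (h x) - a * ln x) has_real_derivative (1 / h x * H1 x - a * (1 / x))) (at x)"
    proof -
      have dh: "(h has_real_derivative H1 x) (at x)"
        using has_derivative_Ici_interior[OF h_deriv] x1 by simp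
      have "h x > 0" "x > 0" using x1 h_ge_1[of x] by auto
      thus ?thesis
        by (intro DERIV_diff DERIV_cmult) (auto intro!: derivative_eq_intros dh)
    qed
    moreover have "H1 x = h x * (c + \<theta> x) / x" using e1[of x] x1 by (simp add: field_simps)
    hence "1 / h x * H1 x - a * (1 / x) = (c + \<theta> x - a) / x"
      using x1 h_ge_1[of x] by (simp add: field_simps)
    ultimately show ?thesis by simp
  qed
  have up: "ln (h x) - (c + \<epsilon> / 2) * ln x \<le> ln (h X) - (c + \<epsilon> / 2) * ln X" if x: "X \<le> x" for x
  proof (rule DERIV_nonpos_imp_nonincreasing[OF x])
    fix y assume y: "X \<le> y" "y \<le> x"
    have "\<bar>\<theta> y\<bar> < \<epsilon> / 2" using y by (intro X0) (simp add: X_def)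
    hence "(c + \<theta> y - (c + \<epsilon> / 2)) / y \<le> 0" using y X by (intro divide_nonpos_nonneg) auto
    with d[OF y(1)] show "\<exists>z. ((\<lambda>x. ln (h x) - (c + \<epsilon> / 2) * ln x) has_real_derivative z) (at y) \<and> z \<le> 0"
      by blast
  qed
  have lo: "ln (h X) - (c - \<epsilon> / 2) * ln X \<le> ln (h x) - (c - \<epsilon> / 2) * ln x" if x: "X \<le> x" for x
  proof (rule DERIV_nonneg_imp_nondecreasing[OF x])
    fix y assume y: "X \<le> y" "y \<le> x"
    have "\<bar>\<theta> y\<bar> < \<epsilon> / 2" using y by (intro X0) (simp add: X_def)
    hence "(c + \<theta> y - (c - \<epsilon> / 2)) / y \<ge> 0" using y X by (intro divide_nonneg_nonneg) auto
    with d[OF y(1)] show "\<exists>z. ((\<lambda>x. ln (h x) - (c - \<epsilon> / 2) * ln x) has_real_derivative z) (at y) \<and> 0 \<le> z"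
      by blast
  qed
  have lnE: "\<forall>\<^sub>F x in at_top. a \<le> \<epsilon> / 2 * ln x" for a :: real
    using assms by real_asymp
  have "\<forall>\<^sub>F x in at_top. ln (h X) - (c + \<epsilon> / 2) * ln X \<le> \<epsilon> / 2 * ln x"
    by (rule lnE)
  moreover have "\<forall>\<^sub>F x in at_top. - (ln (h X) - (c - \<epsilon> / 2) * ln X) \<le> \<epsilon> / 2 * ln x"
    by (rule lnE)
  ultimately show ?thesis using eventually_ge_at_top[of X]
  proof eventually_elim
    case (elim x)
    have hx: "h x > 0" using h_ge_1[of x] X elim by auto
    have "ln (h x) \<le> (c + \<epsilon>) * ln x" using up[of x] elim by (simp add: algebra_simps)
    moreover have "(c - \<epsilon>) * ln x \<le> ln (h x)" using lo[of x] elim by (simp add: algebra_simps)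
    ultimately have "exp ((c - \<epsilon>) * ln x) \<le> exp (ln (h x))" "exp (ln (h x)) \<le> exp ((c + \<epsilon>) * ln x)"
      by (simp_all only: exp_le_cancel_iff)
    thus ?case using X elim hx by (simp add: powr_def)
  qed
qed

text \<open>For \<open>c > 1\<close> the bracket \<open>B\<close> tends to
  \<open>c * (c - 1) > 0\<close>. For \<open>c = 1\<close> it is \<theta> times a factor between 1/2
  and 2, and \<open>1 / \<theta>\<close> grows more slowly than any power; this accounts for the
  loss \<open>x powr (- \<epsilon>)\<close> in the lower bound.\<close>

lemma H2_bounds:
  assumes "0 < \<epsilon>"
  shows "\<forall>\<^sub>F x in at_top. x powr (- \<epsilon>) * h x \<le> x\<^sup>2 * H2 x \<and> x\<^sup>2 * H2 x \<le> (c\<^sup>2 + 1) * h x"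
proof -
  obtain \<theta> T where
    e2: "\<And>x. x0 \<le> x \<Longrightarrow> x\<^sup>2 * H2 x = h x * ((c + \<theta> x) * (c - 1 + \<theta> x) + x * T x)" and
    lim: "(\<theta> \<longlongrightarrow> 0) at_top" and
    g1: "c > 1 \<Longrightarrow> ((\<lambda>x. x * T x) \<longlongrightarrow> 0) at_top" and
    eq1: "c = 1 \<Longrightarrow> ((\<lambda>x. x * T x / \<theta> x) \<longlongrightarrow> 0) at_top"
    "c = 1 \<Longrightarrow> (\<forall>x\<ge>x0. 0 < \<theta> x)"
    "c = 1 \<Longrightarrow> (\<forall>\<epsilon>>0. \<exists>K>0. \<forall>x\<ge>x0. 1 / \<theta> x \<le> K * x powr \<epsilon>)"
    by (rule log_derivative) (rule that; assumption)
  define B where "B = (\<lambda>x. (c + \<theta> x) * (c - 1 + \<theta> x) + x * T x)"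
  have "\<forall>\<^sub>F x in at_top. x powr (- \<epsilon>) \<le> B x \<and> B x \<le> c\<^sup>2 + 1"
  proof (cases "c = 1")
    case False
    hence c: "c > 1" using c_ge_1 by simp
    have "(B \<longlongrightarrow> (c + 0) * (c - 1 + 0) + 0) at_top"
      unfolding B_def by (intro tendsto_intros lim g1 c)
    hence limB: "(B \<longlongrightarrow> c * (c - 1)) at_top" by simp
    have "c * (c - 1) < c\<^sup>2 + 1" using c by (simp add: algebra_simps power2_eq_square)
    hence "\<forall>\<^sub>F x in at_top. B x < c\<^sup>2 + 1" by (rule order_tendstoD[OF limB])
    moreover have "\<forall>\<^sub>F x in at_top. c * (c - 1) / 2 < B x"
      using c by (intro order_tendstoD[OF limB]) (auto simp: field_simps)
    moreover have "\<forall>\<^sub>F x in at_top. x powr (- \<epsilon>) < c * (c - 1) / 2"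
      using assms c by (intro order_tendstoD[OF tendsto_neg_powr[OF _ filterlim_ident]]) auto
    ultimately show ?thesis by eventually_elim auto
  next
    case True
    obtain K where K: "K > 0" "\<And>x. x \<ge> x0 \<Longrightarrow> 1 / \<theta> x \<le> K * x powr (\<epsilon> / 2)"
      using eq1(3)[OF True] assms by (meson half_gt_zero)
    have "\<forall>\<^sub>F x in at_top. \<bar>x * T x / \<theta> x\<bar> < 1 / 2"
      using order_tendstoD(2)[OF tendsto_rabs[OF eq1(1)[OF True]], of "1 / 2"] by simp
    moreover have "\<forall>\<^sub>F x in at_top. \<theta> x < 1 / 2" using order_tendstoD(2)[OF lim, of "1 / 2"] by simp
    moreover have "\<forall>\<^sub>F x::real in at_top. x powr (- \<epsilon>) * (2 * K * x powr (\<epsilon> / 2)) \<le> 1"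
      using assms K(1) by real_asymp
    ultimately show ?thesis using eventually_ge_at_top[of x0]
    proof eventually_elim
      case (elim x)
      have th: "\<theta> x > 0" using eq1(2)[OF True] elim by simp
      have x1: "x \<ge> 1" using elim x0_ge_1 by simp
      have B: "B x = \<theta> x * (1 + \<theta> x + x * T x / \<theta> x)"
        using th by (simp add: B_def True field_simps)
      have w: "1 / 2 \<le> 1 + \<theta> x + x * T x / \<theta> x" "1 + \<theta> x + x * T x / \<theta> x \<le> 2"
        using elim(1,2) th by linarith+
      have "\<theta> x / 2 \<le> B x"
        unfolding B using mult_left_mono[OF w(1), of "\<theta> x"] th by simp
      moreover have "\<theta> x * (1 + \<theta> x + x * T x / \<theta> x) \<le> 1 / 2 * 2"
        using th elim(2) w by (intro mult_mono) linarith+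
      hence "B x \<le> 1" unfolding B by simp
      moreover have "x powr (- \<epsilon>) \<le> \<theta> x / 2"
      proof -
        have "1 \<le> \<theta> x * (K * x powr (\<epsilon> / 2))" using K(2)[of x] elim th by (simp add: field_simps)
        hence "x powr (- \<epsilon>) * 1 \<le> x powr (- \<epsilon>) * (\<theta> x * (K * x powr (\<epsilon> / 2)))"
          by (intro mult_left_mono) auto
        also have "\<dots> = (x powr (- \<epsilon>) * (2 * K * x powr (\<epsilon> / 2))) * (\<theta> x / 2)" by simp
        also have "\<dots> \<le> 1 * (\<theta> x / 2)" using elim th by (intro mult_right_mono) auto
        finally show ?thesis by simp
      qed
      ultimately show ?case by (simp add: True)
    qed
  qed
  thus ?thesis using eventually_ge_at_top[of x0]
  proof eventually_elim
    case (elim x)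
    have "h x \<ge> 0" using h_ge_1[of x] elim by simp
    with elim(1) have "x powr (- \<epsilon>) * h x \<le> B x * h x" "B x * h x \<le> (c\<^sup>2 + 1) * h x"
      by (auto intro!: mult_right_mono)
    moreover have "B x * h x = x\<^sup>2 * H2 x"
      unfolding e2[OF elim(2)] B_def by (rule mult.commute)
    ultimately show ?case by simp
  qed
qed

end

lemma powr_mult_divide:
  assumes "0 < (y::real)" "a + b - 1 = d"
  shows "y powr a * y powr b / y = y powr d"
  using assms by (auto simp: powr_add powr_diff)

lemma powr_mult_divide2:
  assumes "0 < (y::real)" "a + b - 2 = d"
  shows "y powr a * (y powr b / y\<^sup>2) = y powr d"
  using assms by (auto simp: powr_add powr_diff)

context ps_function
begin

section \<open>The inverse function and its derivatives\<close>

definition "h0 = h x0"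
definition "gam = 1 / c"
definition "phi = the_inv_into {x0..} h"
definition "dphi = deriv_on {h0..} phi"
text \<open>The second derivative of \<open>phi\<close>, obtained by differentiating
  \<open>1 / H1 (phi y)\<close>.\<close>

definition "ddphi y = - (H2 (phi y) / H1 (phi y) ^ 3)"

lemma h0_ge_1: "1 \<le> h0"
  using h_ge_1[of x0] by (simp add: h0_def)

lemma gam_bounds: "0 < gam" "gam \<le> 1"
  using c_ge_1 by (auto simp: gam_def)

lemma inj_on_h: "inj_on h {x0..}"
proof (rule inj_onI)
  fix x y assume "x \<in> {x0..}" "y \<in> {x0..}" "h x = h y"
  thus "x = y" using h_strict_mono[of x y] h_strict_mono[of y x] by (cases x y rule: linorder_cases) auto
qed

lemma h_image: "h ` {x0..} = {h0..}"
proof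
  show "h ` {x0..} \<subseteq> {h0..}"
  proof
    fix y assume "y \<in> h ` {x0..}"
    then obtain x where "x \<ge> x0" "y = h x" by auto
    thus "y \<in> {h0..}" using h_strict_mono[of x0 x] by (cases "x = x0") (auto simp: h0_def)
  qed
  show "{h0..} \<subseteq> h ` {x0..}"
  proof
    fix y assume y: "y \<in> {h0..}"
    have "\<forall>\<^sub>F x in at_top. y \<le> h x \<and> x0 \<le> x"
      using h_at_top eventually_ge_at_top[of x0] by (auto simp: filterlim_at_top eventually_conj)
    then obtain b where b: "y \<le> h b" "x0 \<le> b" by (auto simp: eventually_at_top_linorder)
    have "continuous_on {x0..} h"
      using h_deriv DERIV_continuous_on[of "{x0..}" h H1] by auto
    hence "continuous_on {x0..b} h" by (rule continuous_on_subset) auto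
    hence "\<exists>x\<ge>x0. x \<le> b \<and> h x = y"
      using IVT'[of h x0 y b] y b by (auto simp: h0_def)
    thus "y \<in> h ` {x0..}" by force
  qed
qed

lemma phi_ge: "h0 \<le> y \<Longrightarrow> x0 \<le> phi y"
  using the_inv_into_into[OF inj_on_h, of y "{x0..}"] h_image by (auto simp: phi_def)

lemma h_phi: "h0 \<le> y \<Longrightarrow> h (phi y) = y"
  using f_the_inv_into_f[OF inj_on_h, of y] h_image by (auto simp: phi_def)

lemma phi_h: "x0 \<le> x \<Longrightarrow> phi (h x) = x"
  using the_inv_into_f_f[OF inj_on_h, of x] by (auto simp: phi_def)

lemma phi_strict_mono:
  assumes "h0 \<le> y" "y < z"
  shows "phi y < phi z"
proof (rule ccontr)
  assume "\<not> phi y < phi z"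
  hence "h (phi z) \<le> h (phi y)"
    using h_strict_mono[of "phi z" "phi y"] phi_ge assms by (cases "phi y = phi z") auto
  with assms show False by (simp add: h_phi)
qed

lemma phi_mono: "h0 \<le> y \<Longrightarrow> y \<le> z \<Longrightarrow> phi y \<le> phi z"
  using phi_strict_mono[of y z] by (cases "y = z") auto

text \<open>By convexity \<open>h\<close> grows from \<open>phi y\<close> on at least at the rate
  \<open>H1 (phi y)\<close>, so its inverse grows at most at the reciprocal rate.\<close>

lemma phi_increment_le:
  assumes "h0 \<le> y" "y \<le> z"
  shows "phi z - phi y \<le> (z - y) / H1 (phi y)"
proof -
  have "H1 (phi y) * (phi z - phi y) \<le> h (phi z) - h (phi y)"
    using assms phi_mono phi_ge by (intro h_increment_ge) auto
  hence "(phi z - phi y) * H1 (phi y) \<le> z - y" using assms by (simp add: h_phi mult.commute)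
  thus ?thesis using assms H1_pos[OF phi_ge] by (simp add: pos_le_divide_eq)
qed

lemma phi_lipschitz:
  assumes "h0 \<le> y" "h0 \<le> z"
  shows "\<bar>phi z - phi y\<bar> \<le> \<bar>z - y\<bar> / H1 x0"
  using assms
proof (induction y z rule: linorder_wlog)
  case (le y z)
  have "phi z - phi y \<le> (z - y) / H1 (phi y)" using le by (intro phi_increment_le) auto
  also have "\<dots> \<le> (z - y) / H1 x0"
    using le H1_pos[of x0] H1_mono[of x0 "phi y"] phi_ge[of y]
    by (intro divide_left_mono mult_pos_pos) (auto intro: less_le_trans)
  finally show ?case using le phi_mono[of y z] by simp
next
  case (sym y z)
  thus ?case by (simp add: abs_minus_commute)
qed

text \<open>The difference quotient of \<open>phi\<close> is the reciprocal of that of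
  \<open>h\<close> between the points \<open>phi z\<close> and \<open>phi y\<close>; the Lipschitz
  bound gives the continuity needed to pass to the limit. Working within \<open>{h0..}\<close>
  includes the end point, where the derivative is one-sided.\<close>

lemma phi_deriv:
  assumes y: "h0 \<le> y"
  shows "(phi has_real_derivative 1 / H1 (phi y)) (at y within {h0..})"
proof -
  define p where "p = phi y"
  have p: "x0 \<le> p" using phi_ge y by (simp add: p_def)
  have "((\<lambda>z. \<bar>z - y\<bar> / H1 x0) \<longlongrightarrow> \<bar>y - y\<bar> / H1 x0) (at y within {h0..})"
    using H1_pos[of x0] by (intro tendsto_intros) auto
  hence "((\<lambda>z. \<bar>z - y\<bar> / H1 x0) \<longlongrightarrow> 0) (at y within {h0..})" by simp
  hence "((\<lambda>z. phi z - p) \<longlongrightarrow> 0) (at y within {h0..})"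
    by (rule Lim_null_comparison[rotated])
      (use phi_lipschitz[OF y] in \<open>auto simp: eventually_at_filter p_def\<close>)
  hence "(phi \<longlongrightarrow> p) (at y within {h0..})" by (rule LIM_zero_cancel)
  moreover have "\<forall>\<^sub>F z in at y within {h0..}. phi z \<in> {x0..} \<and> phi z \<noteq> p"
    unfolding eventually_at_filter
  proof (rule always_eventually, intro allI impI)
    fix z assume "z \<noteq> y" "z \<in> {h0..}"
    thus "phi z \<in> {x0..} \<and> phi z \<noteq> p"
      using phi_ge[of z] h_phi[of z] h_phi[OF y] by (auto simp: p_def)
  qed
  ultimately have fl: "filterlim phi (at p within {x0..}) (at y within {h0..})"
    by (simp add: filterlim_at)
  have "((\<lambda>x. (h x - h p) / (x - p)) \<longlongrightarrow> H1 p) (at p within {x0..})"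
    using h_deriv[OF p] by (simp add: has_field_derivative_iff)
  from filterlim_compose[OF this fl]
  have "((\<lambda>z. (h (phi z) - h p) / (phi z - p)) \<longlongrightarrow> H1 p) (at y within {h0..})" .
  hence "((\<lambda>z. inverse ((h (phi z) - h p) / (phi z - p))) \<longlongrightarrow> inverse (H1 p)) (at y within {h0..})"
    using H1_pos[OF p] by (intro tendsto_inverse) auto
  hence "((\<lambda>z. (phi z - phi y) / (z - y)) \<longlongrightarrow> inverse (H1 p)) (at y within {h0..})"
    by (rule Lim_transform_eventually)
      (auto simp: eventually_at_filter h_phi p_def y)
  thus ?thesis by (simp add: has_field_derivative_iff p_def inverse_eq_divide)
qed

lemma dphi_eq: "h0 \<le> y \<Longrightarrow> dphi y = 1 / H1 (phi y)"
proof -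
  assume y: "h0 \<le> y"
  have "phi differentiable_on {h0..}"
    using phi_deriv by (auto simp: differentiable_on_def real_differentiable_def)
  hence "(phi has_real_derivative dphi y) (at y within {h0..})"
    unfolding dphi_def using y by (intro deriv_on_works) auto
  from deriv_within_Ici_unique[OF this phi_deriv[OF y] y] show ?thesis .
qed

lemma dphi_pos: "h0 \<le> y \<Longrightarrow> 0 < dphi y"
  using H1_pos[OF phi_ge] by (simp add: dphi_eq)

lemma dphi_antimono:
  assumes "h0 \<le> y" "y \<le> z"
  shows "dphi z \<le> dphi y"
proof -
  have "H1 (phi y) \<le> H1 (phi z)" using assms by (intro H1_mono phi_ge phi_mono) auto
  moreover have "0 < H1 (phi y)" using assms by (intro H1_pos phi_ge) auto
  ultimately show ?thesis using assms by (simp add: dphi_eq frac_le)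
qed

lemma phi_deriv_at: "h0 < y \<Longrightarrow> (phi has_real_derivative dphi y) (at y)"
  using has_derivative_Ici_interior[OF phi_deriv, of y] by (simp add: dphi_eq)

lemma dphi_deriv_at:
  assumes "h0 < y"
  shows "(dphi has_real_derivative ddphi y) (at y)"
proof -
  have p: "x0 < phi y"
    using phi_strict_mono[of h0 y] assms phi_ge[of h0] by simp
  have d1: "(H1 has_real_derivative H2 (phi y)) (at (phi y))"
    using has_derivative_Ici_interior[OF H1_deriv] p by simp
  have H: "H1 (phi y) > 0" using H1_pos p by simp
  have "((\<lambda>y. H1 (phi y)) has_real_derivative H2 (phi y) * dphi y) (at y)"
    by (rule DERIV_chain2[OF d1 phi_deriv_at[OF assms]])
  hence "((\<lambda>y. 1 / H1 (phi y)) has_real_derivative - (H2 (phi y) * dphi y) / (H1 (phi y))\<^sup>2) (at y)"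
    using H by (auto intro!: derivative_eq_intros simp: power2_eq_square)
  moreover have "- (H2 (phi y) * dphi y) / (H1 (phi y))\<^sup>2 = ddphi y"
    using assms by (simp add: ddphi_def dphi_eq power2_eq_square power3_eq_cube)
  ultimately have *: "((\<lambda>y. 1 / H1 (phi y)) has_real_derivative ddphi y) (at y)" by simp
  show ?thesis
    by (rule has_field_derivative_transform_within[OF *, of "y - h0"])
      (use assms in \<open>auto simp: dphi_eq dist_real_def abs_if split: if_splits\<close>)
qed

lemma phi_at_top: "filterlim phi at_top at_top"
  unfolding filterlim_at_top eventually_at_top_linorder
proof
  fix Z
  show "\<exists>N. \<forall>n\<ge>N. Z \<le> phi n"
  proof (intro exI allI impI)
    fix y assume y: "h (max Z x0) \<le> y"
    have "h0 \<le> h (max Z x0)" using h_image by auto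
    hence "phi (h (max Z x0)) \<le> phi y" using y by (rule phi_mono)
    thus "Z \<le> phi y" by (simp add: phi_h)
  qed
qed

lemma dphi_bounds:
  obtains c1 c2 where "0 < c1" "0 < c2"
    "\<And>y. h0 \<le> y \<Longrightarrow> c1 * phi y / y \<le> dphi y" "\<And>y. h0 \<le> y \<Longrightarrow> dphi y \<le> c2 * phi y / y"
proof -
  obtain c1 c2 where c: "0 < c1" "c1 \<le> c2"
    "\<And>x. x0 \<le> x \<Longrightarrow> c1 * h x \<le> x * H1 x" "\<And>x. x0 \<le> x \<Longrightarrow> x * H1 x \<le> c2 * h x"
    by (rule H1_bounds) (rule that; assumption)
  have *: "1 / c2 * phi y / y \<le> dphi y \<and> dphi y \<le> 1 / c1 * phi y / y" if y: "h0 \<le> y" for y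
  proof -
    have p: "x0 \<le> phi y" by (rule phi_ge[OF y])
    have "phi y > 0" "y > 0" "H1 (phi y) > 0" using p x0_ge_1 y h0_ge_1 H1_pos[OF p] by auto
    thus ?thesis using c(3)[OF p] c(4)[OF p] c(1,2)
      by (simp add: dphi_eq[OF y] h_phi[OF y] field_simps)
  qed
  show thesis
    by (rule that[of "1 / c2" "1 / c1"]) (use * c(1,2) in auto)
qed

text \<open>Inverts the growth of \<open>h\<close> at \<open>phi y\<close>; \<delta> is so small
  that \<open>1 / (c - \<delta>)\<close> and \<open>1 / (c + \<delta>)\<close> are within \<epsilon>
  of \<open>gam\<close>.\<close>

lemma phi_growth:
  assumes "0 < \<epsilon>"
  shows "\<forall>\<^sub>F y in at_top. y powr (gam - \<epsilon>) \<le> phi y \<and> phi y \<le> y powr (gam + \<epsilon>)"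
proof -
  define \<delta> where "\<delta> = min (\<epsilon> / 2) (1 / 2)"
  have d: "0 < \<delta>" "\<delta> \<le> \<epsilon> / 2" "\<delta> \<le> 1 / 2" using assms by (auto simp: \<delta>_def)
  have cd: "1 / 2 \<le> c - \<delta>" using c_ge_1 d by simp
  have e1: "1 / (c - \<delta>) \<le> gam + \<epsilon>"
  proof -
    have "1 / (c - \<delta>) - 1 / c = \<delta> / (c * (c - \<delta>))" using cd c_ge_1 by (simp add: field_simps)
    also have "\<dots> \<le> \<delta> / (1 * (1 / 2))"
      using cd c_ge_1 d by (intro divide_left_mono mult_mono) auto
    finally show ?thesis using d by (simp add: gam_def)
  qed
  have e2: "gam - \<epsilon> \<le> 1 / (c + \<delta>)"
  proof -
    have "1 / c - 1 / (c + \<delta>) = \<delta> / (c * (c + \<delta>))" using d c_ge_1 by (simp add: field_simps)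
    also have "\<dots> \<le> \<delta> / (1 * 1)"
      using c_ge_1 d by (intro divide_left_mono mult_mono) auto
    finally show ?thesis using d by (simp add: gam_def)
  qed
  have "\<forall>\<^sub>F y in at_top. phi y powr (c - \<delta>) \<le> h (phi y) \<and> h (phi y) \<le> phi y powr (c + \<delta>)"
    using eventually_compose_filterlim[OF h_growth[OF d(1)] phi_at_top] .
  thus ?thesis using eventually_ge_at_top[of h0]
  proof eventually_elim
    case (elim y)
    have y1: "y \<ge> 1" using elim h0_ge_1 by simp
    have p1: "phi y \<ge> 1" using phi_ge[OF elim(2)] x0_ge_1 by simp
    have "(phi y powr (c - \<delta>)) powr (1 / (c - \<delta>)) \<le> y powr (1 / (c - \<delta>))"
      using elim cd by (intro powr_mono2) (auto simp: h_phi)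
    hence "phi y \<le> y powr (1 / (c - \<delta>))" using cd p1 by (simp add: powr_powr)
    also have "\<dots> \<le> y powr (gam + \<epsilon>)" using e1 y1 by (intro powr_mono) auto
    finally have 1: "phi y \<le> y powr (gam + \<epsilon>)" .
    have "y powr (gam - \<epsilon>) \<le> y powr (1 / (c + \<delta>))" using e2 y1 by (intro powr_mono) auto
    also have "\<dots> \<le> (phi y powr (c + \<delta>)) powr (1 / (c + \<delta>))"
      using elim c_ge_1 d y1 by (intro powr_mono2) (auto simp: h_phi)
    also have "\<dots> = phi y" using c_ge_1 d p1 by (simp add: powr_powr)
    finally show ?case using 1 by simp
  qed
qed

lemma dphi_growth:
  assumes "0 < \<epsilon>"
  shows "\<forall>\<^sub>F y in at_top. y powr (gam - 1 - \<epsilon>) \<le> dphi y \<and> dphi y \<le> y powr (gam - 1 + \<epsilon>)"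
proof -
  obtain c1 c2 where c: "0 < c1" "0 < c2"
    "\<And>y. h0 \<le> y \<Longrightarrow> c1 * phi y / y \<le> dphi y" "\<And>y. h0 \<le> y \<Longrightarrow> dphi y \<le> c2 * phi y / y"
    by (rule dphi_bounds) (rule that; assumption)
  have "\<forall>\<^sub>F y in at_top. y powr (gam - \<epsilon> / 2) \<le> phi y \<and> phi y \<le> y powr (gam + \<epsilon> / 2)"
    using assms by (intro phi_growth) auto
  moreover have "\<forall>\<^sub>F y::real in at_top. c2 \<le> y powr (\<epsilon> / 2)" using assms by real_asymp
  moreover have "\<forall>\<^sub>F y::real in at_top. y powr (- (\<epsilon> / 2)) \<le> c1" using assms c by real_asymp
  ultimately show ?thesis using eventually_ge_at_top[of h0]
  proof eventually_elim
    case (elim y)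
    have y1: "y \<ge> 1" using elim h0_ge_1 by simp
    have "y powr (gam - 1 - \<epsilon>) = y powr (- (\<epsilon> / 2)) * y powr (gam - \<epsilon> / 2) / y"
      using y1 by (intro powr_mult_divide[symmetric]) auto
    also have "\<dots> \<le> c1 * phi y / y" using elim y1 c by (intro divide_right_mono mult_mono) auto
    also have "\<dots> \<le> dphi y" using c elim by auto
    finally have 1: "y powr (gam - 1 - \<epsilon>) \<le> dphi y" .
    have "dphi y \<le> c2 * phi y / y" using c elim by auto
    also have "\<dots> \<le> y powr (\<epsilon> / 2) * y powr (gam + \<epsilon> / 2) / y"
      using elim y1 c phi_ge[of y] x0_ge_1 by (intro divide_right_mono mult_mono) auto
    also have "\<dots> = y powr (gam - 1 + \<epsilon>)"
      using y1 by (intro powr_mult_divide) auto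
    finally show ?case using 1 by simp
  qed
qed

text \<open>\<open>dphi y\<close> is comparable to \<open>phi y / y\<close> and \<open>phi\<close>
  is increasing. The point is that \<open>dphi\<close> may be treated as constant on a dyadic
  block.\<close>

lemma dphi_doubling:
  obtains D where "1 \<le> D" "\<And>y. h0 \<le> y \<Longrightarrow> dphi y \<le> D * dphi (2 * y)"
proof -
  obtain c1 c2 where c: "0 < c1" "0 < c2"
    "\<And>y. h0 \<le> y \<Longrightarrow> c1 * phi y / y \<le> dphi y" "\<And>y. h0 \<le> y \<Longrightarrow> dphi y \<le> c2 * phi y / y"
    by (rule dphi_bounds) (rule that; assumption)
  have *: "dphi y \<le> (2 * c2 / c1) * dphi (2 * y)" if y: "h0 \<le> y" for y
  proof -
    have y1: "y \<ge> 1" using y h0_ge_1 by simp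
    have "dphi y \<le> c2 * phi y / y" using c y by auto
    also have "\<dots> \<le> c2 * phi (2 * y) / y"
      using y1 y phi_mono[of y "2 * y"] c by (intro divide_right_mono mult_left_mono) auto
    also have "\<dots> = (2 * c2 / c1) * (c1 * phi (2 * y) / (2 * y))" using c y1 by (simp add: field_simps)
    also have "\<dots> \<le> (2 * c2 / c1) * dphi (2 * y)"
      using c(1,2) c(3)[of "2 * y"] y y1 by (intro mult_left_mono) auto
    finally show ?thesis .
  qed
  show thesis
  proof (rule that[of "max 1 (2 * c2 / c1)"])
    fix y assume y: "h0 \<le> y"
    have "dphi (2 * y) > 0" using y h0_ge_1 by (intro dphi_pos) auto
    hence "(2 * c2 / c1) * dphi (2 * y) \<le> max 1 (2 * c2 / c1) * dphi (2 * y)"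
      by (intro mult_right_mono) auto
    with *[OF y] show "dphi y \<le> max 1 (2 * c2 / c1) * dphi (2 * y)" by linarith
  qed simp
qed

text \<open>With \<open>p = phi y\<close> and \<open>h p = y\<close>, the quantity
  \<open>- ddphi y\<close> equals \<open>(p\<^sup>2 * H2 p) * dphi y ^ 3 / p\<^sup>2\<close>, which
  has the size \<open>p / y\<^sup>2\<close> up to small powers. The choice
  \<open>e = \<epsilon> / 4\<close> leaves room for the losses in \<open>phi_growth\<close>, in
  \<open>H2_bounds\<close> and in absorbing the constants.\<close>

lemma ddphi_growth:
  assumes "0 < \<epsilon>" "\<epsilon> \<le> 1"
  shows "\<forall>\<^sub>F y in at_top. y powr (gam - 2 - \<epsilon>) \<le> - ddphi y \<and> - ddphi y \<le> y powr (gam - 2 + \<epsilon>)"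
proof -
  obtain c1 c2 where c: "0 < c1" "0 < c2"
    "\<And>y. h0 \<le> y \<Longrightarrow> c1 * phi y / y \<le> dphi y" "\<And>y. h0 \<le> y \<Longrightarrow> dphi y \<le> c2 * phi y / y"
    by (rule dphi_bounds) (rule that; assumption)
  define e where "e = \<epsilon> / 4"
  have e: "0 < e" "e \<le> 1" using assms by (auto simp: e_def)
  have "\<forall>\<^sub>F y in at_top. y powr (gam - e) \<le> phi y \<and> phi y \<le> y powr (gam + e)"
    by (intro phi_growth e)
  moreover have "\<forall>\<^sub>F y in at_top. phi y powr (- e) * h (phi y) \<le> (phi y)\<^sup>2 * H2 (phi y)
      \<and> (phi y)\<^sup>2 * H2 (phi y) \<le> (c\<^sup>2 + 1) * h (phi y)"
    using eventually_compose_filterlim[OF H2_bounds[OF e(1)] phi_at_top] .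
  moreover have "\<forall>\<^sub>F y::real in at_top. (c\<^sup>2 + 1) * c2 ^ 3 \<le> y powr e" using e by real_asymp
  moreover have "\<forall>\<^sub>F y::real in at_top. y powr (- e) \<le> c1 ^ 3" using e c by real_asymp
  ultimately show ?thesis using eventually_ge_at_top[of h0]
  proof eventually_elim
    case (elim y)
    define p where "p = phi y"
    have y1: "y \<ge> 1" using elim h0_ge_1 by simp
    have p1: "p \<ge> 1" using phi_ge[of y] elim x0_ge_1 by (simp add: p_def)
    have b: "p powr (- e) * y \<le> p\<^sup>2 * H2 p" "p\<^sup>2 * H2 p \<le> (c\<^sup>2 + 1) * y"
      using elim by (auto simp: h_phi p_def)
    have dd: "- ddphi y = (p\<^sup>2 * H2 p) * dphi y ^ 3 / p\<^sup>2"
      using elim p1 by (simp add: ddphi_def dphi_eq p_def power_divide)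
    have db: "c1 * p / y \<le> dphi y" "dphi y \<le> c2 * p / y" using c elim by (auto simp: p_def)
    have dp: "dphi y > 0" using dphi_pos elim by simp
    have "y powr (gam - 2 - \<epsilon>) = y powr (- e) * (y powr (gam - 3 * e) / y\<^sup>2)"
      using y1 by (intro powr_mult_divide2[symmetric]) (auto simp: e_def)
    also have "\<dots> \<le> c1 ^ 3 * (p powr (1 - e) / y\<^sup>2)"
    proof (intro mult_mono divide_right_mono)
      have "y powr (gam - 3 * e) \<le> y powr ((gam - e) * (1 - e))"
      proof (rule powr_mono)
        have "gam * e \<le> 1 * e" using gam_bounds e by (intro mult_right_mono) auto
        hence "gam - 3 * e \<le> gam - e - gam * e" using e(1) by linarith
        also have "\<dots> \<le> (gam - e) * (1 - e)" using e by (simp add: algebra_simps)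
        finally show "gam - 3 * e \<le> (gam - e) * (1 - e)" .
      qed (use y1 in auto)
      also have "\<dots> = (y powr (gam - e)) powr (1 - e)" by (simp add: powr_powr)
      also have "\<dots> \<le> p powr (1 - e)" using elim e by (intro powr_mono2) (auto simp: p_def)
      finally show "y powr (gam - 3 * e) \<le> p powr (1 - e)" .
    qed (use elim c in auto)
    also have "\<dots> = (p powr (- e) * y) * (c1 * p / y) ^ 3 / p\<^sup>2"
      using y1 p1 by (simp add: powr_diff powr_minus field_simps power2_eq_square power3_eq_cube)
    also have "\<dots> \<le> (p\<^sup>2 * H2 p) * dphi y ^ 3 / p\<^sup>2"
    proof (intro divide_right_mono mult_mono[OF b(1)] power_mono[OF db(1)])
      have "0 \<le> p powr (- e) * y" using y1 by simp
      thus "0 \<le> p\<^sup>2 * H2 p" using b(1) by (rule order_trans)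
    qed (use c p1 y1 in auto)
    finally have 1: "y powr (gam - 2 - \<epsilon>) \<le> - ddphi y" by (simp add: dd)
    have "- ddphi y \<le> ((c\<^sup>2 + 1) * y) * (c2 * p / y) ^ 3 / p\<^sup>2"
      unfolding dd using y1 dp
      by (intro divide_right_mono mult_mono[OF b(2)] power_mono[OF db(2)]) auto
    also have "\<dots> = ((c\<^sup>2 + 1) * c2 ^ 3) * (p / y\<^sup>2)"
      using y1 p1 by (simp add: field_simps power2_eq_square power3_eq_cube)
    also have "\<dots> \<le> y powr e * (y powr (gam + e) / y\<^sup>2)"
      using elim p1 by (intro mult_mono divide_right_mono) (auto simp: p_def)
    also have "\<dots> = y powr (gam - 2 + 2 * e)"
      using y1 by (intro powr_mult_divide2) auto
    also have "\<dots> \<le> y powr (gam - 2 + \<epsilon>)" using y1 assms by (intro powr_mono) (auto simp: e_def)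
    finally show ?case using 1 by simp
  qed
qed

text \<open>The mean value theorem is applied to \<open>phi (u + s) - phi u\<close> as a function of
  \<open>u\<close>, and then to \<open>dphi\<close>.\<close>

lemma second_difference:
  assumes "h0 < t" "0 < s"
  obtains z where "t < z" "z < t + 2 * s" "phi (t + 2 * s) - 2 * phi (t + s) + phi t = s\<^sup>2 * ddphi z"
proof -
  have "\<exists>z>t. z < t + s \<and> (phi (t + s + s) - phi (t + s)) - (phi (t + s) - phi t) = (t + s - t) * (dphi (z + s) - dphi z)"
  proof (rule MVT2)
    fix u assume u: "t \<le> u" "u \<le> t + s"
    show "((\<lambda>u. phi (u + s) - phi u) has_real_derivative (dphi (u + s) - dphi u)) (at u)"
      using u assms by (intro DERIV_diff DERIV_shift[THEN iffD1] phi_deriv_at) auto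
  qed (use assms in auto)
  then obtain z where z: "t < z" "z < t + s"
    "(phi (t + s + s) - phi (t + s)) - (phi (t + s) - phi t) = s * (dphi (z + s) - dphi z)" by auto
  have "\<exists>w>z. w < z + s \<and> dphi (z + s) - dphi z = (z + s - z) * ddphi w"
    using z assms by (intro MVT2 dphi_deriv_at) auto
  then obtain w where w: "z < w" "w < z + s" "dphi (z + s) - dphi z = s * ddphi w" by auto
  show thesis
  proof (rule that[of w])
    have "phi (t + 2 * s) - 2 * phi (t + s) + phi t
        = (phi (t + s + s) - phi (t + s)) - (phi (t + s) - phi t)" by (simp add: algebra_simps)
    thus "phi (t + 2 * s) - 2 * phi (t + s) + phi t = s\<^sup>2 * ddphi w"
      using z(3) w(3) by (simp add: power2_eq_square)
  qed (use z w in auto)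
qed

end

section \<open>Exponential sums over the inverse function\<close>

context ps_function
begin

text \<open>The intermediate point of \<open>second_difference\<close> lies in
  \<open>[y, 4 * y]\<close>. Since the exponent is at least -3, passing from it to \<open>y\<close>
  in the lower bound costs at most \<open>4 ^ 3 = 64\<close>.\<close>

lemma phi_second_difference_bounds:
  assumes ev: "\<And>z. y \<le> z \<Longrightarrow> z powr (gam - 2 - \<epsilon>) \<le> - ddphi z \<and> - ddphi z \<le> z powr (gam - 2 + \<epsilon>)"
    and "h0 < t" "y \<le> t" "0 < s" "t + 2 * s \<le> 4 * y" "0 < y" "0 \<le> \<epsilon>" "\<epsilon> \<le> 1" "gam - 2 + \<epsilon> \<le> 0"
  shows "s\<^sup>2 * (y powr (gam - 2 - \<epsilon>) / 64) \<le> - (phi (t + 2 * s) - 2 * phi (t + s) + phi t)"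
    and "- (phi (t + 2 * s) - 2 * phi (t + s) + phi t) \<le> s\<^sup>2 * y powr (gam - 2 + \<epsilon>)"
proof -
  obtain z where z: "t < z" "z < t + 2 * s" "phi (t + 2 * s) - 2 * phi (t + s) + phi t = s\<^sup>2 * ddphi z"
    using second_difference assms by blast
  have zz: "y \<le> z" "z \<le> 4 * y" using z assms by auto
  have "y powr (gam - 2 - \<epsilon>) / 64 \<le> (4 * y) powr (gam - 2 - \<epsilon>)"
  proof -
    have "(4::real) powr (- 3) \<le> 4 powr (gam - 2 - \<epsilon>)"
      using gam_bounds assms by (intro powr_mono) auto
    moreover have "(4::real) powr (- 3) = 1 / 64" by (simp add: powr_minus powr_numeral)
    ultimately have "y powr (gam - 2 - \<epsilon>) * (1 / 64) \<le> y powr (gam - 2 - \<epsilon>) * 4 powr (gam - 2 - \<epsilon>)"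
      by (intro mult_left_mono) auto
    thus ?thesis using assms by (simp add: powr_mult mult.commute)
  qed
  also have "\<dots> \<le> z powr (gam - 2 - \<epsilon>)"
    using zz assms gam_bounds by (intro powr_mono2') auto
  finally have "y powr (gam - 2 - \<epsilon>) / 64 \<le> - ddphi z" using ev[OF zz(1)] by linarith
  hence "s\<^sup>2 * (y powr (gam - 2 - \<epsilon>) / 64) \<le> s\<^sup>2 * - ddphi z" by (intro mult_left_mono) auto
  thus "s\<^sup>2 * (y powr (gam - 2 - \<epsilon>) / 64) \<le> - (phi (t + 2 * s) - 2 * phi (t + s) + phi t)"
    using z by simp
  have "- ddphi z \<le> z powr (gam - 2 + \<epsilon>)" using ev[OF zz(1)] by simp
  also have "\<dots> \<le> y powr (gam - 2 + \<epsilon>)" using zz assms by (intro powr_mono2') auto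
  finally have "s\<^sup>2 * - ddphi z \<le> s\<^sup>2 * y powr (gam - 2 + \<epsilon>)" by (intro mult_left_mono) auto
  thus "- (phi (t + 2 * s) - 2 * phi (t + s) + phi t) \<le> s\<^sup>2 * y powr (gam - 2 + \<epsilon>)"
    using z by simp
qed

text \<open>The second derivative test with steps between \<kappa> and \<Lambda>, both of size
  \<open>1 / y\<close> apart from small powers and, in \<kappa>, the power
  \<open>y powr (- (1 - gam))\<close>. With \<open>L\<close> of size \<open>y powr (2/5)\<close> and
  \<rho> of size \<open>y powr (- 3/10)\<close> the four terms have exponents close to
  \<open>2/5\<close>, \<open>4/5\<close>, \<open>9/10\<close> and
  \<open>7/10 + (1 - gam)\<close>.\<close>

lemma phi_exp_sum:
  fixes \<epsilon> :: real
  assumes "15 / 16 \<le> gam" and eps: "\<epsilon> = 1 / 1000"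
  shows "\<forall>\<^sub>F y in at_top. \<forall>(m::nat) (b::nat) (k::nat) (A::nat) (B::nat) (\<theta>::real).
    1 \<le> m \<longrightarrow> real m \<le> y powr \<epsilon> \<longrightarrow> 1 \<le> k \<longrightarrow> real k \<le> y powr (1 - gam + \<epsilon>) \<longrightarrow>
    (\<forall>n\<in>{A..<B}. y \<le> real (m * n + b) \<and> real (m * n + b) \<le> 2 * y) \<longrightarrow>
    norm (\<Sum>n=A..<B. ee (real k * phi (real (m * n + b)) + real n * \<theta>)) \<le> 400 * y powr (9 / 10)"
proof -
  have "\<forall>\<^sub>F y in at_top. y powr (gam - 2 - \<epsilon>) \<le> - ddphi y \<and> - ddphi y \<le> y powr (gam - 2 + \<epsilon>)"
    by (intro ddphi_growth) (auto simp: eps)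
  then obtain Y where Y: "\<And>y. Y \<le> y \<Longrightarrow> y powr (gam - 2 - \<epsilon>) \<le> - ddphi y \<and> - ddphi y \<le> y powr (gam - 2 + \<epsilon>)"
    by (auto simp: eventually_at_top_linorder)
  have "\<forall>\<^sub>F y::real in at_top. y powr \<epsilon> * (2 * y powr (2 / 5) + 3) \<le> 2 * y"
    unfolding eps by real_asymp
  thus ?thesis using eventually_ge_at_top[of Y] eventually_gt_at_top[of h0]
  proof eventually_elim
    case (elim y)
    have y1: "y > 1" using elim h0_ge_1 by simp
    define u where "u = 1 - gam"
    have u: "0 \<le> u" "u \<le> 1 / 16" using assms gam_bounds by (auto simp: u_def)
    show ?case
    proof (intro allI impI)
      fix m b k A B :: nat and \<theta> :: real
      assume m: "1 \<le> m" "real m \<le> y powr \<epsilon>" and k: "1 \<le> k" "real k \<le> y powr (1 - gam + \<epsilon>)"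
        and AB: "\<forall>n\<in>{A..<B}. y \<le> real (m * n + b) \<and> real (m * n + b) \<le> 2 * y"
      show "norm (\<Sum>n=A..<B. ee (real k * phi (real (m * n + b)) + real n * \<theta>)) \<le> 400 * y powr (9 / 10)"
      proof (cases "A < B")
        case False
        thus ?thesis by simp
      next
        case True
        define f where "f = (\<lambda>n. real k * phi (real (m * n + b)) + real n * \<theta>)"
        define L where "L = nat \<lceil>y powr (2 / 5)\<rceil>"
        define \<rho> where "\<rho> = y powr (- (3 / 10)) / 2"
        define \<kappa> where "\<kappa> = y powr (- 1 - u - \<epsilon>) / 64"
        define \<Lambda> where "\<Lambda> = y powr (- 1 + 4 * \<epsilon>)"
        have yp: "1 \<le> y powr (2 / 5)" using y1 by (intro ge_one_powr_ge_zero) auto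
        have L: "y powr (2 / 5) \<le> real L" "real L \<le> 2 * y powr (2 / 5)" "1 \<le> L"
          using yp unfolding L_def by linarith+
        have nA: "y \<le> real (m * A + b)" using AB True by auto
        obtain B' where B': "B = Suc B'" using True by (cases B) auto
        have nB: "real (m * B' + b) \<le> 2 * y" using AB True B' by auto
        have M: "real (B - A) \<le> 2 * y"
        proof -
          have "real B' - real A \<le> real m * (real B' - real A)"
            using mult_right_mono[of 1 "real m" "real B' - real A"] m B' True by simp
          also have "\<dots> = real (m * B' + b) - real (m * A + b)" by (simp add: algebra_simps)
          also have "\<dots> \<le> y" using nA nB by simp
          finally show ?thesis using True y1 by (simp add: B' of_nat_diff)
        qed
        have range: "y \<le> real (m * n + b)" "real (m * n + b) + 2 * real m \<le> 4 * y"
          if n: "A \<le> n" "n < B + L" for n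
        proof -
          have "m * A + b \<le> m * n + b" using n by simp
          thus "y \<le> real (m * n + b)" using nA by linarith
          have "m * n + b + 2 * m \<le> (m * B' + b) + m * (L + 3)"
          proof -
            have "n + 2 \<le> B' + (L + 3)" using n B' by simp
            hence "m * (n + 2) \<le> m * (B' + (L + 3))" by (rule mult_le_mono2)
            thus ?thesis by (simp add: algebra_simps)
          qed
          hence "real (m * n + b) + 2 * real m \<le> real (m * B' + b) + real m * (real L + 3)"
            by (metis (no_types, lifting) of_nat_add of_nat_le_iff of_nat_mult of_nat_numeral)
          also have "real m * (real L + 3) \<le> y powr \<epsilon> * (2 * y powr (2 / 5) + 3)"
            using m L by (intro mult_mono) auto
          finally show "real (m * n + b) + 2 * real m \<le> 4 * y" using elim(1) nB by linarith
        qed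
        have gap: "\<kappa> \<le> (f (Suc n) - f n) - (f (Suc (Suc n)) - f (Suc n))"
            "(f (Suc n) - f n) - (f (Suc (Suc n)) - f (Suc n)) \<le> \<Lambda>" if n: "A \<le> n" "n < B + L" for n
        proof -
          define t where "t = real (m * n + b)"
          define D where "D = - (phi (t + 2 * real m) - 2 * phi (t + real m) + phi t)"
          have eqD: "(f (Suc n) - f n) - (f (Suc (Suc n)) - f (Suc n)) = real k * D"
            by (simp add: f_def D_def t_def algebra_simps)
          have b1: "(real m)\<^sup>2 * (y powr (gam - 2 - \<epsilon>) / 64) \<le> D" and b2: "D \<le> (real m)\<^sup>2 * y powr (gam - 2 + \<epsilon>)"
            unfolding D_def
            by (intro phi_second_difference_bounds[OF Y];
                use elim range[OF n] m y1 u in \<open>simp add: t_def eps u_def\<close>)+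
          have "1 \<le> (real m)\<^sup>2" using m by simp
          hence "1 * (y powr (gam - 2 - \<epsilon>) / 64) \<le> (real m)\<^sup>2 * (y powr (gam - 2 - \<epsilon>) / 64)"
            by (intro mult_right_mono) auto
          hence c1: "\<kappa> \<le> D" using b1 by (simp add: \<kappa>_def u_def)
          have "0 < \<kappa>" using y1 by (simp add: \<kappa>_def)
          hence "1 * \<kappa> \<le> real k * D" using c1 k by (intro mult_mono) auto
          thus "\<kappa> \<le> (f (Suc n) - f n) - (f (Suc (Suc n)) - f (Suc n))" by (simp add: eqD)
          have "real k * D \<le> y powr (1 - gam + \<epsilon>) * ((y powr \<epsilon>)\<^sup>2 * y powr (gam - 2 + \<epsilon>))"
          proof (rule mult_mono[OF k(2) order_trans[OF b2]])
            show "(real m)\<^sup>2 * y powr (gam - 2 + \<epsilon>) \<le> (y powr \<epsilon>)\<^sup>2 * y powr (gam - 2 + \<epsilon>)"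
              using m by (intro mult_right_mono power_mono) auto
            show "0 \<le> D" using c1 \<open>0 < \<kappa>\<close> by simp
          qed auto
          also have "\<dots> = \<Lambda>"
            by (simp add: \<Lambda>_def power2_eq_square flip: powr_add)
          finally show "(f (Suc n) - f n) - (f (Suc (Suc n)) - f (Suc n)) \<le> \<Lambda>" by (simp add: eqD)
        qed
        have rho: "0 < \<rho>" "\<rho> \<le> 1 / 2"
        proof -
          show "0 < \<rho>" using y1 by (simp add: \<rho>_def)
          have "y powr (- (3 / 10)) \<le> y powr 0" using y1 by (intro powr_mono) auto
          thus "\<rho> \<le> 1 / 2" using y1 by (simp add: \<rho>_def)
        qed
        have kap: "0 < \<kappa>" using y1 by (simp add: \<kappa>_def)
        have mono9: "y powr a \<le> y powr (9 / 10)" if "a \<le> 9 / 10" for a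
          using that y1 by (intro powr_mono) auto
        have "norm (\<Sum>n=A..<B. ee (f n)) \<le> 2 * real L + 2 * pi * \<Lambda> * (real L)\<^sup>2 * real (B - A)
             + real (B - A) / (\<rho> * real L) + (real (B - A) * \<Lambda> + 2) * (2 * \<rho> / \<kappa> + 1)"
          by (rule vdc_sum) (use gap kap rho L True in auto)
        also have "\<dots> \<le> 4 * y powr (9 / 10) + 64 * y powr (9 / 10) + 4 * y powr (9 / 10) + 260 * y powr (9 / 10)"
        proof (intro add_mono)
          show "2 * real L \<le> 4 * y powr (9 / 10)" using L mono9[of "2 / 5"] by simp
          have "2 * pi * \<Lambda> * (real L)\<^sup>2 * real (B - A) \<le> 8 * \<Lambda> * (2 * y powr (2 / 5))\<^sup>2 * (2 * y)"
            using pi_less_4 L M y1 by (intro mult_mono power_mono) (auto simp: \<Lambda>_def)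
          also have "\<dots> = 64 * y powr (- 1 + 4 * \<epsilon> + 2 / 5 + 2 / 5 + 1)"
          proof -
            have "y powr (- 1 + 4 * \<epsilon> + 2 / 5 + 2 / 5 + 1)
                = y powr (- 1 + 4 * \<epsilon>) * y powr (2 / 5) * y powr (2 / 5) * y powr 1"
              by (simp only: powr_add)
            thus ?thesis using y1 by (simp add: \<Lambda>_def power2_eq_square mult_ac)
          qed
          also have "\<dots> \<le> 64 * y powr (9 / 10)" using mono9[of "- 1 + 4 * \<epsilon> + 2 / 5 + 2 / 5 + 1"] by (simp add: eps)
          finally show "2 * pi * \<Lambda> * (real L)\<^sup>2 * real (B - A) \<le> 64 * y powr (9 / 10)" .
          have "real (B - A) / (\<rho> * real L) \<le> (2 * y) / (\<rho> * y powr (2 / 5))"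
            using M L rho y1 by (intro frac_le mult_left_mono) auto
          also have "\<dots> = 4 * y powr (1 - (- (3 / 10)) - 2 / 5)"
            using y1 unfolding powr_diff by (simp add: \<rho>_def)
          finally show "real (B - A) / (\<rho> * real L) \<le> 4 * y powr (9 / 10)" by simp
          have e1: "1 \<le> y powr (4 * \<epsilon>)" using y1 by (intro ge_one_powr_ge_zero) (auto simp: eps)
          have e2: "1 \<le> y powr (7 / 10 + u + \<epsilon>)" using y1 u by (intro ge_one_powr_ge_zero) (auto simp: eps)
          have "real (B - A) * \<Lambda> + 2 \<le> 2 * y * \<Lambda> + 2" using M by (intro add_right_mono mult_right_mono) (auto simp: \<Lambda>_def)
          also have "2 * y * \<Lambda> = 2 * y powr (4 * \<epsilon>)" using y1 unfolding \<Lambda>_def powr_add by (simp add: powr_minus)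
          finally have f1: "real (B - A) * \<Lambda> + 2 \<le> 4 * y powr (4 * \<epsilon>)" using e1 by simp
          have "2 * \<rho> / \<kappa> = 64 * y powr (- (3 / 10) - (- 1 - u - \<epsilon>))"
            unfolding powr_diff[of _ "- (3 / 10)"] by (simp add: \<rho>_def \<kappa>_def)
          hence f2: "2 * \<rho> / \<kappa> + 1 \<le> 65 * y powr (7 / 10 + u + \<epsilon>)" using e2 by (simp add: algebra_simps)
          have "(real (B - A) * \<Lambda> + 2) * (2 * \<rho> / \<kappa> + 1) \<le> 4 * y powr (4 * \<epsilon>) * (65 * y powr (7 / 10 + u + \<epsilon>))"
            using rho kap by (intro mult_mono f1 f2) auto
          also have "\<dots> = 260 * y powr (4 * \<epsilon> + (7 / 10 + u + \<epsilon>))" unfolding powr_add[of _ "4 * \<epsilon>"] by simp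
          also have "\<dots> \<le> 260 * y powr (9 / 10)"
            using mono9[of "4 * \<epsilon> + (7 / 10 + u + \<epsilon>)"] u by (simp add: eps)
          finally show "(real (B - A) * \<Lambda> + 2) * (2 * \<rho> / \<kappa> + 1) \<le> 260 * y powr (9 / 10)" .
        qed
        also have "\<dots> \<le> 400 * y powr (9 / 10)" by simp
        finally show ?thesis by (simp add: f_def)
      qed
    qed
  qed
qed

end

section \<open>The Fejer majorant and its Fourier transform\<close>

lemma convex_nat_set_interval:
  fixes S :: "nat set"
  assumes "finite S" "\<And>a b c. a \<in> S \<Longrightarrow> b \<in> S \<Longrightarrow> a \<le> c \<Longrightarrow> c \<le> b \<Longrightarrow> c \<in> S"
  shows "\<exists>A B. S = {A..<B}"
proof (cases "S = {}")
  case True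
  hence "S = {0..<0}" by simp
  thus ?thesis by blast
next
  case False
  have "S = {Min S..<Suc (Max S)}"
  proof
    show "S \<subseteq> {Min S..<Suc (Max S)}" using assms(1) by (auto simp: less_Suc_eq_le)
    show "{Min S..<Suc (Max S)} \<subseteq> S"
      using assms(2)[OF Min_in[OF assms(1) False] Max_in[OF assms(1) False]] by (auto simp: less_Suc_eq_le)
  qed
  thus ?thesis by blast
qed

lemma norm_sum_ee_sq:
  "complex_of_real ((norm (\<Sum>j<K. ee (real j * x)))\<^sup>2)
     = of_nat K + (\<Sum>j<K. \<Sum>l<K. if j = l then 0 else ee ((real j - real l) * x))"
proof -
  have "complex_of_real ((norm (\<Sum>j<K. ee (real j * x)))\<^sup>2)
      = (\<Sum>j<K. ee (real j * x)) * cnj (\<Sum>l<K. ee (real l * x))"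
    by (simp only: complex_norm_square)
  also have "\<dots> = (\<Sum>j<K. \<Sum>l<K. ee (real j * x) * cnj (ee (real l * x)))"
    by (simp add: sum_product)
  also have "\<dots> = (\<Sum>j<K. \<Sum>l<K. (if j = l then 1 else 0) + (if j = l then 0 else ee ((real j - real l) * x)))"
    by (intro sum.cong refl) (auto simp: left_diff_distrib ee_diff[symmetric])
  also have "\<dots> = of_nat K + (\<Sum>j<K. \<Sum>l<K. if j = l then 0 else ee ((real j - real l) * x))"
    by (simp add: sum.distrib)
  finally show ?thesis .
qed

context ps_function
begin

text \<open>An integer \<open>t\<close> is of the form \<open>\<lfloor>h j\<rfloor>\<close> only if \<open>phi t\<close> lies within \<open>dphi t\<close> below an integer. On a
  dyadic block \<open>VV\<close> is the Fejer kernel at \<open>phi t\<close> whose width matches \<open>dphi t\<close>, so it dominates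
  \<open>1 / dphi t\<close> on these integers while its Fourier expansion has constant term 1.\<close>

definition blk :: "real \<Rightarrow> nat" where "blk t = (LEAST i. t < h0 * 2 ^ Suc i)"
definition KK :: "nat \<Rightarrow> nat" where "KK i = nat (max 1 \<lfloor>1 / (6 * dphi (h0 * 2 ^ i))\<rfloor>)"
definition VV :: "real \<Rightarrow> real" where
  "VV t = (if t < h0 then 1 else (norm (\<Sum>j<KK (blk t). ee (real j * phi t)))\<^sup>2 / real (KK (blk t)))"

lemma blk_bounds:
  assumes "h0 \<le> t"
  shows "h0 * 2 ^ blk t \<le> t" "t < 2 * (h0 * 2 ^ blk t)"
proof -
  have "\<exists>n. t / h0 < 2 ^ n" by (rule real_arch_pow) simp
  then obtain n where "t / h0 < 2 ^ n" by blast
  hence "t < h0 * 2 ^ n" using h0_ge_1 by (simp add: field_simps)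
  also have "\<dots> \<le> h0 * 2 ^ Suc n" using h0_ge_1 by simp
  finally have "t < h0 * 2 ^ Suc (blk t)"
    unfolding blk_def by (rule LeastI)
  thus "t < 2 * (h0 * 2 ^ blk t)" by simp
  show "h0 * 2 ^ blk t \<le> t"
  proof (cases "blk t")
    case 0
    then show ?thesis using assms by simp
  next
    case (Suc i)
    hence "\<not> t < h0 * 2 ^ Suc i"
      using not_less_Least[of i "\<lambda>i. t < h0 * 2 ^ Suc i"] by (simp add: blk_def)
    with Suc show ?thesis by simp
  qed
qed

lemma blk_eqI:
  assumes "h0 * 2 ^ i \<le> t" "t < 2 * (h0 * 2 ^ i)"
  shows "blk t = i"
  unfolding blk_def
proof (rule Least_equality)
  show "t < h0 * 2 ^ Suc i" using assms by simp
  fix j assume j: "t < h0 * 2 ^ Suc j"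
  show "i \<le> j"
  proof (rule ccontr)
    assume "\<not> i \<le> j"
    hence "h0 * 2 ^ Suc j \<le> h0 * 2 ^ i" using h0_ge_1 by (intro mult_left_mono power_increasing) auto
    with j assms show False by linarith
  qed
qed

lemma block_start_ge: "h0 \<le> h0 * 2 ^ i"
  using h0_ge_1 one_le_power[of "2::real" i] by (simp add: mult_le_cancel_left1)

lemma KK_ge_1: "1 \<le> KK i"
  by (simp add: KK_def)

lemma KK_le:
  assumes "h0 * 2 ^ i \<le> z"
  shows "real (KK i) \<le> max 1 (1 / dphi z)"
proof -
  have d: "0 < dphi z" "dphi z \<le> dphi (h0 * 2 ^ i)"
    using block_start_ge[of i] assms by (auto intro!: dphi_pos dphi_antimono)
  have "1 / (6 * dphi (h0 * 2 ^ i)) \<le> 1 / dphi z"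
    using d by (intro divide_left_mono) auto
  thus ?thesis unfolding KK_def by linarith
qed

lemma VV_nonneg: "0 \<le> VV t"
  by (simp add: VV_def)

lemma VV_le: "h0 \<le> t \<Longrightarrow> VV t \<le> real (KK (blk t))"
proof -
  assume t: "h0 \<le> t"
  define K where "K = KK (blk t)"
  have K: "1 \<le> K" using KK_ge_1 by (simp only: K_def)
  have "norm (\<Sum>j<K. ee (real j * phi t)) \<le> (\<Sum>j<K. 1)" by (rule sum_norm_le) simp
  hence "(norm (\<Sum>j<K. ee (real j * phi t)))\<^sup>2 \<le> (real K)\<^sup>2" by (intro power_mono) auto
  hence "(norm (\<Sum>j<K. ee (real j * phi t)))\<^sup>2 / real K \<le> (real K)\<^sup>2 / real K"
    by (intro divide_right_mono) auto
  also have "\<dots> = real K" by (simp add: power2_eq_square)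
  finally show ?thesis using t by (simp add: VV_def K_def)
qed

text \<open>As \<open>h j - t < 1\<close>, the integer \<open>j\<close> satisfies
  \<open>0 \<le> j - phi t \<le> dphi t\<close>. The 6 in \<open>KK\<close> keeps the phases
  \<open>2 * pi * l * (j - phi t)\<close> with \<open>l < K\<close> within \<open>pi / 3\<close>, so
  every term of the kernel has real part at least 1/2 and \<open>VV t \<ge> K / 4\<close>. By
  \<open>dphi_doubling\<close>, replacing \<open>t\<close> by the start of its block costs the
  factor \<open>D\<close>; the constant is \<open>48 = 6 * 2 * 4\<close>.\<close>

lemma VV_lower:
  obtains C where "1 \<le> C"
    "\<And>t j. h0 \<le> t \<Longrightarrow> x0 \<le> real j \<Longrightarrow> t \<le> h (real j) \<Longrightarrow> h (real j) < t + 1 \<Longrightarrow> 1 / dphi t \<le> C * VV t"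
proof -
  obtain D where D: "1 \<le> D" "\<And>y. h0 \<le> y \<Longrightarrow> dphi y \<le> D * dphi (2 * y)"
    by (rule dphi_doubling) (rule that; assumption)
  have "1 / dphi t \<le> (48 * D) * VV t"
    if t: "h0 \<le> t" "x0 \<le> real j" "t \<le> h (real j)" "h (real j) < t + 1" for t j
  proof -
    define y where "y = h0 * 2 ^ blk t"
    define K where "K = KK (blk t)"
    have y: "h0 \<le> y" "y \<le> t" "t < 2 * y"
      using blk_bounds[OF t(1)] block_start_ge by (auto simp: y_def)
    have K1: "1 \<le> K" using KK_ge_1 by (simp only: K_def)
    have dp: "0 < dphi t" "0 < dphi y" using t y by (auto intro: dphi_pos)
    have mono: "dphi t \<le> dphi y" using y by (intro dphi_antimono)
    define \<delta> where "\<delta> = real j - phi t"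
    have "phi (h (real j)) = real j" using t by (intro phi_h)
    hence d0: "0 \<le> \<delta>" using phi_mono[OF t(1) t(3)] by (simp add: \<delta>_def)
    have "\<delta> \<le> (h (real j) - t) / H1 (phi t)"
      using phi_increment_le[OF t(1) t(3)] phi_h[OF t(2)] by (simp add: \<delta>_def)
    also have "\<dots> = (h (real j) - t) * dphi t" using t by (simp add: dphi_eq)
    also have "\<dots> \<le> 1 * dphi t" using t dp by (intro mult_right_mono) auto
    finally have d1: "\<delta> \<le> dphi y" using mono by simp
    have V: "real K / 4 \<le> VV t"
    proof (cases "K = 1")
      case True
      hence "VV t = 1" using t by (simp add: VV_def K_def[symmetric])
      with True show ?thesis by simp
    next
      case False
      hence "real K \<le> 1 / (6 * dphi y)"
        using K1 unfolding K_def KK_def y_def by linarith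
      hence "real K * dphi y \<le> 1 / 6" using dp by (simp add: field_simps)
      have shift: "ee (real l * phi t) = ee (- (real l * \<delta>))" for l
      proof -
        have "real l * phi t = real (l * j) + - (real l * \<delta>)" by (simp add: \<delta>_def algebra_simps)
        thus ?thesis unfolding ee_add by (simp only:) (simp only: ee_add ee_of_nat mult_1)
      qed
      have "(\<Sum>l<K. 1 / 2) \<le> (\<Sum>l<K. Re (ee (real l * phi t)))"
      proof (rule sum_mono)
        fix l assume "l \<in> {..<K}"
        hence "real l * \<delta> \<le> real K * dphi y" using d0 d1 dp by (intro mult_mono) auto
        hence "real l * \<delta> \<le> 1 / 6" using \<open>real K * dphi y \<le> 1 / 6\<close> by simp
        hence "2 * pi * (real l * \<delta>) \<le> 2 * pi * (1 / 6)" by (intro mult_left_mono) auto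
        hence "cos (pi / 3) \<le> cos (2 * pi * (real l * \<delta>))"
          using d0 by (intro cos_monotone_0_pi_le) auto
        thus "1 / 2 \<le> Re (ee (real l * phi t))" unfolding shift by (simp add: ee_def cos_60)
      qed
      also have "\<dots> = Re (\<Sum>l<K. ee (real l * phi t))" by simp
      also have "\<dots> \<le> norm (\<Sum>l<K. ee (real l * phi t))" by (rule complex_Re_le_cmod)
      finally have "real K / 2 \<le> norm (\<Sum>l<K. ee (real l * phi t))" by simp
      hence "(real K / 2)\<^sup>2 \<le> (norm (\<Sum>l<K. ee (real l * phi t)))\<^sup>2" by (intro power_mono) auto
      hence "(real K / 2)\<^sup>2 / real K \<le> (norm (\<Sum>l<K. ee (real l * phi t)))\<^sup>2 / real K"
        by (intro divide_right_mono) auto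
      moreover have "(real K / 2)\<^sup>2 / real K = real K / 4" using K1 by (simp add: power2_eq_square)
      moreover have "VV t = (norm (\<Sum>l<K. ee (real l * phi t)))\<^sup>2 / real K"
        using t by (simp add: VV_def K_def)
      ultimately show ?thesis by linarith
    qed
    have "dphi y \<le> D * dphi t"
    proof -
      have "dphi (2 * y) \<le> dphi t" using t y by (intro dphi_antimono) auto
      hence "D * dphi (2 * y) \<le> D * dphi t" using D by (intro mult_left_mono) auto
      with D(2)[OF y(1)] show ?thesis by linarith
    qed
    hence "1 / dphi t \<le> D / dphi y" using dp by (simp add: field_simps)
    also have "\<dots> = 6 * D * (1 / (6 * dphi y))" by simp
    \<comment> \<open>Rounding down, together with the cut-off at 1 in \<open>KK\<close>, costs at
      most a factor 2.\<close>
    also have "1 / (6 * dphi y) \<le> 2 * real K"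
      using K1 unfolding K_def KK_def y_def by linarith
    hence "6 * D * (1 / (6 * dphi y)) \<le> 6 * D * (2 * (4 * VV t))"
      using V D by (intro mult_left_mono) auto
    finally show ?thesis by simp
  qed
  with D(1) show thesis by (intro that[of "48 * D"]) auto
qed

text \<open>The diagonal of the Fejer kernel is the constant 1 that is subtracted; fewer than
  \<open>K\<^sup>2\<close> frequencies remain, and the kernel carries the factor
  \<open>1 / K\<close>. Negative frequencies reduce to positive ones by conjugation, which also
  changes the sign of \<theta>.\<close>

lemma VV_block_sum:
  assumes "1 \<le> K" "S = {A..<B}"
    and VV: "\<And>n. n \<in> S \<Longrightarrow> VV (t n) = (norm (\<Sum>j<K. ee (real j * phi (t n))))\<^sup>2 / real K"
    and E: "\<And>k \<theta>. 1 \<le> k \<Longrightarrow> k < K \<Longrightarrow> norm (\<Sum>n=A..<B. ee (real k * phi (t n) + real n * \<theta>)) \<le> E"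
    and "0 \<le> E"
  shows "norm (\<Sum>n\<in>S. complex_of_real (VV (t n) - 1) * ee (real n * \<theta>)) \<le> real K * E"
proof -
  have K0: "real K \<noteq> 0" using assms(1) by simp
  have "(\<Sum>n\<in>S. complex_of_real (VV (t n) - 1) * ee (real n * \<theta>))
      = (\<Sum>n\<in>S. (1 / of_nat K) * (\<Sum>j<K. \<Sum>l<K. if j = l then 0 else ee ((real j - real l) * phi (t n) + real n * \<theta>)))"
  proof (intro sum.cong refl)
    fix n assume n: "n \<in> S"
    have "complex_of_real (VV (t n) - 1)
        = (1 / of_nat K) * complex_of_real ((norm (\<Sum>j<K. ee (real j * phi (t n))))\<^sup>2) - 1"
      unfolding VV[OF n] by simp
    also have "\<dots> = (1 / of_nat K) * (\<Sum>j<K. \<Sum>l<K. if j = l then 0 else ee ((real j - real l) * phi (t n)))"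
      unfolding norm_sum_ee_sq using assms(1) by (simp add: field_simps)
    finally have "complex_of_real (VV (t n) - 1) * ee (real n * \<theta>)
        = (1 / of_nat K) * ((\<Sum>j<K. \<Sum>l<K. if j = l then 0 else ee ((real j - real l) * phi (t n))) * ee (real n * \<theta>))"
      by (simp only: mult.assoc)
    also have "(\<Sum>j<K. \<Sum>l<K. if j = l then 0 else ee ((real j - real l) * phi (t n))) * ee (real n * \<theta>)
        = (\<Sum>j<K. \<Sum>l<K. if j = l then 0 else ee ((real j - real l) * phi (t n) + real n * \<theta>))"
      unfolding sum_distrib_right by (intro sum.cong refl) (simp add: ee_add)
    finally show "complex_of_real (VV (t n) - 1) * ee (real n * \<theta>)
        = (1 / of_nat K) * (\<Sum>j<K. \<Sum>l<K. if j = l then 0 else ee ((real j - real l) * phi (t n) + real n * \<theta>))" .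
  qed
  also have "\<dots> = (1 / of_nat K) * (\<Sum>n\<in>S. \<Sum>j<K. \<Sum>l<K. if j = l then 0 else ee ((real j - real l) * phi (t n) + real n * \<theta>))"
    by (simp only: sum_distrib_left)
  also have "(\<Sum>n\<in>S. \<Sum>j<K. \<Sum>l<K. if j = l then 0 else ee ((real j - real l) * phi (t n) + real n * \<theta>))
      = (\<Sum>j<K. \<Sum>n\<in>S. \<Sum>l<K. if j = l then 0 else ee ((real j - real l) * phi (t n) + real n * \<theta>))"
    by (rule sum.swap)
  also have "\<dots> = (\<Sum>j<K. \<Sum>l<K. \<Sum>n\<in>S. if j = l then 0 else ee ((real j - real l) * phi (t n) + real n * \<theta>))"
    by (intro sum.cong refl sum.swap)
  finally have eq: "(\<Sum>n\<in>S. complex_of_real (VV (t n) - 1) * ee (real n * \<theta>))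
      = (1 / of_nat K) * (\<Sum>j<K. \<Sum>l<K. \<Sum>n\<in>S. if j = l then 0 else ee ((real j - real l) * phi (t n) + real n * \<theta>))" .
  have each: "norm (\<Sum>n\<in>S. if j = l then 0 else ee ((real j - real l) * phi (t n) + real n * \<theta>)) \<le> E"
    if jl: "j < K" "l < K" for j l
  proof (cases j l rule: linorder_cases)
    case equal
    thus ?thesis using \<open>0 \<le> E\<close> by simp
  next
    case greater
    hence "real j - real l = real (j - l)" by (simp add: of_nat_diff)
    thus ?thesis using E[of "j - l" \<theta>] jl greater assms(2) by simp
  next
    case less
    hence r: "real j - real l = - real (l - j)" by (simp add: of_nat_diff)
    have "(\<Sum>n\<in>S. ee ((real j - real l) * phi (t n) + real n * \<theta>))
        = cnj (\<Sum>n=A..<B. ee (real (l - j) * phi (t n) + real n * (- \<theta>)))"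
      unfolding cnj_sum r assms(2) by (intro sum.cong refl) (simp add: cnj_ee)
    hence "norm (\<Sum>n\<in>S. ee ((real j - real l) * phi (t n) + real n * \<theta>)) \<le> E"
      using E[of "l - j" "- \<theta>"] jl less by (simp only: complex_mod_cnj)
    thus ?thesis using less by simp
  qed
  have "norm (\<Sum>j<K. \<Sum>l<K. \<Sum>n\<in>S. if j = l then 0 else ee ((real j - real l) * phi (t n) + real n * \<theta>))
      \<le> (\<Sum>j<K. \<Sum>l<K. E)"
    by (intro sum_norm_le each) auto
  hence "norm (\<Sum>j<K. \<Sum>l<K. \<Sum>n\<in>S. if j = l then 0 else ee ((real j - real l) * phi (t n) + real n * \<theta>))
      \<le> real K * (real K * E)" by simp
  thus ?thesis unfolding eq using assms(1)
    by (simp add: norm_mult norm_divide field_simps)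
qed

text \<open>The final range of \<open>r\<close> only needs some exponent below 15/16 in place of 91/100.\<close>

lemma VV_fourier:
  assumes gam: "15 / 16 \<le> gam"
  shows "\<forall>\<^sub>F N in sequentially. \<forall>(m::nat) (b::nat) (\<theta>::real). 1 \<le> m \<longrightarrow> real m \<le> ln (real N) \<longrightarrow> b < m \<longrightarrow>
    norm (\<Sum>n\<le>N. complex_of_real (VV (real (m * n + b)) - 1) * ee (real n * \<theta>))
      \<le> 400 * real N powr (91 / 100 + (1 - gam))"
proof -
  define \<epsilon> :: real where "\<epsilon> = 1 / 1000"
  define u where "u = 1 - gam"
  have u: "0 \<le> u" "u \<le> 1 / 16" using gam gam_bounds by (auto simp: u_def)
  obtain Y1 where Y1: "\<And>y. Y1 \<le> y \<Longrightarrow> \<forall>(m::nat) (b::nat) (k::nat) (A::nat) (B::nat) (\<theta>::real).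
    1 \<le> m \<longrightarrow> real m \<le> y powr \<epsilon> \<longrightarrow> 1 \<le> k \<longrightarrow> real k \<le> y powr (1 - gam + \<epsilon>) \<longrightarrow>
    (\<forall>n\<in>{A..<B}. y \<le> real (m * n + b) \<and> real (m * n + b) \<le> 2 * y) \<longrightarrow>
    norm (\<Sum>n=A..<B. ee (real k * phi (real (m * n + b)) + real n * \<theta>)) \<le> 400 * y powr (9 / 10)"
    using phi_exp_sum[OF gam \<epsilon>_def] unfolding eventually_at_top_linorder by blast
  have "\<forall>\<^sub>F y in at_top. y powr (gam - 1 - \<epsilon>) \<le> dphi y \<and> dphi y \<le> y powr (gam - 1 + \<epsilon>)"
    by (intro dphi_growth) (simp add: \<epsilon>_def)
  then obtain Y2 where Y2: "\<And>y. Y2 \<le> y \<Longrightarrow> y powr (gam - 1 - \<epsilon>) \<le> dphi y"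
    unfolding eventually_at_top_linorder by blast
  define Y where "Y = max (max Y1 Y2) (max h0 1)"
  have dY: "max 1 (1 / dphi y) \<le> y powr (u + \<epsilon>)" if "Y \<le> y" for y
  proof -
    have y: "Y2 \<le> y" "1 \<le> y" using that by (auto simp: Y_def)
    have "1 / dphi y \<le> 1 / y powr (gam - 1 - \<epsilon>)"
      using Y2[OF y(1)] y by (intro divide_left_mono mult_pos_pos) (auto intro: less_le_trans[of _ "y powr _"])
    also have "\<dots> = y powr (u + \<epsilon>)" by (simp add: u_def powr_minus_divide[symmetric] algebra_simps)
    finally show ?thesis using y u by (auto simp: \<epsilon>_def intro!: ge_one_powr_ge_zero)
  qed
  have "\<forall>\<^sub>F N::real in at_top. ln N \<le> (N powr (9 / 10)) powr \<epsilon>" unfolding \<epsilon>_def by real_asymp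
  moreover have "\<forall>\<^sub>F N::real in at_top. ln N * (2 * N) \<le> N powr (1 + \<epsilon>)" unfolding \<epsilon>_def by real_asymp
  moreover have "\<forall>\<^sub>F N::real in at_top. ln N * (2 * N) \<le> N powr 2" by real_asymp
  moreover have "\<forall>\<^sub>F N::real in at_top. 3 * ln N + 2 \<le> N powr \<epsilon>" unfolding \<epsilon>_def by real_asymp
  moreover have "\<forall>\<^sub>F N::real in at_top. Y \<le> N powr (9 / 10)" by real_asymp
  moreover have "\<forall>\<^sub>F N::real in at_top. Y \<le> N" by (rule eventually_ge_at_top)
  ultimately have "\<forall>\<^sub>F N::real in at_top. ln N \<le> (N powr (9 / 10)) powr \<epsilon> \<and> ln N * (2 * N) \<le> N powr (1 + \<epsilon>)
     \<and> ln N * (2 * N) \<le> N powr 2 \<and> 3 * ln N + 2 \<le> N powr \<epsilon> \<and> Y \<le> N powr (9 / 10) \<and> Y \<le> N"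
    by eventually_elim auto
  from eventually_compose_filterlim[OF this filterlim_real_sequentially]
  show ?thesis
  proof eventually_elim
    case (elim N)
    have N1: "real N \<ge> 1" using elim by (auto simp: Y_def)
    show ?case
    proof (intro allI impI)
      fix m b :: nat and \<theta> :: real
      assume m: "1 \<le> m" "real m \<le> ln (real N)" and b: "b < m"
      define t where "t = (\<lambda>n. real (m * n + b))"
      have tT: "t n \<le> ln (real N) * (2 * real N)" if "n \<le> N" for n
      proof -
        have "m * n \<le> m * N" using that by simp
        hence "m * n + b \<le> m * (N + 1)" using b unfolding distrib_left by linarith
        hence "t n \<le> real (m * (N + 1))" unfolding t_def by (simp only: of_nat_le_iff)
        also have "\<dots> \<le> ln (real N) * (2 * real N)"
          using m N1 unfolding of_nat_mult by (intro mult_mono) auto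
        finally show ?thesis .
      qed
      \<comment> \<open>The bound for a single dyadic block. The margin
        \<open>4 * \<epsilon>\<close> covers the excess of the largest argument over
        \<open>N\<close> and that of \<open>K\<close> over the power \<open>u\<close>.\<close>
      define Z where "Z = 400 * real N powr (9 / 10 + u + 4 * \<epsilon>)"
      have Z0: "0 \<le> Z" by (simp add: Z_def)
      define S where "S = (\<lambda>i. {n\<in>{..N}. h0 \<le> t n \<and> blk (t n) = i})"
      have blockE: "norm (\<Sum>n\<in>S i. complex_of_real (VV (t n) - 1) * ee (real n * \<theta>)) \<le> Z" for i
      proof (cases "S i = {}")
        case True
        thus ?thesis using Z0 by simp
      next
        case False
        then obtain n0 where n0: "n0 \<in> S i" by blast
        define y where "y = h0 * 2 ^ i"
        define K where "K = KK i"
        have yn: "y \<le> t n" "t n < 2 * y" if "n \<in> S i" for n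
          using blk_bounds[of "t n"] that by (auto simp: S_def y_def)
        have y1: "1 \<le> y" "h0 \<le> y" using block_start_ge[of i] h0_ge_1 unfolding y_def by linarith+
        have mono: "t a \<le> t c" if "a \<le> c" for a c using that by (simp add: t_def mult_left_mono)
        have "\<exists>A B. S i = {A..<B}"
        proof (rule convex_nat_set_interval)
          show "finite (S i)" by (simp add: S_def)
          fix a d e assume *: "a \<in> S i" "d \<in> S i" "a \<le> e" "e \<le> d"
          have "y \<le> t e" using yn(1)[OF *(1)] mono[OF *(3)] by linarith
          moreover have "t e < 2 * y" using yn(2)[OF *(2)] mono[OF *(4)] by linarith
          ultimately show "e \<in> S i" using blk_eqI[of i "t e"] y1 * by (auto simp: S_def y_def)
        qed
        then obtain A B where AB: "S i = {A..<B}" by blast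
        have VVn: "VV (t n) = (norm (\<Sum>j<K. ee (real j * phi (t n))))\<^sup>2 / real K" if "n \<in> S i" for n
          using that by (auto simp: VV_def S_def K_def)
        have K1: "1 \<le> K" using KK_ge_1 by (simp only: K_def)
        show ?thesis
        \<comment> \<open>Only blocks beyond \<open>N powr (9/10)\<close> need the exponential sums;
          an earlier block contains so few \<open>n\<close> that the trivial estimate by
          \<open>K\<close> is enough.\<close>
        proof (cases "real N powr (9 / 10) \<le> y")
          case True
          hence Yy: "Y \<le> y" using elim by linarith
          have "y \<le> real N powr (1 + \<epsilon>)" using yn(1)[OF n0] tT[of n0] n0 elim by (auto simp: S_def)
          have Ky: "real K \<le> y powr (u + \<epsilon>)"
            using KK_le[of i y] dY[OF Yy] unfolding K_def y_def by linarith
          have "norm (\<Sum>n\<in>S i. complex_of_real (VV (t n) - 1) * ee (real n * \<theta>)) \<le> real K * (400 * y powr (9 / 10))"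
          proof (rule VV_block_sum[OF K1 AB VVn])
            fix k :: nat and \<theta> :: real assume k: "1 \<le> k" "k < K"
            have "real m \<le> (real N powr (9 / 10)) powr \<epsilon>" using m elim by linarith
            also have "\<dots> \<le> y powr \<epsilon>" using True by (intro powr_mono2) (auto simp: \<epsilon>_def)
            finally have my: "real m \<le> y powr \<epsilon>" .
            have ky: "real k \<le> y powr (1 - gam + \<epsilon>)" using k Ky by (simp add: u_def)
            have "\<forall>n\<in>{A..<B}. y \<le> real (m * n + b) \<and> real (m * n + b) \<le> 2 * y"
              using yn AB by (auto simp: t_def less_imp_le)
            moreover have "Y1 \<le> y" using Yy by (simp add: Y_def)
            ultimately show "norm (\<Sum>n=A..<B. ee (real k * phi (t n) + real n * \<theta>)) \<le> 400 * y powr (9 / 10)"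
              using Y1[of y] m my k ky unfolding t_def by blast
          qed auto
          also have "\<dots> \<le> y powr (u + \<epsilon>) * (400 * y powr (9 / 10))"
            using Ky by (intro mult_right_mono) auto
          also have "\<dots> = 400 * y powr (9 / 10 + u + \<epsilon>)" by (simp add: powr_add)
          also have "\<dots> \<le> 400 * (real N powr (1 + \<epsilon>)) powr (9 / 10 + u + \<epsilon>)"
            using \<open>y \<le> real N powr (1 + \<epsilon>)\<close> y1 u by (intro mult_left_mono powr_mono2) (auto simp: \<epsilon>_def)
          also have "\<dots> = 400 * real N powr ((1 + \<epsilon>) * (9 / 10 + u + \<epsilon>))" by (simp add: powr_powr)
          also have "\<dots> \<le> Z" unfolding Z_def
            using N1 u by (intro mult_left_mono powr_mono) (auto simp: \<epsilon>_def algebra_simps)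
          finally show ?thesis .
        next
          case False
          have "N \<noteq> 0" using N1 by auto
          have yN: "y \<le> real N"
          proof -
            have "real N powr (9 / 10) \<le> real N powr 1" using N1 by (intro powr_mono) auto
            thus ?thesis using False N1 by simp
          qed
          have KN: "real K \<le> real N powr (u + \<epsilon>)"
            using KK_le[of i "real N"] dY[of "real N"] yN elim unfolding K_def y_def by linarith
          have card: "real (card (S i)) \<le> 2 * real N powr (9 / 10)"
          proof -
            have "A < B" using AB False \<open>S i \<noteq> {}\<close> by (cases "A < B") auto
            have "A \<in> S i" "B - 1 \<in> S i" using \<open>A < B\<close> AB by auto
            hence "t (B - 1) - t A \<le> y" using yn[of A] yn[of "B - 1"] by linarith
            moreover have "real (B - 1) - real A \<le> t (B - 1) - t A"
              using m \<open>A < B\<close> mult_right_mono[of 1 "real m" "real (B - 1) - real A"]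
              by (simp add: t_def algebra_simps of_nat_diff)
            ultimately have "real B - 1 - real A \<le> y" using \<open>A < B\<close> by (simp add: of_nat_diff)
            hence "real (card (S i)) \<le> y + 1" using AB \<open>A < B\<close> by (simp add: of_nat_diff)
            thus ?thesis using False y1 by linarith
          qed
          have "norm (\<Sum>n\<in>S i. complex_of_real (VV (t n) - 1) * ee (real n * \<theta>)) \<le> (\<Sum>n\<in>S i. 2 * real N powr (u + \<epsilon>))"
          proof (rule sum_norm_le)
            fix n assume n: "n \<in> S i"
            have "VV (t n) \<le> real K" using VV_le[of "t n"] n by (auto simp: S_def K_def)
            moreover have "0 \<le> VV (t n)" by (rule VV_nonneg)
            ultimately have "\<bar>VV (t n) - 1\<bar> \<le> 2 * real K" using K1 by linarith
            also have "\<dots> \<le> 2 * real N powr (u + \<epsilon>)" using KN by simp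
            finally show "norm (complex_of_real (VV (t n) - 1) * ee (real n * \<theta>)) \<le> 2 * real N powr (u + \<epsilon>)"
              unfolding norm_mult norm_of_real norm_ee by simp
          qed
          also have "\<dots> = real (card (S i)) * (2 * real N powr (u + \<epsilon>))" by simp
          also have "\<dots> \<le> 2 * real N powr (9 / 10) * (2 * real N powr (u + \<epsilon>))"
            using card by (intro mult_right_mono) auto
          also have "\<dots> = 4 * real N powr (9 / 10 + (u + \<epsilon>))" unfolding powr_add[of _ "9 / 10"] by simp
          also have "\<dots> \<le> Z" unfolding Z_def
            using N1 u by (intro mult_mono powr_mono) (auto simp: \<epsilon>_def)
          finally show ?thesis .
        qed
      qed
      \<comment> \<open>All arguments are at most \<open>N\<^sup>2\<close>, so at most
        \<open>3 * ln N + 1\<close> dyadic blocks occur. Arguments below \<open>h0\<close> drop out,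
        as \<open>VV\<close> is 1 there by definition.\<close>
      define I where "I = nat \<lfloor>3 * ln (real N)\<rfloor>"
      have blkI: "blk (t n) \<in> {..I}" if n: "n \<le> N" "h0 \<le> t n" for n
      proof -
        have "2 ^ blk (t n) \<le> h0 * 2 ^ blk (t n)" using h0_ge_1 by simp
        also have "\<dots> \<le> t n" using blk_bounds n by blast
        also have "\<dots> \<le> real N powr 2" using tT[OF n(1)] elim by linarith
        finally have "ln ((2::real) ^ blk (t n)) \<le> ln (real N powr 2)"
          using N1 by (subst ln_le_cancel_iff) auto
        hence "real (blk (t n)) * ln 2 \<le> 2 * ln (real N)"
          using N1 by (simp add: ln_realpow ln_powr)
        moreover have "real (blk (t n)) * (2 / 3) \<le> real (blk (t n)) * ln 2"
          using ln2_ge_two_thirds by (intro mult_left_mono) auto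
        ultimately have "real (blk (t n)) \<le> 3 * ln (real N)" by linarith
        thus ?thesis unfolding I_def by (simp add: le_nat_floor)
      qed
      have "(\<Sum>n\<le>N. complex_of_real (VV (t n) - 1) * ee (real n * \<theta>))
          = (\<Sum>n\<in>{n\<in>{..N}. h0 \<le> t n}. complex_of_real (VV (t n) - 1) * ee (real n * \<theta>))"
        by (intro sum.mono_neutral_right) (auto simp: VV_def)
      also have "\<dots> = (\<Sum>i\<in>{..I}. \<Sum>n\<in>{x\<in>{n\<in>{..N}. h0 \<le> t n}. blk (t x) = i}. complex_of_real (VV (t n) - 1) * ee (real n * \<theta>))"
        by (intro sum.group[symmetric]) (use blkI in auto)
      also have "\<dots> = (\<Sum>i\<in>{..I}. \<Sum>n\<in>S i. complex_of_real (VV (t n) - 1) * ee (real n * \<theta>))"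
        by (intro sum.cong) (auto simp: S_def)
      also have "norm \<dots> \<le> (\<Sum>i\<in>{..I}. Z)" by (intro sum_norm_le blockE)
      also have "\<dots> = (real I + 1) * Z" by simp
      also have "\<dots> \<le> real N powr \<epsilon> * Z"
      proof (intro mult_right_mono Z0)
        have "real I \<le> 3 * ln (real N)" using N1 unfolding I_def by simp
        thus "real I + 1 \<le> real N powr \<epsilon>" using elim by linarith
      qed
      also have "\<dots> = 400 * real N powr (\<epsilon> + (9 / 10 + u + 4 * \<epsilon>))"
        unfolding Z_def powr_add[of _ \<epsilon>] by simp
      also have "\<dots> \<le> 400 * real N powr (91 / 100 + (1 - gam))"
        using N1 by (intro mult_left_mono powr_mono) (auto simp: \<epsilon>_def u_def)
      finally show "norm (\<Sum>n\<le>N. complex_of_real (VV (real (m * n + b)) - 1) * ee (real n * \<theta>))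
          \<le> 400 * real N powr (91 / 100 + (1 - gam))" by (simp add: t_def)
    qed
  qed
qed

end

section \<open>The restriction estimate\<close>

text \<open>The unimodular \<open>c\<close> are the conjugate phases of the values, with the default
  1 where a value is 0, so that the sum of absolute values becomes one linear form in
  \<open>f\<close>. Cauchy-Schwarz with respect to the weight \<open>lam\<close> then separates
  \<open>f\<close> from the dual sum.\<close>

lemma duality_bound:
  fixes lam :: "nat \<Rightarrow> real" and f :: "nat \<Rightarrow> complex" and \<xi> :: "nat \<Rightarrow> real"
  assumes "finite X" "finite L" and lam: "\<And>n. n \<in> L \<Longrightarrow> 0 \<le> lam n" and "0 \<le> \<alpha>"
    and ge: "\<And>x. x \<in> X \<Longrightarrow> \<alpha> \<le> norm (\<Sum>n\<in>L. f n * of_real (lam n) * ee (real n * \<xi> x))"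
    and D: "\<And>c. (\<And>x. x \<in> X \<Longrightarrow> norm (c x) = 1) \<Longrightarrow>
      (\<Sum>n\<in>L. lam n * (norm (\<Sum>x\<in>X. c x * ee (real n * \<xi> x)))\<^sup>2) \<le> D"
  shows "(\<alpha> * real (card X))\<^sup>2 \<le> (\<Sum>n\<in>L. (norm (f n))\<^sup>2 * lam n) * D"
proof -
  define s where "s = (\<lambda>x. \<Sum>n\<in>L. f n * of_real (lam n) * ee (real n * \<xi> x))"
  define c where "c = (\<lambda>x. if s x = 0 then 1 else cnj (s x) / of_real (norm (s x)))"
  define g where "g = (\<lambda>n. \<Sum>x\<in>X. c x * ee (real n * \<xi> x))"
  have c1: "norm (c x) = 1" for x by (simp add: c_def norm_divide)
  have cs: "c x * s x = of_real (norm (s x))" for x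
  proof (cases "s x = 0")
    case False
    have "cnj (s x) * s x = of_real ((norm (s x))\<^sup>2)"
      unfolding complex_norm_square by (rule mult.commute)
    thus ?thesis using False by (simp add: c_def power2_eq_square)
  qed (simp add: c_def)
  have "\<alpha> * real (card X) \<le> (\<Sum>x\<in>X. norm (s x))"
    using sum_mono[of X "\<lambda>_. \<alpha>" "\<lambda>x. norm (s x)"] ge by (simp add: s_def mult.commute)
  also have "\<dots> = norm (of_real (\<Sum>x\<in>X. norm (s x)) :: complex)"
    unfolding norm_of_real by (simp add: sum_nonneg)
  also have "of_real (\<Sum>x\<in>X. norm (s x)) = (\<Sum>x\<in>X. c x * s x)" by (simp add: cs)
  also have "\<dots> = (\<Sum>x\<in>X. \<Sum>n\<in>L. f n * of_real (lam n) * (c x * ee (real n * \<xi> x)))"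
    unfolding s_def sum_distrib_left by (intro sum.cong refl) (simp only: mult_ac)
  also have "\<dots> = (\<Sum>n\<in>L. \<Sum>x\<in>X. f n * of_real (lam n) * (c x * ee (real n * \<xi> x)))"
    by (rule sum.swap)
  also have "\<dots> = (\<Sum>n\<in>L. f n * of_real (lam n) * g n)"
    by (simp only: g_def sum_distrib_left)
  also have "norm \<dots> \<le> (\<Sum>n\<in>L. (sqrt (lam n) * norm (f n)) * (sqrt (lam n) * norm (g n)))"
  proof (rule sum_norm_le)
    fix n assume "n \<in> L"
    hence "lam n = sqrt (lam n) * sqrt (lam n)" using lam by simp
    hence "norm (f n * of_real (lam n) * g n) = norm (f n) * (sqrt (lam n) * sqrt (lam n)) * norm (g n)"
      using lam[OF \<open>n \<in> L\<close>] by (simp add: norm_mult)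
    thus "norm (f n * of_real (lam n) * g n) \<le> (sqrt (lam n) * norm (f n)) * (sqrt (lam n) * norm (g n))"
      by (simp only: mult_ac order_refl)
  qed
  finally have "\<alpha> * real (card X) \<le> (\<Sum>n\<in>L. (sqrt (lam n) * norm (f n)) * (sqrt (lam n) * norm (g n)))" .
  hence "(\<alpha> * real (card X))\<^sup>2 \<le> (\<Sum>n\<in>L. (sqrt (lam n) * norm (f n)) * (sqrt (lam n) * norm (g n)))\<^sup>2"
    using \<open>0 \<le> \<alpha>\<close> by (intro power_mono) auto
  also have "\<dots> \<le> (\<Sum>n\<in>L. (sqrt (lam n) * norm (f n))\<^sup>2) * (\<Sum>n\<in>L. (sqrt (lam n) * norm (g n))\<^sup>2)"
    by (rule Cauchy_Schwarz_ineq_sum)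
  also have "(\<Sum>n\<in>L. (sqrt (lam n) * norm (f n))\<^sup>2) = (\<Sum>n\<in>L. (norm (f n))\<^sup>2 * lam n)"
    using lam by (intro sum.cong) (auto simp: power_mult_distrib)
  also have "(\<Sum>n\<in>L. (sqrt (lam n) * norm (g n))\<^sup>2) = (\<Sum>n\<in>L. lam n * (norm (g n))\<^sup>2)"
    using lam by (intro sum.cong) (auto simp: power_mult_distrib)
  also have "(\<Sum>n\<in>L. (norm (f n))\<^sup>2 * lam n) * (\<Sum>n\<in>L. lam n * (norm (g n))\<^sup>2)
      \<le> (\<Sum>n\<in>L. (norm (f n))\<^sup>2 * lam n) * D"
    unfolding g_def using lam c1 by (intro mult_left_mono D sum_nonneg) auto
  finally show ?thesis .
qed

definition valid_params :: "nat \<Rightarrow> nat \<Rightarrow> nat \<Rightarrow> bool" where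
  "valid_params N m b \<longleftrightarrow> 1 \<le> m \<and> real m \<le> ln (real N) \<and> b < m"

text \<open>From \<open>1 \<le> m \<le> ln N\<close> one gets \<open>N \<ge> exp 1\<close>; the
  arguments \<open>m * n + b\<close> then stay within \<open>N\<^sup>2\<close>, so that their
  logarithm is at most \<open>2 * ln N\<close>.\<close>

lemma valid_params_bounds:
  assumes "valid_params N m b"
  shows "1 \<le> ln (real N)" "2 \<le> real N" "ln (real N) * (2 * real N) \<le> (real N)\<^sup>2"
    "n \<le> N \<Longrightarrow> real (m * n + b) \<le> ln (real N) * (2 * real N)"
proof -
  show l1: "1 \<le> ln (real N)" using assms by (auto simp: valid_params_def)
  hence N0: "N > 0" by (cases N) auto
  have "exp 1 \<le> real N" using l1 N0 by (simp add: ln_ge_iff)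
  thus N2: "2 \<le> real N" using exp_ge_add_one_self[of 1] by linarith
  have "ln (real N / 2) \<le> real N / 2 - 1" using N0 by (intro ln_le_minus_one) auto
  hence "ln (real N) \<le> real N / 2" using N0 ln_2_less_1 by (simp add: ln_div)
  hence "ln (real N) * (2 * real N) \<le> real N / 2 * (2 * real N)" by (intro mult_right_mono) auto
  thus "ln (real N) * (2 * real N) \<le> (real N)\<^sup>2" by (simp add: power2_eq_square)
  show "real (m * n + b) \<le> ln (real N) * (2 * real N)" if n: "n \<le> N"
  proof -
    have "m * n \<le> m * N" using n by simp
    hence "m * n + b \<le> m * (N + 1)" using assms unfolding valid_params_def distrib_left by linarith
    hence "real (m * n + b) \<le> real (m * (N + 1))" by (simp only: of_nat_le_iff)
    also have "\<dots> \<le> ln (real N) * (2 * real N)"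
      using assms N2 unfolding of_nat_mult valid_params_def by (intro mult_mono) auto
    finally show ?thesis .
  qed
qed

lemma totient_ratio_le: "real (totient m) / real m \<le> 1"
  using totient_le[of m] by (cases "m = 0") (auto simp: field_simps)

context ps_function
begin

section \<open>The size of the weights\<close>

abbreviation "Lam N m b \<equiv> Lambda_set h x0 b m N"
abbreviation "lam N m b \<equiv> lambda_weight h x0 phi b m N"

lemma finite_Lam [simp]: "finite (Lam N m b)"
  by (rule finite_subset[of _ "{..N}"]) (auto simp: Lambda_set_def)

lemma Lam_subset: "Lam N m b \<subseteq> {..N}"
  by (auto simp: Lambda_set_def)

lemma LamD:
  assumes "n \<in> Lam N m b"
  shows "n \<le> N" "prime (m * n + b)" "h0 \<le> real (m * n + b)"
    "\<exists>j::nat. x0 \<le> real j \<and> real (m * n + b) \<le> h (real j) \<and> h (real j) < real (m * n + b) + 1"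
proof -
  show "n \<le> N" "prime (m * n + b)" "h0 \<le> real (m * n + b)"
    using assms by (auto simp: Lambda_set_def P_set_def h0_def)
  obtain j :: nat where j: "x0 \<le> real j" "int (m * n + b) = \<lfloor>h (real j)\<rfloor>"
    using assms unfolding Lambda_set_def P_set_def by blast
  hence "real_of_int (int (m * n + b)) \<le> h (real j)" "h (real j) < real_of_int (int (m * n + b)) + 1"
    by linarith+
  with j(1) show "\<exists>j::nat. x0 \<le> real j \<and> real (m * n + b) \<le> h (real j) \<and> h (real j) < real (m * n + b) + 1"
    by (intro exI[of _ j]) (simp only: of_int_of_nat_eq conj_absorb simp_thms)
qed

lemma lam_eq:
  assumes "n \<in> Lam N m b"
  shows "lam N m b n = real (totient m) / real m * ln (real (m * n + b)) / real N * (1 / dphi (real (m * n + b)))"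
  using assms by (simp add: lambda_weight_def dphi_def h0_def)

lemma lam_bound:
  assumes "valid_params N m b" "n \<in> Lam N m b" "1 / dphi (real (m * n + b)) \<le> B"
  shows "0 \<le> lam N m b n" "lam N m b n \<le> real (totient m) / real m * (2 * ln (real N)) / real N * B"
proof -
  define t where "t = real (m * n + b)"
  note vp = valid_params_bounds[OF assms(1)]
  have t: "h0 \<le> t" "1 \<le> t" using LamD[OF assms(2)] h0_ge_1 by (auto simp: t_def)
  have "t \<le> (real N)\<^sup>2" using vp(3) vp(4)[OF LamD(1)[OF assms(2)]] by (simp add: t_def)
  hence "ln t \<le> ln ((real N)\<^sup>2)" using t vp by (subst ln_le_cancel_iff) auto
  hence ln: "ln t \<le> 2 * ln (real N)" using vp by (simp add: ln_realpow)
  have d: "0 < dphi t" using t by (intro dphi_pos)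
  show "0 \<le> lam N m b n" unfolding lam_eq[OF assms(2)] using t d by (simp add: t_def)
  show "lam N m b n \<le> real (totient m) / real m * (2 * ln (real N)) / real N * B"
    unfolding lam_eq[OF assms(2)] t_def[symmetric] using ln t d assms(3) vp
    by (intro mult_mono divide_right_mono mult_left_mono) (auto simp: t_def)
qed

text \<open>A member of \<open>Lam\<close> comes with an integer \<open>j\<close> such that
  \<open>h j\<close> has integer part \<open>m * n + b\<close>, which is the situation of
  \<open>VV_lower\<close>.\<close>

lemma lam_le_V:
  obtains C where "1 \<le> C"
    "\<And>N m b n. valid_params N m b \<Longrightarrow> n \<in> Lam N m b \<Longrightarrow>
      lam N m b n \<le> (C * (real (totient m) / real m) * ln (real N) / real N) * VV (real (m * n + b))"
proof -
  obtain C where C: "1 \<le> C"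
    "\<And>t j. h0 \<le> t \<Longrightarrow> x0 \<le> real j \<Longrightarrow> t \<le> h (real j) \<Longrightarrow> h (real j) < t + 1 \<Longrightarrow> 1 / dphi t \<le> C * VV t"
    by (rule VV_lower) (rule that; assumption)
  show thesis
  proof (rule that[of "2 * C"])
    fix N m b n assume *: "valid_params N m b" "n \<in> Lam N m b"
    obtain j :: nat where "x0 \<le> real j" "real (m * n + b) \<le> h (real j)" "h (real j) < real (m * n + b) + 1"
      using LamD(4)[OF *(2)] by blast
    hence "1 / dphi (real (m * n + b)) \<le> C * VV (real (m * n + b))"
      using LamD(3)[OF *(2)] by (intro C(2))
    from lam_bound(2)[OF * this]
    show "lam N m b n \<le> (2 * C * (real (totient m) / real m) * ln (real N) / real N) * VV (real (m * n + b))"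
      by (simp add: mult_ac)
  qed (use C in auto)
qed

text \<open>Makes the eventual bound of \<open>dphi_growth\<close> uniform: before the threshold
  \<open>Z\<close>, monotonicity bounds \<open>1 / dphi t\<close> by its value at
  \<open>Z\<close>.\<close>

lemma dphi_inverse_le:
  assumes "0 < \<epsilon>"
  obtains C where "1 \<le> C" "\<And>t. h0 \<le> t \<Longrightarrow> 1 / dphi t \<le> C * t powr (1 - gam + \<epsilon>)"
proof -
  obtain Y where Y: "\<And>y. Y \<le> y \<Longrightarrow> y powr (gam - 1 - \<epsilon>) \<le> dphi y"
    using dphi_growth[OF assms] unfolding eventually_at_top_linorder by blast
  define Z where "Z = max Y h0"
  have dZ: "0 < dphi Z" by (intro dphi_pos) (simp add: Z_def)
  define C where "C = max 1 (1 / dphi Z)"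
  have "1 / dphi t \<le> C * t powr (1 - gam + \<epsilon>)" if t: "h0 \<le> t" for t
  proof -
    have t1: "1 \<le> t" using t h0_ge_1 by simp
    have p1: "1 \<le> t powr (1 - gam + \<epsilon>)" using t1 gam_bounds assms by (intro ge_one_powr_ge_zero) auto
    show ?thesis
    proof (cases "Z \<le> t")
      case True
      have pos: "0 < t powr (gam - 1 - \<epsilon>)" using t1 by simp
      have le: "t powr (gam - 1 - \<epsilon>) \<le> dphi t" using Y True by (simp add: Z_def)
      have "1 / dphi t \<le> 1 / t powr (gam - 1 - \<epsilon>)"
        using le pos dphi_pos[OF t] by (intro divide_left_mono mult_pos_pos) auto
      also have "\<dots> = 1 * t powr (1 - gam + \<epsilon>)" by (simp add: powr_minus_divide[symmetric] algebra_simps)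
      also have "\<dots> \<le> C * t powr (1 - gam + \<epsilon>)" by (intro mult_right_mono) (auto simp: C_def)
      finally show ?thesis .
    next
      case False
      have "dphi Z \<le> dphi t" using False t by (intro dphi_antimono) auto
      hence "1 / dphi t \<le> 1 / dphi Z" using dZ by (intro divide_left_mono mult_pos_pos) auto
      also have "\<dots> \<le> C * 1" by (simp add: C_def)
      also have "\<dots> \<le> C * t powr (1 - gam + \<epsilon>)" using p1 by (intro mult_left_mono) (auto simp: C_def)
      finally show ?thesis .
    qed
  qed
  thus thesis by (intro that[of C]) (auto simp: C_def)
qed

text \<open>Three factors \<open>ln N\<close> arise, one from the weight and two from the generous
  estimate of \<open>(2 * ln N) powr (1 - gam + e)\<close>; each is at most
  \<open>N powr e / e\<close>. The fourth share of \<open>\<epsilon> = 4 * e\<close> is spent in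
  \<open>dphi_inverse_le\<close>.\<close>

lemma lam_le_powr:
  assumes "0 < \<epsilon>" "\<epsilon> \<le> 1"
  obtains C where "1 \<le> C"
    "\<And>N m b n. valid_params N m b \<Longrightarrow> n \<in> Lam N m b \<Longrightarrow> lam N m b n \<le> C * real N powr (1 - gam + \<epsilon>) / real N"
proof -
  define e where "e = \<epsilon> / 4"
  have e: "0 < e" "e \<le> 1 / 4" using assms by (auto simp: e_def)
  obtain C where C: "1 \<le> C" "\<And>t. h0 \<le> t \<Longrightarrow> 1 / dphi t \<le> C * t powr (1 - gam + e)"
    by (rule dphi_inverse_le[OF e(1)]) (rule that; assumption)
  have "lam N m b n \<le> (8 * C / e ^ 3) * real N powr (1 - gam + \<epsilon>) / real N"
    if *: "valid_params N m b" "n \<in> Lam N m b" for N m b n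
  proof -
    define t where "t = real (m * n + b)"
    define l where "l = ln (real N)"
    note vp = valid_params_bounds[OF *(1)]
    have l: "1 \<le> l" "l \<le> real N powr e / e" using vp e by (auto simp: l_def intro!: ln_powr_bound)
    have t: "h0 \<le> t" "1 \<le> t" "t \<le> l * (2 * real N)"
      using LamD[OF *(2)] h0_ge_1 vp(4) by (auto simp: t_def l_def)
    have "t powr (1 - gam + e) \<le> (real N * (2 * l)) powr (1 - gam + e)"
      using t gam_bounds e by (intro powr_mono2) (auto simp: mult_ac)
    also have "\<dots> = real N powr (1 - gam + e) * (2 * l) powr (1 - gam + e)"
      using l by (simp add: powr_mult)
    also have "\<dots> \<le> real N powr (1 - gam + e) * (2 * l) powr 2"
      using l gam_bounds e by (intro mult_left_mono powr_mono) auto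
    also have "(2 * l) powr 2 = 4 * l\<^sup>2" using l by (simp add: power2_eq_square)
    finally have tp: "t powr (1 - gam + e) \<le> real N powr (1 - gam + e) * (4 * l\<^sup>2)" .
    have "1 / dphi t \<le> C * (real N powr (1 - gam + e) * (4 * l\<^sup>2))"
      using C(2)[OF t(1)] mult_left_mono[OF tp, of C] C(1) by linarith
    hence "lam N m b n \<le> real (totient m) / real m * (2 * ln (real N)) / real N * (C * (real N powr (1 - gam + e) * (4 * l\<^sup>2)))"
      unfolding t_def by (rule lam_bound(2)[OF *])
    also have "\<dots> \<le> 1 * (2 * ln (real N)) / real N * (C * (real N powr (1 - gam + e) * (4 * l\<^sup>2)))"
      using totient_ratio_le[of m] l C(1) vp by (intro mult_right_mono divide_right_mono) (auto simp: l_def)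
    also have "\<dots> = 8 * C * real N powr (1 - gam + e) / real N * l ^ 3"
      by (simp add: l_def power2_eq_square power3_eq_cube)
    also have "\<dots> \<le> 8 * C * real N powr (1 - gam + e) / real N * (real N powr e / e) ^ 3"
      using l C(1) by (intro mult_left_mono power_mono) auto
    also have "\<dots> = (8 * C / e ^ 3) * (real N powr (1 - gam + e) * real N powr e * real N powr e * real N powr e) / real N"
      by (simp add: power3_eq_cube power_divide mult_ac)
    also have "real N powr (1 - gam + e) * real N powr e * real N powr e * real N powr e = real N powr (1 - gam + \<epsilon>)"
    proof -
      have "1 - gam + e + e + e + e = 1 - gam + \<epsilon>" by (simp add: e_def)
      thus ?thesis by (simp only: powr_add[symmetric])
    qed
    finally show ?thesis .
  qed
  moreover have "1 \<le> 8 * C / e ^ 3"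
  proof -
    have "e ^ 3 \<le> 1" using e by (intro power_le_one) auto
    thus ?thesis using C(1) e by (simp add: field_simps)
  qed
  ultimately show thesis by (rule that[rotated])
qed

section \<open>Three bounds for the dual mean square\<close>

definition Dsum :: "nat \<Rightarrow> nat \<Rightarrow> nat \<Rightarrow> nat set \<Rightarrow> real \<Rightarrow> (nat \<Rightarrow> complex) \<Rightarrow> real" where
  "Dsum N m b X \<theta> w = (\<Sum>n\<in>Lam N m b. lam N m b n * (norm (\<Sum>x\<in>X. w x * ee (real n * (\<theta> + real x / real (N + 1)))))\<^sup>2)"

text \<open>The largest weight times Parseval. This is the bound of choice for very many points and
  for bounded \<open>N\<close>.\<close>

lemma Dsum_trivial:
  assumes "0 < \<epsilon>" "\<epsilon> \<le> 1"
  obtains C where "1 \<le> C"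
    "\<And>N m b X \<theta> w. valid_params N m b \<Longrightarrow> X \<subseteq> {..N} \<Longrightarrow> (\<forall>x\<in>X. norm (w x) = 1) \<Longrightarrow>
      Dsum N m b X \<theta> w \<le> C * real N powr (1 - gam + \<epsilon>) * real (card X)"
proof -
  obtain C where C: "1 \<le> C"
    "\<And>N m b n. valid_params N m b \<Longrightarrow> n \<in> Lam N m b \<Longrightarrow> lam N m b n \<le> C * real N powr (1 - gam + \<epsilon>) / real N"
    by (rule lam_le_powr[OF assms]) (rule that; assumption)
  have "Dsum N m b X \<theta> w \<le> (2 * C) * real N powr (1 - gam + \<epsilon>) * real (card X)"
    if *: "valid_params N m b" "X \<subseteq> {..N}" "\<And>x. x \<in> X \<Longrightarrow> norm (w x) = 1" for N m b X \<theta> w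
  proof -
    let ?s = "\<lambda>n. (norm (\<Sum>x\<in>X. w x * ee (real n * (\<theta> + real x / real (N + 1)))))\<^sup>2"
    define B where "B = C * real N powr (1 - gam + \<epsilon>) / real N"
    have B0: "0 \<le> B" using C(1) by (simp add: B_def)
    note vp = valid_params_bounds[OF *(1)]
    have "Dsum N m b X \<theta> w \<le> (\<Sum>n\<in>Lam N m b. B * ?s n)"
      unfolding Dsum_def B_def by (intro sum_mono mult_right_mono C(2) *) auto
    also have "\<dots> \<le> (\<Sum>n\<le>N. B * ?s n)"
      using B0 by (intro sum_mono2 Lam_subset) auto
    also have "\<dots> = B * (real (N + 1) * real (card X))"
      unfolding sum_distrib_left[symmetric] using parseval_unimodular[OF *(2,3)] by simp
    also have "\<dots> \<le> B * (2 * real N * real (card X))"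
      using B0 vp by (intro mult_left_mono mult_right_mono) auto
    also have "\<dots> = (2 * C) * real N powr (1 - gam + \<epsilon>) * real (card X)"
      using vp by (simp add: B_def)
    finally show ?thesis .
  qed
  thus thesis using C(1) by (intro that[of "2 * C"]) auto
qed

text \<open>Majorising the weight by \<open>VV\<close> discards primality, whence the factor
  \<open>ln N\<close>. The constant term of \<open>VV\<close> gives the Parseval term, its Fourier
  error the second one, with exponent \<open>91/100 + (1 - gam) - 1\<close>.\<close>

lemma Dsum_no_sieve:
  assumes "15 / 16 \<le> gam"
  obtains C N0 where "1 \<le> C"
    "\<And>N m b X \<theta> w. N0 \<le> N \<Longrightarrow> valid_params N m b \<Longrightarrow> X \<subseteq> {..N} \<Longrightarrow> (\<forall>x\<in>X. norm (w x) = 1) \<Longrightarrow>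
      Dsum N m b X \<theta> w \<le> C * ln (real N) * (real (card X) + (real (card X))\<^sup>2 * real N powr (1 - gam - 9 / 100))"
proof -
  obtain C where C: "1 \<le> C"
    "\<And>N m b n. valid_params N m b \<Longrightarrow> n \<in> Lam N m b \<Longrightarrow>
      lam N m b n \<le> (C * (real (totient m) / real m) * ln (real N) / real N) * VV (real (m * n + b))"
    by (rule lam_le_V) (rule that; assumption)
  obtain N0 where N0: "\<And>N m b \<theta>. N0 \<le> N \<Longrightarrow> 1 \<le> m \<Longrightarrow> real m \<le> ln (real N) \<Longrightarrow> b < m \<Longrightarrow>
    norm (\<Sum>n\<le>N. complex_of_real (VV (real (m * n + b)) - 1) * ee (real n * \<theta>))
      \<le> 400 * real N powr (91 / 100 + (1 - gam))"
    using VV_fourier[OF assms] unfolding eventually_sequentially by blast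
  have "Dsum N m b X \<theta> w \<le> (400 * C) * ln (real N) * (real (card X) + (real (card X))\<^sup>2 * real N powr (1 - gam - 9 / 100))"
    if *: "N0 \<le> N" "valid_params N m b" "X \<subseteq> {..N}" "\<And>x. x \<in> X \<Longrightarrow> norm (w x) = 1" for N m b X \<theta> w
  proof -
    let ?s = "\<lambda>n. (norm (\<Sum>x\<in>X. w x * ee (real n * (\<theta> + real x / real (N + 1)))))\<^sup>2"
    note vp = valid_params_bounds[OF *(2)]
    define H where "H = C * ln (real N) / real N"
    have H0: "0 \<le> H" using C(1) vp by (simp add: H_def)
    have "C * (real (totient m) / real m) * ln (real N) / real N \<le> H"
      unfolding H_def using totient_ratio_le[of m] C(1) vp
      by (intro divide_right_mono mult_right_mono mult_left_le) auto
    hence "(C * (real (totient m) / real m) * ln (real N) / real N) * VV (real (m * n + b)) \<le> H * VV (real (m * n + b))" for n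
      by (intro mult_right_mono VV_nonneg)
    hence lamH: "lam N m b n \<le> H * VV (real (m * n + b))" if "n \<in> Lam N m b" for n
      using C(2)[OF *(2) that] order_trans by blast
    have "Dsum N m b X \<theta> w \<le> (\<Sum>n\<in>Lam N m b. H * VV (real (m * n + b)) * ?s n)"
      unfolding Dsum_def by (intro sum_mono mult_right_mono lamH) auto
    also have "\<dots> \<le> (\<Sum>n\<le>N. H * VV (real (m * n + b)) * ?s n)"
      using H0 VV_nonneg by (intro sum_mono2 Lam_subset) auto
    also have "\<dots> = H * (\<Sum>n\<le>N. VV (real (m * n + b)) * ?s n)"
      by (simp only: sum_distrib_left mult.assoc)
    also have "\<dots> \<le> H * ((\<Sum>n\<le>N. ?s n) + 400 * real N powr (91 / 100 + (1 - gam)) * (\<Sum>x\<in>X. norm (w x))\<^sup>2)"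
      using *(2) unfolding valid_params_def
      by (intro mult_left_mono H0 weighted_sum_le N0[OF *(1)]) auto
    also have "\<dots> = H * (real (N + 1) * real (card X) + 400 * real N powr (91 / 100 + (1 - gam)) * (real (card X))\<^sup>2)"
      using parseval_unimodular[OF *(3,4)] *(4) by simp
    also have "\<dots> \<le> H * (400 * real N * real (card X) + 400 * real N powr (91 / 100 + (1 - gam)) * (real (card X))\<^sup>2)"
      using vp by (intro mult_left_mono add_right_mono mult_right_mono H0) auto
    also have "real N powr (91 / 100 + (1 - gam)) = real N * real N powr (1 - gam - 9 / 100)"
    proof -
      have "real N powr (91 / 100 + (1 - gam)) = real N powr (1 + (1 - gam - 9 / 100))" by simp
      also have "\<dots> = real N * real N powr (1 - gam - 9 / 100)" unfolding powr_add using vp by simp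
      finally show ?thesis .
    qed
    also have "H * (400 * real N * real (card X) + 400 * (real N * real N powr (1 - gam - 9 / 100)) * (real (card X))\<^sup>2)
        = (400 * C) * ln (real N) * (real (card X) + (real (card X))\<^sup>2 * real N powr (1 - gam - 9 / 100))"
      using vp by (simp add: H_def field_simps)
    finally show ?thesis .
  qed
  thus thesis using C(1) by (intro that[of "400 * C" N0]) auto
qed

text \<open>Here \<open>ln N\<close> disappears: \<open>G\<close> is at least a constant times
  \<open>(totient m / m) * ln N * J powr (- \<epsilon>)\<close>, and the first two factors are those
  of the weight. The choice \<open>z = J\<^sup>2\<close> brings the collision term of the large
  sieve down to the order of its diagonal. As \<open>Q\<close> and \<open>J\<close> are at most
  \<open>N powr (1/1000)\<close>, the terms with powers of \<open>Q\<close> do no harm.\<close>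

lemma Dsum_sieve:
  assumes gam: "15 / 16 \<le> gam" and "0 < \<epsilon>"
  obtains C N0 where "1 \<le> C"
    "\<And>N m b X \<theta> w. N0 \<le> N \<Longrightarrow> valid_params N m b \<Longrightarrow> X \<subseteq> {..N} \<Longrightarrow> X \<noteq> {} \<Longrightarrow>
      real (card X) \<le> real N powr (1 / 1000) \<Longrightarrow> (\<forall>x\<in>X. norm (w x) = 1) \<Longrightarrow>
      Dsum N m b X \<theta> w \<le> C * real (card X) powr \<epsilon> * real (card X)"
proof -
  obtain CV where CV: "1 \<le> CV"
    "\<And>N m b n. valid_params N m b \<Longrightarrow> n \<in> Lam N m b \<Longrightarrow>
      lam N m b n \<le> (CV * (real (totient m) / real m) * ln (real N) / real N) * VV (real (m * n + b))"
    by (rule lam_le_V) (rule that; assumption)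
  obtain N0 where N0: "\<And>N m b \<theta>. N0 \<le> N \<Longrightarrow> 1 \<le> m \<Longrightarrow> real m \<le> ln (real N) \<Longrightarrow> b < m \<Longrightarrow>
    norm (\<Sum>n\<le>N. complex_of_real (VV (real (m * n + b)) - 1) * ee (real n * \<theta>))
      \<le> 400 * real N powr (91 / 100 + (1 - gam))"
    using VV_fourier[OF gam] unfolding eventually_sequentially by blast
  have e10: "0 < (1 / 10 :: real)" "(1 / 10 :: real) \<le> 1" by simp_all
  obtain CP where CP: "1 \<le> CP"
    "\<And>N m b n. valid_params N m b \<Longrightarrow> n \<in> Lam N m b \<Longrightarrow> lam N m b n \<le> CP * real N powr (1 - gam + 1 / 10) / real N"
    by (rule lam_le_powr[OF e10]) (rule that; assumption)
  obtain c0 where c0: "c0 > 0" "\<And>z::nat. z \<ge> 1 \<Longrightarrow> c0 * real z powr (- (\<epsilon> / 2)) \<le> mertens_prod z"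
    using mertens_prod_ge[of "\<epsilon> / 2"] assms(2) by auto
  define CC where "CC = 816000 * CV / c0 + 2 * CP"
  have main: "Dsum N m b X \<theta> w \<le> CC * real (card X) powr \<epsilon> * real (card X)"
    if *: "N0 \<le> N" "valid_params N m b" "X \<subseteq> {..N}" "X \<noteq> {}" "real (card X) \<le> real N powr (1 / 1000)"
      "\<And>x. x \<in> X \<Longrightarrow> norm (w x) = 1" for N m b X \<theta> w
  proof -
    let ?s = "\<lambda>n. (norm (\<Sum>x\<in>X. w x * ee (real n * (\<theta> + real x / real (N + 1)))))\<^sup>2"
    note vp = valid_params_bounds[OF *(2)]
    have m: "1 \<le> m" "real m \<le> ln (real N)" "b < m" using *(2) by (auto simp: valid_params_def)
    have N1: "1 \<le> real N" using vp by simp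
    have finX: "finite X" using *(3) by (rule finite_subset) simp
    define J where "J = card X"
    have J: "1 \<le> J" using *(4) finX by (simp add: J_def Suc_le_eq card_gt_0_iff)
    define \<delta> :: real where "\<delta> = 1 / 1000"
    have JN: "real J \<le> real N powr \<delta>" using *(5) by (simp add: J_def \<delta>_def)
    define Q where "Q = nat \<lfloor>real N powr \<delta>\<rfloor>"
    have Np: "1 \<le> real N powr \<delta>" using N1 by (intro ge_one_powr_ge_zero) (auto simp: \<delta>_def)
    have Q: "1 \<le> Q" "real Q \<le> real N powr \<delta>" "real N powr \<delta> \<le> real Q + 1"
      using Np unfolding Q_def by linarith+
    define z where "z = J\<^sup>2"
    define S where "S = prime_factors m \<union> {p. prime p \<and> p \<le> z}"
    define rr where "rr = real (totient m) / real m"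
    have rr: "0 < rr" "rr \<le> 1" using m totient_ratio_le[of m] by (auto simp: rr_def)
    interpret sieve_setup S m z Q
    proof
      fix q assume q: "q \<in> sieve_moduli S Q"
      show "coprime m q"
      proof (rule ccontr)
        assume "\<not> coprime m q"
        hence "gcd m q \<noteq> 1" by (simp only: coprime_iff_gcd_eq_1 not_False_eq_True)
        then obtain p where p: "prime p" "p dvd gcd m q" using prime_factor_nat by blast
        hence "p dvd m" "p dvd q" by auto
        hence "p \<in> S" using p m by (auto simp: S_def prime_factors_dvd)
        thus False using q \<open>p dvd q\<close> by (auto simp: sieve_moduli_def)
      qed
    qed (use J Q in \<open>auto simp: S_def z_def\<close>)
    have G1: "1 \<le> G" by (rule sieve_sum_ge_1)
    have sqz: "sqrt (real z) = real J" by (simp add: z_def)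
    define H where "H = CV * rr * ln (real N) / real N"
    have H0: "0 \<le> H" using CV(1) rr vp by (simp add: H_def)
    \<comment> \<open>A prime \<open>m * n + b \<le> Q\<close> can divide a modulus, and then the
      Ramanujan sums are not constant; these \<open>n\<close>, at most \<open>Q + 1\<close> in
      number, are estimated trivially.\<close>
    define L0 L1 where "L0 = {n\<in>Lam N m b. m * n + b \<le> Q}" and "L1 = {n\<in>Lam N m b. Q < m * n + b}"
    have split: "Dsum N m b X \<theta> w = (\<Sum>n\<in>L0. lam N m b n * ?s n) + (\<Sum>n\<in>L1. lam N m b n * ?s n)"
      unfolding Dsum_def
      by (subst sum.union_disjoint[symmetric]) (auto simp: L0_def L1_def intro!: sum.cong)
    have lam0: "0 \<le> lam N m b n" if "n \<in> Lam N m b" for n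
      using lam_bound(1)[OF *(2) that order_refl] .
    have E: "norm (\<Sum>n\<le>N. complex_of_real (VV (real (m * n + b)) - 1) * ee (real n * \<theta>))
      \<le> 400 * real N powr (91 / 100 + (1 - gam))" for \<theta>
      using N0[OF *(1) m] .
    have "(\<Sum>n\<in>L1. lam N m b n * ?s n)
      \<le> H / G\<^sup>2 * (real (N + 1) * real (card X) * G
        + (real (card X))\<^sup>2 * (2 * G / sqrt (real z) * real (N + 1) + 2 * real Q ^ 6)
        + 400 * real N powr (91 / 100 + (1 - gam)) * (real (card X) * real Q)\<^sup>2)"
    proof (rule sieve_dual_bound[where W = "\<lambda>n. VV (real (m * n + b))" and b = b])
      show "L1 \<subseteq> {..N}" using Lam_subset by (auto simp: L1_def)
      fix n assume n: "n \<in> L1"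
      hence nL: "n \<in> Lam N m b" by (simp add: L1_def)
      show "0 \<le> lam N m b n" by (rule lam0[OF nL])
      show "lam N m b n \<le> H * VV (real (m * n + b))"
        using CV(2)[OF *(2) nL] by (simp add: H_def rr_def)
      fix q assume "q \<in> sieve_moduli S Q"
      hence "1 \<le> q" "q \<le> Q" using moduli_bounds by auto
      hence "\<not> (m * n + b) dvd q" using n by (auto simp: L1_def dest: dvd_imp_le)
      thus "coprime (m * n + b) q" using LamD(2)[OF nL] by (rule prime_imp_coprime[rotated])
    qed (use *(3,6) finX H0 VV_nonneg E in auto)
    \<comment> \<open>\<open>408 = 2 + 4 + 2 + 400\<close>: the diagonal, the collisions, the
      remainder with \<open>Q ^ 6\<close> and the Fourier error, each measured in units of
      \<open>G * J * N\<close>.\<close>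
    also have "\<dots> \<le> H / G\<^sup>2 * (408 * G * real J * real N)"
    proof (rule mult_left_mono)
      have t1: "real (N + 1) * real (card X) * G \<le> 2 * (G * real J * real N)"
        using N1 G1 mult_right_mono[of "real (N + 1)" "2 * real N" "real J * G"] by (simp add: J_def mult_ac)
      have t2: "(real (card X))\<^sup>2 * (2 * G / sqrt (real z) * real (N + 1)) \<le> 4 * (G * real J * real N)"
      proof -
        have "(real (card X))\<^sup>2 * (2 * G / sqrt (real z) * real (N + 1)) = 2 * G * real J * real (N + 1)"
          unfolding sqz using J by (simp add: J_def power2_eq_square)
        also have "\<dots> \<le> 2 * G * real J * (2 * real N)" using N1 G1 by (intro mult_left_mono) auto
        finally show ?thesis by simp
      qed
      have pw: "real N powr a \<le> real N" if "a \<le> 1" for a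
        using powr_mono[OF that N1] N1 by simp
      have G': "real J * real N \<le> G * real J * real N"
        using G1 mult_right_mono[of 1 G "real J * real N"] by (simp add: mult_ac)
      have t3: "(real (card X))\<^sup>2 * (2 * real Q ^ 6) \<le> 2 * (G * real J * real N)"
      proof -
        have "(real (card X))\<^sup>2 * (2 * real Q ^ 6) = 2 * real J * (real J * real Q ^ 6)"
          by (simp add: J_def power2_eq_square)
        also have "\<dots> \<le> 2 * real J * (real N powr \<delta> * (real N powr \<delta>) ^ 6)"
          using JN Q by (intro mult_left_mono mult_mono power_mono) auto
        also have "real N powr \<delta> * (real N powr \<delta>) ^ 6 = real N powr (7 * \<delta>)"
          using N1 by (simp add: powr_power flip: powr_add)
        also have "2 * real J * real N powr (7 * \<delta>) \<le> 2 * real J * real N"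
          by (intro mult_left_mono pw) (auto simp: \<delta>_def)
        finally show ?thesis using G' by linarith
      qed
      have t4: "400 * real N powr (91 / 100 + (1 - gam)) * (real (card X) * real Q)\<^sup>2 \<le> 400 * (G * real J * real N)"
      proof -
        have "400 * real N powr (91 / 100 + (1 - gam)) * (real (card X) * real Q)\<^sup>2
            = 400 * real J * (real N powr (91 / 100 + (1 - gam)) * (real J * (real Q)\<^sup>2))"
          by (simp add: J_def power2_eq_square)
        also have "\<dots> \<le> 400 * real J * (real N powr (91 / 100 + (1 - gam)) * (real N powr \<delta> * (real N powr \<delta>)\<^sup>2))"
          using JN Q by (intro mult_left_mono mult_mono power_mono) auto
        also have "real N powr (91 / 100 + (1 - gam)) * (real N powr \<delta> * (real N powr \<delta>)\<^sup>2)
            = real N powr (91 / 100 + (1 - gam) + 3 * \<delta>)"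
          using N1 by (simp add: powr_power flip: powr_add)
        also have "400 * real J * \<dots> \<le> 400 * real J * real N"
          using gam by (intro mult_left_mono pw) (auto simp: \<delta>_def)
        finally show ?thesis using G' by linarith
      qed
      show "real (N + 1) * real (card X) * G
        + (real (card X))\<^sup>2 * (2 * G / sqrt (real z) * real (N + 1) + 2 * real Q ^ 6)
        + 400 * real N powr (91 / 100 + (1 - gam)) * (real (card X) * real Q)\<^sup>2 \<le> 408 * G * real J * real N"
        using t1 t2 t3 t4 unfolding distrib_left by linarith
    qed (use H0 in auto)
    also have "\<dots> = 408 * CV * (rr * ln (real N)) / G * real J"
      using G1 N1 by (simp add: H_def power2_eq_square field_simps)
    also have "\<dots> \<le> 816000 * CV / c0 * real J powr \<epsilon> * real J"
    proof -
      have "rr * mertens_prod z * (ln (real Q + 1) / 2) \<le> G"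
        using sieve_sum_lower[of m z Q] m by (simp add: rr_def S_def)
      moreover have "rr * (c0 * real J powr (- \<epsilon>)) * (\<delta> * ln (real N) / 2) \<le> rr * mertens_prod z * (ln (real Q + 1) / 2)"
      proof -
        have "real z powr (- (\<epsilon> / 2)) = real J powr (- \<epsilon>)"
          using J by (simp add: z_def powr_powr flip: powr_numeral)
        hence a1: "c0 * real J powr (- \<epsilon>) \<le> mertens_prod z" using c0(2)[of z] J by (simp add: z_def)
        have "\<delta> * ln (real N) = ln (real N powr \<delta>)" using N1 by (simp add: ln_powr)
        also have "\<dots> \<le> ln (real Q + 1)" using Q Np N1 by (subst ln_le_cancel_iff) auto
        finally have a2: "\<delta> * ln (real N) \<le> ln (real Q + 1)" .
        show ?thesis
          by (intro mult_mono mult_left_mono[OF a1] divide_right_mono[OF a2])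
            (use rr vp mertens_prod_pos[of z] in \<open>auto simp: \<delta>_def\<close>)
      qed
      ultimately have Glow: "rr * (c0 * real J powr (- \<epsilon>)) * (\<delta> * ln (real N) / 2) \<le> G" by linarith
      have "rr * ln (real N) = (rr * (c0 * real J powr (- \<epsilon>)) * (\<delta> * ln (real N) / 2)) * (2 / (c0 * \<delta>) * real J powr \<epsilon>)"
        using c0 J by (simp add: \<delta>_def powr_minus field_simps)
      also have "\<dots> \<le> G * (2 / (c0 * \<delta>) * real J powr \<epsilon>)"
        using Glow c0 by (intro mult_right_mono) (auto simp: \<delta>_def)
      finally have "rr * ln (real N) / G \<le> 2000 / c0 * real J powr \<epsilon>"
        using G1 by (simp add: \<delta>_def field_simps)
      hence "408 * CV * (rr * ln (real N) / G) * real J \<le> 408 * CV * (2000 / c0 * real J powr \<epsilon>) * real J"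
        using CV(1) by (intro mult_left_mono mult_right_mono) auto
      thus ?thesis by simp
    qed
    finally have D1: "(\<Sum>n\<in>L1. lam N m b n * ?s n) \<le> 816000 * CV / c0 * real J powr \<epsilon> * real J" .
    have "(\<Sum>n\<in>L0. lam N m b n * ?s n) \<le> (\<Sum>n\<in>L0. CP * real N powr (1 - gam + 1 / 10) / real N * (real J)\<^sup>2)"
    proof (intro sum_mono mult_mono power_mono)
      fix n assume n: "n \<in> L0"
      show "lam N m b n \<le> CP * real N powr (1 - gam + 1 / 10) / real N"
        using CP(2)[OF *(2)] n by (simp add: L0_def)
      have "norm (\<Sum>x\<in>X. w x * ee (real n * (\<theta> + real x / real (N + 1)))) \<le> (\<Sum>x\<in>X. 1)"
        by (rule sum_norm_le) (simp add: norm_mult *(6))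
      thus "norm (\<Sum>x\<in>X. w x * ee (real n * (\<theta> + real x / real (N + 1)))) \<le> real J" by (simp add: J_def)
    qed (use CP(1) in auto)
    also have "\<dots> = real (card L0) * (CP * real N powr (1 - gam + 1 / 10) / real N * (real J)\<^sup>2)" by simp
    also have "\<dots> \<le> (2 * real N powr \<delta>) * (CP * real N powr (1 - gam + 1 / 10) / real N * (real J)\<^sup>2)"
    proof (rule mult_right_mono)
      have "n \<le> Q" if "m * n + b \<le> Q" for n
      proof -
        have "1 * n \<le> m * n" using m by (intro mult_right_mono) auto
        thus ?thesis using that by linarith
      qed
      hence "L0 \<subseteq> {..Q}" unfolding L0_def by blast
      hence "card L0 \<le> card {..Q}" by (intro card_mono) auto
      thus "real (card L0) \<le> 2 * real N powr \<delta>" using Q Np by simp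
    qed (use CP(1) in auto)
    also have "\<dots> = 2 * CP * real J * (real N powr \<delta> * real N powr (1 - gam + 1 / 10) / real N) * real J"
      by (simp add: power2_eq_square)
    also have "\<dots> \<le> 2 * CP * real J * (real N powr \<delta> * real N powr (1 - gam + 1 / 10) / real N) * real N powr \<delta>"
      using JN CP(1) by (intro mult_left_mono) auto
    also have "\<dots> = 2 * CP * real J * (real N powr (\<delta> + (1 - gam + 1 / 10) - 1 + \<delta>))"
    proof -
      have "real N powr (\<delta> + (1 - gam + 1 / 10) - 1 + \<delta>)
          = real N powr \<delta> * real N powr (1 - gam + 1 / 10) / real N powr 1 * real N powr \<delta>"
        by (simp only: powr_add powr_diff)
      thus ?thesis using N1 by simp
    qed
    also have "\<dots> \<le> 2 * CP * real J * (real N powr 0)"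
      using CP(1) N1 gam by (intro mult_left_mono powr_mono) (auto simp: \<delta>_def)
    also have "\<dots> \<le> 2 * CP * real J * real J powr \<epsilon>"
      using CP(1) N1 J assms(2) by (intro mult_left_mono) (auto intro!: ge_one_powr_ge_zero)
    finally have D0: "(\<Sum>n\<in>L0. lam N m b n * ?s n) \<le> 2 * CP * real J powr \<epsilon> * real J" by (simp add: mult_ac)
    show ?thesis using D0 D1 unfolding split CC_def J_def[symmetric] by (simp add: algebra_simps)
  qed
  have "0 \<le> 816000 * CV / c0" using CV(1) c0(1) by simp
  hence "1 \<le> CC" using CP(1) unfolding CC_def by linarith
  thus thesis using main by (intro that[of CC N0]) blast+
qed

end

section \<open>Level sets and the restriction estimate\<close>

context ps_function
begin

text \<open>By duality \<open>\<alpha>\<^sup>2 \<le> F * B\<close> whenever the dual sum is at most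
  \<open>B * J\<^sup>2\<close>. Bounded \<open>N\<close> are absorbed by the constant. The sieve
  bound serves \<open>J \<le> N powr (1/1000)\<close>; from there to \<open>N powr (9/100)\<close>
  the bound without sieve is used, where \<open>ln N\<close> is harmless and either
  \<open>1 / J\<close> or \<open>N powr (- \<sigma>)\<close> dominates; beyond that the trivial
  bound takes over. The last two meet at \<open>J = N powr (9/100)\<close>, where both are
  \<open>N powr (- \<sigma>)\<close> up to small powers, and this produces the limit
  \<open>\<sigma> * (100/9)\<close> for \<tau>.\<close>

lemma level_set_bound:
  assumes gam: "15 / 16 \<le> gam" and \<tau>: "0 < \<tau>" "\<tau> < (gam - 91 / 100) * (100 / 9)"
  obtains C where "1 \<le> C"
    "\<And>N m b X \<theta> f \<alpha>. valid_params N m b \<Longrightarrow> X \<subseteq> {..N} \<Longrightarrow> X \<noteq> {} \<Longrightarrow> 0 \<le> \<alpha> \<Longrightarrow>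
      (\<forall>x\<in>X. \<alpha> \<le> norm (\<Sum>n\<in>Lam N m b. f n * of_real (lam N m b n) * ee (real n * (\<theta> + real x / real (N + 1))))) \<Longrightarrow>
      \<alpha>\<^sup>2 \<le> C * (\<Sum>n\<in>Lam N m b. (norm (f n))\<^sup>2 * lam N m b n) * real (card X) powr (- \<tau>)"
proof -
  define \<sigma> where sigma_def: "\<sigma> = gam - 91 / 100"
  have \<tau>1: "\<tau> < 1" using \<tau> gam_bounds by auto
  \<comment> \<open>The slack in \<open>\<tau> < 1\<close> pays for the losses
    \<open>J powr \<epsilon>\<close> with few points, that in
    \<open>9/100 * \<tau> < \<sigma>\<close> for the losses \<open>N powr \<epsilon>\<close> around
    the critical size \<open>J = N powr (9/100)\<close>.\<close>
  define \<epsilon> where "\<epsilon> = min (1 - \<tau>) (\<sigma> - 9 / 100 * \<tau>)"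
  have \<epsilon>: "0 < \<epsilon>" "\<epsilon> \<le> 1" "\<epsilon> \<le> 1 - \<tau>" "\<epsilon> \<le> \<sigma> - 9 / 100 * \<tau>"
    using \<tau> \<tau>1 by (auto simp: \<epsilon>_def sigma_def)
  obtain C1 where C1: "1 \<le> C1"
    "\<And>N m b X \<theta> w. valid_params N m b \<Longrightarrow> X \<subseteq> {..N} \<Longrightarrow> (\<forall>x\<in>X. norm (w x) = 1) \<Longrightarrow>
      Dsum N m b X \<theta> w \<le> C1 * real N powr (1 - gam + \<epsilon>) * real (card X)"
    by (rule Dsum_trivial[OF \<epsilon>(1,2)]) (rule that; assumption)
  obtain C2 N2 where C2: "1 \<le> C2"
    "\<And>N m b X \<theta> w. N2 \<le> N \<Longrightarrow> valid_params N m b \<Longrightarrow> X \<subseteq> {..N} \<Longrightarrow> (\<forall>x\<in>X. norm (w x) = 1) \<Longrightarrow>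
      Dsum N m b X \<theta> w \<le> C2 * ln (real N) * (real (card X) + (real (card X))\<^sup>2 * real N powr (1 - gam - 9 / 100))"
    by (rule Dsum_no_sieve[OF gam]) (rule that; assumption)
  obtain C3 N3 where C3: "1 \<le> C3"
    "\<And>N m b X \<theta> w. N3 \<le> N \<Longrightarrow> valid_params N m b \<Longrightarrow> X \<subseteq> {..N} \<Longrightarrow> X \<noteq> {} \<Longrightarrow>
      real (card X) \<le> real N powr (1 / 1000) \<Longrightarrow> (\<forall>x\<in>X. norm (w x) = 1) \<Longrightarrow>
      Dsum N m b X \<theta> w \<le> C3 * real (card X) powr \<epsilon> * real (card X)"
    by (rule Dsum_sieve[OF gam \<epsilon>(1)]) (rule that; assumption)
  define N0 where "N0 = max (max N2 N3) 1"
  define C where "C = C1 * (real N0)\<^sup>2 + C3 + 2 * C2 * (1000 / \<epsilon>)"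
  have N0: "1 \<le> (real N0)\<^sup>2" by (simp add: N0_def)
  have "1 * 1 \<le> C1 * (real N0)\<^sup>2" using C1(1) N0 by (intro mult_mono) auto
  moreover have "0 \<le> 2 * C2 * (1000 / \<epsilon>)" using C2(1) \<epsilon>(1) by (intro mult_nonneg_nonneg) auto
  moreover have "C1 * 1 \<le> C1 * (real N0)\<^sup>2" using C1(1) N0 by (intro mult_left_mono) auto
  ultimately have CC: "1 \<le> C" "C1 * (real N0)\<^sup>2 \<le> C" "C1 \<le> C" "C3 \<le> C" "2 * C2 * (1000 / \<epsilon>) \<le> C"
    using C3(1) C1(1) unfolding C_def by linarith+
  have main: "\<alpha>\<^sup>2 \<le> C * (\<Sum>n\<in>Lam N m b. (norm (f n))\<^sup>2 * lam N m b n) * real (card X) powr (- \<tau>)"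
    if *: "valid_params N m b" "X \<subseteq> {..N}" "X \<noteq> {}" "0 \<le> \<alpha>"
      "\<And>x. x \<in> X \<Longrightarrow> \<alpha> \<le> norm (\<Sum>n\<in>Lam N m b. f n * of_real (lam N m b n) * ee (real n * (\<theta> + real x / real (N + 1))))"
    for N m b X \<theta> f \<alpha>
  proof -
    note vp = valid_params_bounds[OF *(1)]
    have N1: "1 \<le> real N" using vp by simp
    have finX: "finite X" using *(2) by (rule finite_subset) simp
    define J where "J = real (card X)"
    have J: "1 \<le> J" using *(3) finX by (simp add: J_def Suc_le_eq card_gt_0_iff)
    define F where "F = (\<Sum>n\<in>Lam N m b. (norm (f n))\<^sup>2 * lam N m b n)"
    have lam0: "0 \<le> lam N m b n" if "n \<in> Lam N m b" for n
      using lam_bound(1)[OF *(1) that order_refl] .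
    have F0: "0 \<le> F" unfolding F_def using lam0 by (intro sum_nonneg) auto
    have dual: "\<alpha>\<^sup>2 \<le> F * B"
      if B: "\<And>w. (\<And>x. x \<in> X \<Longrightarrow> norm (w x) = 1) \<Longrightarrow> Dsum N m b X \<theta> w \<le> B * J\<^sup>2" for B
    proof -
      have "(\<alpha> * J)\<^sup>2 \<le> F * (B * J\<^sup>2)"
        unfolding J_def F_def
        by (rule duality_bound[where \<xi> = "\<lambda>x. \<theta> + real x / real (N + 1)"])
          (use finX lam0 *(4,5) B in \<open>auto simp: Dsum_def J_def\<close>)
      hence "\<alpha>\<^sup>2 * J\<^sup>2 \<le> (F * B) * J\<^sup>2" by (simp add: power_mult_distrib)
      thus ?thesis using J by simp
    qed
    have fin: "\<alpha>\<^sup>2 \<le> C * F * J powr (- \<tau>)" if B: "\<alpha>\<^sup>2 \<le> F * B" "B \<le> C * J powr (- \<tau>)" for B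
      using B(1) mult_left_mono[OF B(2) F0] by (simp add: mult_ac)
    have triv: "\<alpha>\<^sup>2 \<le> F * (C1 * real N powr (1 - gam + \<epsilon>) / J)"
    proof (rule dual)
      fix w :: "nat \<Rightarrow> complex" assume "\<And>x. x \<in> X \<Longrightarrow> norm (w x) = 1"
      hence "Dsum N m b X \<theta> w \<le> C1 * real N powr (1 - gam + \<epsilon>) * J"
        unfolding J_def by (intro C1(2)[OF *(1,2)]) auto
      thus "Dsum N m b X \<theta> w \<le> C1 * real N powr (1 - gam + \<epsilon>) / J * J\<^sup>2"
        using J by (simp add: power2_eq_square)
    qed
    have Jt: "J powr a \<le> J powr (- \<tau>)" if "a \<le> - \<tau>" for a using that J by (intro powr_mono) auto
    have Jinv: "1 / J \<le> J powr (- \<tau>)"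
      using Jt[of "- 1"] \<tau>1 J by (simp add: powr_minus_divide)
    have "\<alpha>\<^sup>2 \<le> C * F * J powr (- \<tau>)"
    proof (cases "N < N0")
      case True
      have "real N powr (1 - gam + \<epsilon>) \<le> real N powr 2" using N1 gam \<epsilon> by (intro powr_mono) auto
      also have "\<dots> = (real N)\<^sup>2" using N1 by simp
      also have "\<dots> \<le> (real N0)\<^sup>2" using True by (intro power_mono) auto
      finally have "C1 * real N powr (1 - gam + \<epsilon>) \<le> C"
        using CC(2) C1(1) mult_left_mono[of "real N powr (1 - gam + \<epsilon>)" "(real N0)\<^sup>2" C1] by linarith
      hence "C1 * real N powr (1 - gam + \<epsilon>) * (1 / J) \<le> C * J powr (- \<tau>)"
        using Jinv CC(1) J by (intro mult_mono) auto
      thus ?thesis using triv by (intro fin[OF triv]) simp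
    next
      case False
      hence NN: "N2 \<le> N" "N3 \<le> N" by (auto simp: N0_def)
      show ?thesis
      proof (cases "J \<le> real N powr (1 / 1000)")
        case True
        have "\<alpha>\<^sup>2 \<le> F * (C3 * J powr \<epsilon> / J)"
        proof (rule dual)
          fix w :: "nat \<Rightarrow> complex" assume "\<And>x. x \<in> X \<Longrightarrow> norm (w x) = 1"
          hence "Dsum N m b X \<theta> w \<le> C3 * J powr \<epsilon> * J"
            using True unfolding J_def by (intro C3(2)[OF NN(2) *(1-3)]) auto
          thus "Dsum N m b X \<theta> w \<le> C3 * J powr \<epsilon> / J * J\<^sup>2"
            using J by (simp add: power2_eq_square)
        qed
        moreover have "C3 * J powr \<epsilon> / J \<le> C * J powr (- \<tau>)"
        proof -
          have "J powr \<epsilon> / J = J powr (\<epsilon> - 1)" using J by (simp add: powr_diff)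
          also have "\<dots> \<le> J powr (- \<tau>)" using \<epsilon> by (intro Jt) auto
          finally have "C3 * (J powr \<epsilon> / J) \<le> C * J powr (- \<tau>)"
            using CC C3(1) J by (intro mult_mono) auto
          thus ?thesis by simp
        qed
        ultimately show ?thesis by (rule fin)
      next
        case big: False
        define l where "l = ln (real N)"
        have ns: "\<alpha>\<^sup>2 \<le> F * (C2 * l * (1 / J + real N powr (- \<sigma>)))"
        proof (rule dual)
          fix w :: "nat \<Rightarrow> complex" assume w: "\<And>x. x \<in> X \<Longrightarrow> norm (w x) = 1"
          have "1 - gam - 9 / 100 = - \<sigma>" by (simp add: sigma_def)
          hence "Dsum N m b X \<theta> w \<le> C2 * l * (J + J\<^sup>2 * real N powr (- \<sigma>))"
            using C2(2)[OF NN(1) *(1,2), of w \<theta>] w by (simp add: J_def l_def)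
          also have "J + J\<^sup>2 * real N powr (- \<sigma>) = (1 / J + real N powr (- \<sigma>)) * J\<^sup>2"
            using J by (simp add: field_simps power2_eq_square)
          finally show "Dsum N m b X \<theta> w \<le> C2 * l * (1 / J + real N powr (- \<sigma>)) * J\<^sup>2" by simp
        qed
        show ?thesis
        proof (cases "J \<le> real N powr \<sigma>")
          case True
          have "real N powr (- \<sigma>) \<le> 1 / J"
            using True J N1 unfolding powr_minus_divide by (intro divide_left_mono mult_pos_pos) auto
          hence "C2 * l * (1 / J + real N powr (- \<sigma>)) \<le> C2 * l * (2 / J)"
            using C2(1) vp by (intro mult_left_mono) (auto simp: l_def)
          also have "l \<le> (real N powr (1 / 1000)) powr \<epsilon> * (1000 / \<epsilon>)"
            using ln_powr_bound[of "real N" "\<epsilon> / 1000"] N1 \<epsilon> by (simp add: l_def powr_powr)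
          also have "\<dots> \<le> J powr \<epsilon> * (1000 / \<epsilon>)"
            using big \<epsilon> by (intro mult_right_mono powr_mono2) auto
          finally have "C2 * l * (1 / J + real N powr (- \<sigma>)) \<le> C2 * (J powr \<epsilon> * (1000 / \<epsilon>)) * (2 / J)"
            using C2(1) J by (simp add: mult_left_mono mult_right_mono divide_right_mono)
          also have "\<dots> = 2 * C2 * (1000 / \<epsilon>) * J powr (\<epsilon> - 1)"
            using J by (simp add: powr_diff)
          also have "\<dots> \<le> C * J powr (- \<tau>)"
            using CC C2(1) \<epsilon> J by (intro mult_mono Jt) auto
          finally show ?thesis by (rule fin[OF ns])
        next
          case False
          show ?thesis
          proof (cases "J \<le> real N powr (9 / 100)")
            case True
            have "1 / J \<le> real N powr (- \<sigma>)"
              using False J N1 unfolding powr_minus_divide by (intro divide_left_mono mult_pos_pos) auto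
            hence "C2 * l * (1 / J + real N powr (- \<sigma>)) \<le> C2 * l * (2 * real N powr (- \<sigma>))"
              using C2(1) vp by (intro mult_left_mono) (auto simp: l_def)
            also have "\<dots> \<le> C2 * (real N powr \<epsilon> / \<epsilon>) * (2 * real N powr (- \<sigma>))"
              using C2(1) N1 \<epsilon> ln_powr_bound[of "real N" \<epsilon>]
              by (intro mult_right_mono mult_left_mono) (auto simp: l_def)
            also have "\<dots> = 2 * C2 * (1 / \<epsilon>) * real N powr (\<epsilon> - \<sigma>)"
              by (simp add: powr_diff powr_minus field_simps)
            also have "\<dots> \<le> C * J powr (- \<tau>)"
            proof (intro mult_mono)
              have "1 / \<epsilon> \<le> 1000 / \<epsilon>" using \<epsilon> by (intro divide_right_mono) auto
              hence "2 * C2 * (1 / \<epsilon>) \<le> 2 * C2 * (1000 / \<epsilon>)" using C2(1) by (intro mult_left_mono) auto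
              thus "2 * C2 * (1 / \<epsilon>) \<le> C" using CC by linarith
              have "real N powr (\<epsilon> - \<sigma>) = (real N powr (9 / 100)) powr ((\<epsilon> - \<sigma>) * (100 / 9))"
              proof -
                have "9 / 100 * ((\<epsilon> - \<sigma>) * (100 / 9)) = \<epsilon> - \<sigma>" by simp
                thus ?thesis by (simp only: powr_powr)
              qed
              also have "\<dots> \<le> J powr ((\<epsilon> - \<sigma>) * (100 / 9))"
                using True J \<epsilon> \<tau> by (intro powr_mono2') auto
              also have "\<dots> \<le> J powr (- \<tau>)" using \<epsilon> by (intro Jt) auto
              finally show "real N powr (\<epsilon> - \<sigma>) \<le> J powr (- \<tau>)" .
            qed (use CC in auto)
            finally show ?thesis by (rule fin[OF ns])
          next
            case large: False
            have "real N powr (1 - gam + \<epsilon>) = (real N powr (9 / 100)) powr ((1 - gam + \<epsilon>) * (100 / 9))"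
            proof -
              have "9 / 100 * ((1 - gam + \<epsilon>) * (100 / 9)) = 1 - gam + \<epsilon>" by simp
              thus ?thesis by (simp only: powr_powr)
            qed
            also have "\<dots> \<le> J powr ((1 - gam + \<epsilon>) * (100 / 9))"
              using large J \<epsilon> gam_bounds by (intro powr_mono2) auto
            finally have "real N powr (1 - gam + \<epsilon>) / J \<le> J powr ((1 - gam + \<epsilon>) * (100 / 9)) / J"
              using J by (intro divide_right_mono) auto
            also have "\<dots> = J powr ((1 - gam + \<epsilon>) * (100 / 9) - 1)" using J by (simp add: powr_diff)
            also have "\<dots> \<le> J powr (- \<tau>)" 
            proof (rule Jt)
              have "1 - gam + \<epsilon> \<le> 9 / 100 * (1 - \<tau>)" using \<epsilon>(4) by (simp add: sigma_def algebra_simps)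
              hence "(1 - gam + \<epsilon>) * (100 / 9) \<le> 9 / 100 * (1 - \<tau>) * (100 / 9)" by (rule mult_right_mono) simp
              also have "9 / 100 * (1 - \<tau>) * (100 / 9) = 1 - \<tau>" by simp
              finally show "(1 - gam + \<epsilon>) * (100 / 9) - 1 \<le> - \<tau>" by linarith
            qed
            finally have "C1 * (real N powr (1 - gam + \<epsilon>) / J) \<le> C * J powr (- \<tau>)"
              using CC C1(1) J by (intro mult_mono) auto
            thus ?thesis by (intro fin[OF triv]) simp
          qed
        qed
      qed
    qed
    thus ?thesis by (simp add: F_def J_def)
  qed
  show thesis using CC(1) main by (intro that[of C]) blast+
qed

lemma restriction_estimate:
  assumes gam: "15 / 16 \<le> gam" and r: "0 < r" "2 / r < (gam - 91 / 100) * (100 / 9)"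
  obtains C where "0 < C"
    "\<And>N m b f. valid_params N m b \<Longrightarrow> Lr_norm_torus r (T_op h x0 phi b m N f)
      \<le> C * real N powr (- 1 / r) * L2_norm_Lambda h x0 phi b m N f"
proof -
  \<comment> \<open>The midpoint is strictly between both limits: above \<open>2 / r\<close>, so
    that the series over the ranks converges, and below the limit required by
    \<open>level_set_bound\<close>.\<close>
  define \<tau> where "\<tau> = (2 / r + (gam - 91 / 100) * (100 / 9)) / 2"
  have \<tau>: "0 < \<tau>" "\<tau> < (gam - 91 / 100) * (100 / 9)" "2 / r < \<tau>"
  proof -
    have mid: "0 < (a + b) / 2 \<and> (a + b) / 2 < b \<and> a < (a + b) / 2" if "0 < a" "a < b" for a b :: real
      using that by auto
    have "0 < 2 / r" using r by simp
    from mid[OF this r(2)] show "0 < \<tau>" "\<tau> < (gam - 91 / 100) * (100 / 9)" "2 / r < \<tau>"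
      unfolding \<tau>_def by blast+
  qed
  obtain C where C: "1 \<le> C"
    "\<And>N m b X \<theta> f \<alpha>. valid_params N m b \<Longrightarrow> X \<subseteq> {..N} \<Longrightarrow> X \<noteq> {} \<Longrightarrow> 0 \<le> \<alpha> \<Longrightarrow>
      (\<forall>x\<in>X. \<alpha> \<le> norm (\<Sum>n\<in>Lam N m b. f n * of_real (lam N m b n) * ee (real n * (\<theta> + real x / real (N + 1))))) \<Longrightarrow>
      \<alpha>\<^sup>2 \<le> C * (\<Sum>n\<in>Lam N m b. (norm (f n))\<^sup>2 * lam N m b n) * real (card X) powr (- \<tau>)"
    by (rule level_set_bound[OF gam \<tau>(1,2)]) (rule that; assumption)
  have sm: "summable (\<lambda>j. real j powr (- (\<tau> * r / 2)))"
    using \<tau>(3) r(1) by (subst summable_real_powr_iff) (simp add: field_simps)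
  define K where "K = 1 + (\<Sum>j. real j powr (- (\<tau> * r / 2)))"
  have K: "(\<Sum>j=1..n. real j powr (- (\<tau> * r / 2))) \<le> K" for n
  proof -
    have "(\<Sum>j=1..n. real j powr (- (\<tau> * r / 2))) \<le> (\<Sum>j. real j powr (- (\<tau> * r / 2)))"
      by (rule sum_le_suminf[OF sm]) auto
    thus ?thesis by (simp add: K_def)
  qed
  have K1: "1 \<le> K" unfolding K_def using suminf_nonneg[OF sm] by simp
  have "Lr_norm_torus r (T_op h x0 phi b m N f)
      \<le> (sqrt C * K powr (1 / r)) * real N powr (- 1 / r) * L2_norm_Lambda h x0 phi b m N f"
    if v: "valid_params N m b" for N m b f
  proof -
    note vp = valid_params_bounds[OF v]
    define F where "F = (\<Sum>n\<in>Lam N m b. (norm (f n))\<^sup>2 * lam N m b n)"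
    have F0: "0 \<le> F" unfolding F_def
      using lam_bound(1)[OF v _ order_refl] by (intro sum_nonneg) auto
    have Top: "T_op h x0 phi b m N f \<xi> = (\<Sum>n\<in>Lam N m b. f n * of_real (lam N m b n) * ee (real n * \<xi>))" for \<xi>
      unfolding T_op_def ee_def cis_conv_exp by (intro sum.cong refl) (simp add: mult_ac)
    have B: "(\<Sum>j<N + 1. norm (T_op h x0 phi b m N f (\<theta> + real j / real (N + 1))) powr r)
        \<le> (C * F) powr (r / 2) * K" for \<theta>
    proof -
      have "(\<Sum>j\<in>{..<N + 1}. norm (T_op h x0 phi b m N f (\<theta> + real j / real (N + 1))) powr r)
          \<le> (C * F) powr (r / 2) * (\<Sum>j=1..card {..<N + 1}. real j powr (- (\<tau> * r / 2)))"
      proof (rule sum_powr_rank_le)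
        fix Y \<alpha> assume Y: "Y \<subseteq> {..<N + 1}" "Y \<noteq> {}" "0 \<le> \<alpha>"
          "\<And>x. x \<in> Y \<Longrightarrow> \<alpha> \<le> norm (T_op h x0 phi b m N f (\<theta> + real x / real (N + 1)))"
        have "Y \<subseteq> {..N}" using Y(1) by auto
        thus "\<alpha>\<^sup>2 \<le> C * F * real (card Y) powr (- \<tau>)"
          unfolding F_def using Y(4) by (intro C(2)[OF v _ Y(2,3)]) (simp_all only: Top, blast)
      qed (use C(1) F0 r in auto)
      also have "\<dots> \<le> (C * F) powr (r / 2) * K" by (intro mult_left_mono K) auto
      finally show ?thesis .
    qed
    have "continuous_on UNIV (T_op h x0 phi b m N f)"
      unfolding T_op_def by (intro continuous_intros)
    hence "Lr_norm_torus r (T_op h x0 phi b m N f) \<le> ((C * F) powr (r / 2) * K / real (N + 1)) powr (1 / r)"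
      by (rule Lr_norm_torus_le[OF _ r(1) _ B]) simp
    also have "\<dots> \<le> ((C * F) powr (r / 2) * K / real N) powr (1 / r)"
      using r K1 vp by (intro powr_mono2 divide_left_mono) auto
    also have "\<dots> = ((C * F) powr (r / 2)) powr (1 / r) * K powr (1 / r) / real N powr (1 / r)"
      using K1 vp by (simp add: powr_divide powr_mult)
    also have "((C * F) powr (r / 2)) powr (1 / r) = (C * F) powr (1 / 2)"
      using r(1) by (simp add: powr_powr)
    also have "\<dots> = sqrt C * sqrt F"
      using C(1) F0 by (simp add: powr_half_sqrt real_sqrt_mult)
    also have "sqrt C * sqrt F * K powr (1 / r) / real N powr (1 / r)
        = (sqrt C * K powr (1 / r)) * real N powr (- 1 / r) * sqrt F"
      by (simp add: powr_minus_divide)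
    also have "sqrt F = L2_norm_Lambda h x0 phi b m N f" by (simp add: L2_norm_Lambda_def F_def)
    finally show ?thesis .
  qed
  thus thesis using C(1) K1 by (intro that[of "sqrt C * K powr (1 / r)"]) auto
qed

end

theorem theorem4p3:
  fixes c \<gamma> x0 r :: real and h \<phi> :: "real \<Rightarrow> real"
  assumes "1 \<le> c" and "c < 16 / 15" and "\<gamma> = 1 / c"
    and "h \<in> F_class c x0"
    and "\<phi> = the_inv_into {x0..} h"
    and "r > (26 - 24 * \<gamma>) / (16 * \<gamma> - 15)"
  shows "\<exists>C>0. \<forall>(m::nat) (N::nat) (b::nat) (f :: nat \<Rightarrow> complex).
           1 \<le> N \<longrightarrow> 1 \<le> m \<longrightarrow> real m \<le> ln (real N) \<longrightarrow> b \<le> m - 1 \<longrightarrow> coprime b m \<longrightarrow>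
           Lr_norm_torus r (T_op h x0 \<phi> b m N f)
             \<le> C * real N powr (- 1 / r) * L2_norm_Lambda h x0 \<phi> b m N f"
proof -
  interpret ps_function c x0 h
    using assms by unfold_locales
  have gam: "gam = \<gamma>" using assms(3) by (simp add: gam_def)
  have phi: "phi = \<phi>" using assms(5) by (simp add: phi_def)
  have g: "15 / 16 < \<gamma>" "\<gamma> \<le> 1"
    using assms(1,2) unfolding assms(3) by (simp_all add: field_simps)
  \<comment> \<open>The left side is \<open>2 / \<tau>\<close> at the limiting \<tau>. Both sides
    are 2 at \<open>\<gamma> = 1\<close>, hence the factor \<open>1 - \<gamma>\<close> in the
    difference after clearing denominators; the other factor \<open>24 * \<gamma> - 524 / 25\<close>
    is positive for \<open>\<gamma> > 15/16\<close>, that is, for \<open>c < 16/15\<close>.\<close>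
  have "(9 / 50) / (\<gamma> - 91 / 100) \<le> (26 - 24 * \<gamma>) / (16 * \<gamma> - 15)"
  proof -
    have nn: "0 \<le> (1 - \<gamma>) * (24 * \<gamma> - 524 / 25)" using g by (intro mult_nonneg_nonneg) auto
    have "(9 / 50) * (16 * \<gamma> - 15) \<le> (26 - 24 * \<gamma>) * (\<gamma> - 91 / 100)"
    proof -
      have "(26 - 24 * \<gamma>) * (\<gamma> - 91 / 100) - (9 / 50) * (16 * \<gamma> - 15) = (1 - \<gamma>) * (24 * \<gamma> - 524 / 25)"
        by (simp add: field_simps)
      with nn show ?thesis by linarith
    qed
    thus ?thesis using g by (simp add: divide_simps)
  qed
  hence r: "(9 / 50) / (\<gamma> - 91 / 100) < r" using assms(6) by linarith
  have "0 < (9 / 50) / (\<gamma> - 91 / 100)" using g by simp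
  hence r0: "0 < r" using r by linarith
  have "9 / 50 < r * (\<gamma> - 91 / 100)" using r g by (simp add: divide_simps split: if_splits)
  hence r1: "2 / r < (gam - 91 / 100) * (100 / 9)" using r0 by (simp add: gam field_simps)
  have g': "15 / 16 \<le> gam" using g gam by simp
  obtain C where C: "0 < C"
    "\<And>N m b f. valid_params N m b \<Longrightarrow> Lr_norm_torus r (T_op h x0 phi b m N f)
      \<le> C * real N powr (- 1 / r) * L2_norm_Lambda h x0 phi b m N f"
    by (rule restriction_estimate[OF g' r0 r1]) (rule that; assumption)
  show ?thesis
  proof (intro exI[of _ C] conjI allI impI C(1))
    fix m N b :: nat and f :: "nat \<Rightarrow> complex"
    assume "1 \<le> m" "real m \<le> ln (real N)" "b \<le> m - 1"
    hence "valid_params N m b" by (auto simp: valid_params_def)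
    from C(2)[OF this] show "Lr_norm_torus r (T_op h x0 \<phi> b m N f)
             \<le> C * real N powr (- 1 / r) * L2_norm_Lambda h x0 \<phi> b m N f"
      by (simp only: phi)
  qed
qed

end
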